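(* There is a constant $C$ (independent of $\Omega$ and $V$) such that for any open set $\Omega\subset\mathbb{R}^2$ of finite measure and any real-valued $V\in L^{\mathcal B}(\Omega)$, $$ N(-\Delta_\Omega^D+V) \leq C\, \|V_-\|_{\mathcal B,\Omega} . $$
   Context: Let $\mathcal A(t):=e^{|t|}-1-|t|$ and $\mathcal B(t):=(1+|t|)\ln(1+|t|)-|t|$; these are convex functions which are Legendre transforms of each other. For a measurable set $\Omega\subset\mathbb{R}^2$ of positive and finite Lebesgue measure $|\Omega|$, $L^{\mathcal B}(\Omega)$ denotes the class of measurable functions $g:\Omega\to\mathbb{C}$ (modulo almost everywhere equality) for which $$ \|g\|_{\mathcal B,\Omega}:=\sup\left\{\left|\int_\Omega fg\,dx\right| :\ f:\Omega\to\mathbb{C}\ \text{measurable such that}\ \int_\Omega \mathcal A(f)\,dx\le|\Omega|\right\} $$ is finite. Here $\mathcal A(f)=e^{|f|}-1-|f|$ for complex-valued $f$. $V(x)_-:=\max\{0,-V(x)\}$ denotes the negative part of $V$. $-\Delta_\Omega^D$ denotes the Dirichlet Laplacian on $\Omega$, and $-\Delta_\Omega^D+V$ is the self-adjoint, lower semi-bounded Schrödinger operator in $L^2(\Omega)$ associated with the quadratic form $\int_\Omega(|\nabla u|^2+V|u|^2)\,dx$ defined for $u\in H^1_0(\Omega)$. $N(H)$ denotes the number of negative eigenvalues, counting multiplicities, of a self-adjoint lower semi-bounded operator $H$. *)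

theory Defs
  imports "HOL-Analysis.Analysis"
begin

section \<open>The Orlicz class $L^{\mathcal B}(\Omega)$\<close>

definition young_A :: "complex \<Rightarrow> real"
  where "young_A z = exp (cmod z) - 1 - cmod z"

text \<open>This is the dual norm for \<open>young_A\<close>, whose Legendre transform is
  $\mathcal B(t) = (1+|t|)\ln(1+|t|)-|t|$. The supremum is taken in the extended half-line. A test function \<open>f\<close> for which \<open>f g\<close> is not
  integrable contributes \<open>\<infinity>\<close>; this prevents the library convention that the integral of a
  non-integrable function is \<open>0\<close> from making the norm small.\<close>

definition norm_B :: "('a::euclidean_space) set \<Rightarrow> ('a \<Rightarrow> complex) \<Rightarrow> ennreal"
  where "norm_B \<Omega> g =
    (SUP f \<in> {f. f \<in> borel_measurable (lebesgue_on \<Omega>) \<and>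
                 (\<integral>\<^sup>+x. ennreal (young_A (f x)) \<partial>lebesgue_on \<Omega>) \<le> emeasure lebesgue \<Omega>}.
       if integrable (lebesgue_on \<Omega>) (\<lambda>x. f x * g x)
       then ennreal (cmod (LINT x|lebesgue_on \<Omega>. f x * g x))
       else \<infinity>)"

definition L_B :: "('a::euclidean_space) set \<Rightarrow> ('a \<Rightarrow> complex) set"
  where "L_B \<Omega> = {g. g \<in> borel_measurable (lebesgue_on \<Omega>) \<and> norm_B \<Omega> g < \<infinity>}"


section \<open>The Sobolev space $H^1_0(\Omega)$\<close>

text \<open>Elements of the function spaces below are functions, not classes modulo almost everywhere
  equality; all notions depend only on the values almost everywhere on \<open>\<Omega>\<close>.\<close>

definition L2 :: "('a::euclidean_space) set \<Rightarrow> ('a \<Rightarrow> complex) set"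
  where "L2 \<Omega> = {u. u \<in> borel_measurable (lebesgue_on \<Omega>) \<and>
                    integrable (lebesgue_on \<Omega>) (\<lambda>x. (cmod (u x))\<^sup>2)}"

primrec C_k :: "nat \<Rightarrow> ('a::real_normed_vector \<Rightarrow> 'b::real_normed_vector) \<Rightarrow> bool"
  where
    "C_k 0 f \<longleftrightarrow> continuous_on UNIV f"
  | "C_k (Suc k) f \<longleftrightarrow> (\<forall>x. f differentiable (at x)) \<and>
                       (\<forall>v. C_k k (\<lambda>x. frechet_derivative f (at x) v))"

definition test_fun :: "(real^'n) set \<Rightarrow> (real^'n \<Rightarrow> complex) set"
  where "test_fun \<Omega> = {\<phi>. (\<forall>k. C_k k \<phi>) \<and> compact (closure {x. \<phi> x \<noteq> 0}) \<and>
                          closure {x. \<phi> x \<noteq> 0} \<subseteq> \<Omega>}"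

definition partial_deriv :: "'n \<Rightarrow> (real^'n \<Rightarrow> complex) \<Rightarrow> real^'n \<Rightarrow> complex"
  where "partial_deriv i \<phi> x = frechet_derivative \<phi> (at x) (axis i 1)"

definition is_weak_grad :: "(real^'n) set \<Rightarrow> (real^'n \<Rightarrow> complex) \<Rightarrow> (real^'n \<Rightarrow> complex^'n) \<Rightarrow> bool"
  where "is_weak_grad \<Omega> u G \<longleftrightarrow>
    (\<forall>i. (\<lambda>x. G x $ i) \<in> L2 \<Omega>) \<and>
    (\<forall>\<phi>\<in>test_fun \<Omega>. \<forall>i.
       (LINT x|lebesgue_on \<Omega>. u x * partial_deriv i \<phi> x) =
       - (LINT x|lebesgue_on \<Omega>. G x $ i * \<phi> x))"

definition weak_grad :: "(real^'n) set \<Rightarrow> (real^'n \<Rightarrow> complex) \<Rightarrow> real^'n \<Rightarrow> complex^'n"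
  where "weak_grad \<Omega> u = (SOME G. is_weak_grad \<Omega> u G)"

definition H1 :: "(real^'n) set \<Rightarrow> (real^'n \<Rightarrow> complex) set"
  where "H1 \<Omega> = {u \<in> L2 \<Omega>. \<exists>G. is_weak_grad \<Omega> u G}"

definition H1_norm :: "(real^'n) set \<Rightarrow> (real^'n \<Rightarrow> complex) \<Rightarrow> real"
  where "H1_norm \<Omega> u =
    sqrt (LINT x|lebesgue_on \<Omega>. (norm (weak_grad \<Omega> u x))\<^sup>2 + (cmod (u x))\<^sup>2)"

definition H10 :: "(real^'n) set \<Rightarrow> (real^'n \<Rightarrow> complex) set"
  where "H10 \<Omega> = {u \<in> H1 \<Omega>. \<forall>\<epsilon>>0. \<exists>\<phi>\<in>test_fun \<Omega>. H1_norm \<Omega> (\<lambda>x. u x - \<phi> x) < \<epsilon>}"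


section \<open>The Schroedinger operator\<close>

text \<open>The sesquilinear form whose diagonal is $\int_\Omega (|\nabla u|^2 + V |u|^2)\,dx$.\<close>

definition schroedinger_form ::
    "(real^'n) set \<Rightarrow> (real^'n \<Rightarrow> real) \<Rightarrow> (real^'n \<Rightarrow> complex) \<Rightarrow> (real^'n \<Rightarrow> complex) \<Rightarrow> complex"
  where "schroedinger_form \<Omega> V u v =
    (LINT x|lebesgue_on \<Omega>.
       (\<Sum>i\<in>UNIV. weak_grad \<Omega> u x $ i * cnj (weak_grad \<Omega> v x $ i)) +
       complex_of_real (V x) * u x * cnj (v x))"

lemma schroedinger_form_diag:
  "schroedinger_form \<Omega> V u u =
     complex_of_real (LINT x|lebesgue_on \<Omega>. (norm (weak_grad \<Omega> u x))\<^sup>2 + V x * (cmod (u x))\<^sup>2)"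
proof -
  have "(\<Sum>i\<in>UNIV. weak_grad \<Omega> u x $ i * cnj (weak_grad \<Omega> u x $ i)) +
          complex_of_real (V x) * u x * cnj (u x) =
        complex_of_real ((norm (weak_grad \<Omega> u x))\<^sup>2 + V x * (cmod (u x))\<^sup>2)" for x
    by (simp add: norm_vec_def L2_set_def sum_nonneg mult.assoc flip: complex_norm_square)
  then show ?thesis
    by (simp add: schroedinger_form_def flip: integral_complex_of_real)
qed

text \<open>The graph of the operator that the first representation theorem associates with the form
  (with form domain $H^1_0(\Omega)$).\<close>

definition schroedinger_op ::
    "(real^'n) set \<Rightarrow> (real^'n \<Rightarrow> real) \<Rightarrow> ((real^'n \<Rightarrow> complex) \<times> (real^'n \<Rightarrow> complex)) set"
  where "schroedinger_op \<Omega> V = {(u, w). u \<in> H10 \<Omega> \<and> w \<in> L2 \<Omega> \<and>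
    (\<forall>v\<in>H10 \<Omega>. schroedinger_form \<Omega> V u v = (LINT x|lebesgue_on \<Omega>. w x * cnj (v x)))}"


section \<open>Counting negative eigenvalues\<close>

definition eigenspace :: "(('a \<Rightarrow> complex) \<times> ('a \<Rightarrow> complex)) set \<Rightarrow> real \<Rightarrow> ('a \<Rightarrow> complex) set"
  where "eigenspace H l = {u. (u, \<lambda>x. complex_of_real l * u x) \<in> H}"

text \<open>The complex dimension, modulo equality almost everywhere, of a space of functions.\<close>

definition ae_dim :: "'a measure \<Rightarrow> ('a \<Rightarrow> complex) set \<Rightarrow> ennreal"
  where "ae_dim M E =
    (SUP n \<in> {n. \<exists>u. (\<forall>i<n. u i \<in> E) \<and>
                     (\<forall>c. (AE x in M. (\<Sum>i<n. c i * u i x) = 0) \<longrightarrow> (\<forall>i<n. c i = 0))}.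
       of_nat n)"

text \<open>The sum over all real \<open>l < 0\<close> of the multiplicity of \<open>l\<close>, which is \<open>0\<close> unless \<open>l\<close> is an
  eigenvalue. A self-adjoint operator only has real eigenvalues.\<close>

definition num_neg_eigenvalues ::
    "'a measure \<Rightarrow> (('a \<Rightarrow> complex) \<times> ('a \<Rightarrow> complex)) set \<Rightarrow> ennreal"
  where "num_neg_eigenvalues M H = (\<Sum>\<^sub>\<infinity>l\<in>{..<0}. ae_dim M (eigenspace H l))"

definition neg_part :: "('a \<Rightarrow> real) \<Rightarrow> 'a \<Rightarrow> real"
  where "neg_part V x = max 0 (- V x)"

end

theory Submission
  imports Defs
begin

text \<open>The proof rests on a Trudinger inequality for whole families, in the spirit of Rumin's proof of
  the Cwikel--Lieb--Rozenblum bound: if \<open>u\<^sub>1, \<dots>, u\<^sub>n\<close> are orthonormal for the form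
  \<open>\<integral> \<bar>\<nabla>u\<bar>\<^sup>2 + E \<bar>u\<bar>\<^sup>2\<close> and \<open>\<rho> = \<Sum> \<bar>u\<^sub>j\<bar>\<^sup>2\<close>, then \<open>\<integral> E \<rho> exp (\<rho> / 64) \<le> 4 n\<close>. To see
  this, cut each \<open>u\<^sub>j\<close> at a frequency. By duality the density of the low frequencies is pointwise at
  most logarithmic in the cutoff, so where \<open>\<rho>\<close> is large the high frequencies carry a fixed share of
  it for exponentially many cutoffs; summed over all cutoffs, the high frequencies cost at most the
  Dirichlet energy.

  For a negative subspace of dimension \<open>n\<close> this gives \<open>n \<le> \<integral> (V\<^sub>- + E) \<rho>\<close>, where \<open>E\<close> is chosen
  as a multiple of the Orlicz norm of \<open>V\<^sub>-\<close> divided by the measure of the domain. The exponential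
  bound on \<open>\<rho>\<close> makes a multiple of \<open>\<rho>\<close> admissible in the Orlicz norm and lets both terms
  be absorbed. No covering of the domain is needed, so the constant does not depend on it.\<close>

section \<open>Integration by parts and test functions\<close>

text \<open>The logarithm comes from the plane: the low-frequency density at a point is bounded by
  the diagonal of a truncated resolvent kernel of \<open>- \<Delta> + E\<close>, and the sum of
  \<open>1 / (\<bar>k\<bar>\<^sup>2 + l)\<close> over a two-dimensional lattice diverges only
  logarithmically. Normalising in the energy form, not in \<open>L2\<close>, lets one bound serve
  the whole family: a unit vector of coefficients gives a function of energy at most one, so the
  estimate for a single function bounds the density with no factor \<open>n\<close>. The mass term
  \<open>E\<close> tames the zero frequency, which the gradient does not see. Frequencies come from
  Fourier series on a square large enough to hold all supports, and its side cancels at the end. The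
  rate 64 is 8 times 8: one factor from the lattice shells, the other from asking the low
  frequencies to carry at most a quarter of \<open>\<rho>\<close>.

  The obstacle in leaving test functions is that \<open>weak_grad\<close> is an arbitrary choice, so
  its additivity is directly visible only after integration against test functions; functions are
  therefore carried together with a prescribed gradient.\<close>

text \<open>Difference quotients of a function that vanishes off a bounded set have integral zero by
  translation invariance, and dominated convergence passes this on to the directional
  derivative.\<close>

lemma integral_derivative_compact_support:
  fixes g :: "'a::euclidean_space \<Rightarrow> complex"
  assumes der: "\<And>x. (g has_derivative g' x) (at x)"
    and cont: "continuous_on UNIV (\<lambda>x. g' x e)"
    and S: "bounded S" "\<And>x. x \<notin> S \<Longrightarrow> g x = 0"
  shows "(LINT x|lborel. g' x e) = 0"
proof -
  obtain R where R: "\<And>x. x \<in> S \<Longrightarrow> norm x \<le> R"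
    using S(1) by (auto simp: bounded_iff)
  \<comment> \<open>The extra \<open>norm e + 1\<close> leaves room for the shifts by at most
    \<open>norm e\<close>: every difference quotient vanishes off \<open>K\<close>, so a multiple of
    its indicator dominates them all.\<close>
  define K where "K = cball (0::'a) (R + norm e + 1)"
  have g0: "g x = 0" if "norm x > R" for x
    using R[of x] S(2)[of x] that by force
  have contg: "continuous_on UNIV g"
    using der by (meson continuous_at_imp_continuous_on has_derivative_continuous)
  have "compact ((\<lambda>x. norm (g' x e)) ` K)"
    by (intro compact_continuous_image continuous_on_norm continuous_on_subset[OF cont])
       (auto simp: K_def)
  then obtain B0 where B0: "\<And>x. x \<in> K \<Longrightarrow> norm (g' x e) \<le> B0"
    by (force dest!: compact_imp_bounded simp: bounded_iff)
  define B where "B = max 0 B0"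
  have g'0: "g' x e = 0" if "norm x > R" for x
  proof -
    have "((\<lambda>_. 0) has_derivative (\<lambda>_. 0)) (at x)" by simp
    then have "(g has_derivative (\<lambda>_. 0)) (at x)"
    proof (rule has_derivative_transform_within_open)
      show "open {y::'a. norm y > R}" by (intro open_Collect_less) (auto intro: continuous_intros)
    qed (use that g0 in auto)
    then show ?thesis using der[of x] has_derivative_unique by metis
  qed
  have bnd: "norm (g' x e) \<le> B" for x
  proof (cases "x \<in> K")
    case False
    then have "norm x > R" using norm_ge_zero[of e] unfolding K_def mem_cball_0 by linarith
    then show ?thesis using g'0[of x] by (simp add: B_def)
  qed (use B0[of x] in \<open>auto simp: B_def\<close>)
  define D where "D n x = real (Suc n) *\<^sub>R (g (x + (1 / real (Suc n)) *\<^sub>R e) - g x)" for n x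
  have curve: "((\<lambda>t. g (x + t *\<^sub>R e)) has_vector_derivative g' (x + t *\<^sub>R e) e) (at t)" for x t
  proof -
    have 1: "((\<lambda>t. x + t *\<^sub>R e) has_vector_derivative e) (at t)"
      by (auto intro!: derivative_eq_intros simp: has_vector_derivative_def)
    show ?thesis
      using vector_derivative_diff_chain_within[OF 1 has_derivative_at_withinI[OF der]]
      by (simp add: o_def)
  qed
  have limD: "(\<lambda>n. D n x) \<longlonglongrightarrow> g' x e" for x
  proof -
    have "((\<lambda>h. norm (g (x + h *\<^sub>R e) - g x - h *\<^sub>R g' x e) / norm h) \<longlongrightarrow> 0) (at 0)"
      using curve[of x 0] unfolding has_vector_derivative_def has_derivative_at by simp
    moreover have "filterlim (\<lambda>n. 1 / real (Suc n)) (at 0) sequentially"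
      using LIMSEQ_Suc[OF lim_1_over_n] by (auto simp: filterlim_at)
    ultimately have "(\<lambda>n. norm (g (x + (1 / real (Suc n)) *\<^sub>R e) - g x - (1 / real (Suc n)) *\<^sub>R g' x e)
        / norm (1 / real (Suc n))) \<longlonglongrightarrow> 0"
      by (rule filterlim_compose)
    moreover have "norm (g (x + (1 / real (Suc n)) *\<^sub>R e) - g x - (1 / real (Suc n)) *\<^sub>R g' x e)
        / norm (1 / real (Suc n)) = norm (D n x - g' x e)" for n
    proof -
      have "D n x - g' x e = real (Suc n) *\<^sub>R
          (g (x + (1 / real (Suc n)) *\<^sub>R e) - g x - (1 / real (Suc n)) *\<^sub>R g' x e)"
        by (simp add: D_def scaleR_diff_right del: of_nat_Suc)
      then show ?thesis by (simp only: norm_scaleR) (simp add: field_simps del: of_nat_Suc)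
    qed
    ultimately show ?thesis by (simp add: tendsto_norm_zero_iff LIM_zero_iff)
  qed
  have Dbnd: "norm (D n x) \<le> B * indicat_real K x" for n x
  proof (cases "x \<in> K")
    case True
    have "norm (g (x + (1 / real (Suc n)) *\<^sub>R e) - g (x + 0 *\<^sub>R e)) \<le> B * norm (1 / real (Suc n) - 0)"
    proof (rule differentiable_bound[where S=UNIV and f="\<lambda>t. g (x + t *\<^sub>R e)"
          and f'="\<lambda>t s. s *\<^sub>R g' (x + t *\<^sub>R e) e"])
      show "onorm (\<lambda>s. s *\<^sub>R g' (x + t *\<^sub>R e) e) \<le> B" for t
        using bnd by (intro onorm_le) (simp add: mult.commute[of B] mult_left_mono)
    qed (use curve in \<open>auto simp: has_vector_derivative_def\<close>)
    then have "real (Suc n) * norm (g (x + (1 / real (Suc n)) *\<^sub>R e) - g x) \<le> B"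
      by (simp add: field_simps del: of_nat_Suc)
    then show ?thesis using True by (simp add: D_def del: of_nat_Suc)
  next
    case False
    have "norm ((1 / real (Suc n)) *\<^sub>R e) \<le> norm e"
      by (simp add: divide_le_eq mult_le_cancel_left1)
    moreover have "norm x \<le> norm (x + (1 / real (Suc n)) *\<^sub>R e) + norm ((1 / real (Suc n)) *\<^sub>R e)"
      using norm_triangle_ineq4[of "x + (1 / real (Suc n)) *\<^sub>R e" "(1 / real (Suc n)) *\<^sub>R e"] by simp
    ultimately have "norm x > R" "norm (x + (1 / real (Suc n)) *\<^sub>R e) > R"
      using False norm_ge_zero[of e] unfolding K_def mem_cball_0 by linarith+
    then show ?thesis using False g0 by (simp add: D_def)
  qed
  have intg: "integrable lborel g"
  proof -
    have "integrable lborel (\<lambda>x. indicator K x *\<^sub>R g x)"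
      by (intro borel_integrable_compact continuous_on_subset[OF contg]) (auto simp: K_def)
    moreover have "indicator K x *\<^sub>R g x = g x" for x
    proof (cases "x \<in> K")
      case False
      then have "norm x > R" using norm_ge_zero[of e] unfolding K_def mem_cball_0 by linarith
      then show ?thesis using g0 by simp
    qed simp
    ultimately show ?thesis by simp
  qed
  have gm: "g \<in> borel_measurable borel" using contg by (rule borel_measurable_continuous_onI)
  have intg2: "integrable lborel (\<lambda>x. g (x + a))" "(LINT x|lborel. g (x + a)) = (LINT x|lborel. g x)" for a
  proof -
    have "integrable (distr lborel borel ((+) a)) g" "(LINT x|distr lborel borel ((+) a). g x) = (LINT x|lborel. g x)"
      using intg by (simp_all add: lborel_distr_plus)
    then show "integrable lborel (\<lambda>x. g (x + a))" "(LINT x|lborel. g (x + a)) = (LINT x|lborel. g x)"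
      using gm by (simp_all add: integrable_distr_eq integral_distr add.commute)
  qed
  have D0: "(LINT x|lborel. D n x) = 0" for n
    unfolding D_def using intg intg2 by (simp add: )
  have "(\<lambda>n. LINT x|lborel. D n x) \<longlonglongrightarrow> (LINT x|lborel. g' x e)"
  proof (rule integral_dominated_convergence)
    show "integrable lborel (\<lambda>x. B * indicat_real K x)"
      using borel_integrable_compact[of K "\<lambda>_. B"] by (simp add: K_def mult.commute)
  qed (use limD Dbnd contg cont in \<open>auto simp: D_def intro!: borel_measurable_continuous_onI continuous_intros continuous_on_compose2[OF contg]\<close>)
  then show ?thesis unfolding D0 by (simp add: LIMSEQ_const_iff)
qed

lemma integrable_continuous_compact_support:
  fixes f :: "'a::euclidean_space \<Rightarrow> 'b::{banach, second_countable_topology}"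
  assumes "continuous_on UNIV f" "compact K" "\<And>x. x \<notin> K \<Longrightarrow> f x = 0"
  shows "integrable lborel f"
proof -
  have "integrable lborel (\<lambda>x. indicator K x *\<^sub>R f x)"
    using assms by (intro borel_integrable_compact) (auto intro: continuous_on_subset)
  moreover have "(\<lambda>x. indicator K x *\<^sub>R f x) = f"
    using assms(3) by (auto simp: indicator_def fun_eq_iff)
  ultimately show ?thesis by simp
qed

lemma has_derivative_zero_outside_closed:
  fixes f :: "'a::real_normed_vector \<Rightarrow> 'b::real_normed_vector"
  assumes "closed K" "\<And>x. x \<notin> K \<Longrightarrow> f x = 0" "x \<notin> K" "(f has_derivative f') (at x)"
  shows "f' e = 0"
proof -
  have "((\<lambda>_. 0) has_derivative (\<lambda>_. 0)) (at x)" by simp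
  then have "(f has_derivative (\<lambda>_. 0)) (at x)"
  proof (rule has_derivative_transform_within_open)
    show "open (- K)" using assms by auto
  qed (use assms in auto)
  then show ?thesis using assms(4) has_derivative_unique by metis
qed

text \<open>Compact support is asked of \<open>f\<close> alone, which lets \<open>g\<close> be a
  plane wave when Fourier coefficients of derivatives are computed.\<close>

lemma integral_by_parts_compact_support:
  fixes f g :: "'a::euclidean_space \<Rightarrow> complex"
  assumes f: "\<And>x. (f has_derivative f' x) (at x)" "continuous_on UNIV (\<lambda>x. f' x e)"
    and g: "\<And>x. (g has_derivative g' x) (at x)" "continuous_on UNIV (\<lambda>x. g' x e)"
    and K: "compact K" "\<And>x. x \<notin> K \<Longrightarrow> f x = 0"
  shows "(LINT x|lborel. f x * g' x e) = - (LINT x|lborel. f' x e * g x)"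
proof -
  have cf: "continuous_on UNIV f" and cg: "continuous_on UNIV g"
    using f g by (meson continuous_at_imp_continuous_on has_derivative_continuous)+
  have f'0: "f' x e = 0" if "x \<notin> K" for x
    using has_derivative_zero_outside_closed[OF compact_imp_closed K(2) that f(1)] K(1) by blast
  have 1: "integrable lborel (\<lambda>x. f x * g' x e)"
    by (rule integrable_continuous_compact_support[OF continuous_on_mult[OF cf g(2)] K(1)]) (simp add: K(2))
  have 2: "integrable lborel (\<lambda>x. f' x e * g x)"
    by (rule integrable_continuous_compact_support[OF continuous_on_mult[OF f(2) cg] K(1)]) (simp add: f'0)
  have "(LINT x|lborel. f x * g' x e + f' x e * g x) = 0"
  proof (rule integral_derivative_compact_support)
    show "((\<lambda>x. f x * g x) has_derivative (\<lambda>e. f x * g' x e + f' x e * g x)) (at x)" for x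
      by (rule has_derivative_mult[OF f(1) g(1)])
    show "continuous_on UNIV (\<lambda>x. f x * g' x e + f' x e * g x)"
      by (intro continuous_on_add continuous_on_mult cf cg f(2) g(2))
    show "f x * g x = 0" if "x \<notin> K" for x using K(2)[OF that] by simp
  qed (rule compact_imp_bounded[OF K(1)])
  then show ?thesis
    using 1 2 by (simp add: eq_neg_iff_add_eq_0)
qed

section \<open>Algebra and calculus of test functions\<close>

lemma frechet_derivative_bounded_linear:
  assumes "bounded_linear L" "f differentiable (at x)"
  shows "frechet_derivative (\<lambda>x. L (f x)) (at x) = (\<lambda>v. L (frechet_derivative f (at x) v))"
  by (rule frechet_derivative_at[symmetric],
      rule bounded_linear.has_derivative[OF assms(1) assms(2)[unfolded frechet_derivative_works]])

lemma frechet_derivative_add: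
  assumes "f differentiable (at x)" "g differentiable (at x)"
  shows "frechet_derivative (\<lambda>x. f x + g x) (at x)
    = (\<lambda>v. frechet_derivative f (at x) v + frechet_derivative g (at x) v)"
  by (rule frechet_derivative_at[symmetric], rule has_derivative_add[OF assms[unfolded frechet_derivative_works]])

lemma C_k_bounded_linear:
  assumes L: "bounded_linear L"
  shows "C_k k f \<Longrightarrow> C_k k (\<lambda>x. L (f x))"
proof (induction k arbitrary: f)
  case 0
  then show ?case using L by (auto intro: bounded_linear.continuous_on)
next
  case (Suc k)
  then have "frechet_derivative (\<lambda>x. L (f x)) (at x) v = L (frechet_derivative f (at x) v)" for x v
    by (subst frechet_derivative_bounded_linear[OF L]) simp_all
  moreover have "(\<lambda>x. L (f x)) differentiable (at x)" for x
  proof -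
    obtain D where "(f has_derivative D) (at x)" using Suc.prems by (auto simp: differentiable_def)
    then show ?thesis
      by (rule differentiableI[OF bounded_linear.has_derivative[OF L]])
  qed
  ultimately show ?case using Suc by simp
qed

lemma C_k_add: "C_k k f \<Longrightarrow> C_k k g \<Longrightarrow> C_k k (\<lambda>x. f x + g x)"
proof (induction k arbitrary: f g)
  case (Suc k)
  then have "frechet_derivative (\<lambda>x. f x + g x) (at x) v
      = frechet_derivative f (at x) v + frechet_derivative g (at x) v" for x v
    by (subst frechet_derivative_add) simp_all
  then show ?case using Suc by simp
qed (auto intro: continuous_intros)

lemma C_k_zero: "C_k k (\<lambda>x. 0)"
  by (induction k) auto

lemma test_funI:
  assumes "\<And>k. C_k k \<phi>" "compact K" "K \<subseteq> \<Omega>" "\<And>x. x \<notin> K \<Longrightarrow> \<phi> x = 0"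
  shows "\<phi> \<in> test_fun \<Omega>"
proof -
  have sub: "closure {x. \<phi> x \<noteq> 0} \<subseteq> K"
    using assms by (intro closure_minimal) (auto intro: compact_imp_closed)
  then have "closure {x. \<phi> x \<noteq> 0} = K \<inter> closure {x. \<phi> x \<noteq> 0}" by blast
  then have "compact (closure {x. \<phi> x \<noteq> 0})"
    using compact_Int_closed[OF assms(2) closed_closure] by metis
  then show ?thesis
    using assms(1,3) sub by (auto simp: test_fun_def)
qed

lemma test_fun_support:
  assumes "\<phi> \<in> test_fun \<Omega>"
  shows "\<exists>K. compact K \<and> K \<subseteq> \<Omega> \<and> (\<forall>x. x \<notin> K \<longrightarrow> \<phi> x = 0)"
  using assms closure_subset[of "{x. \<phi> x \<noteq> 0}"]
  by (intro exI[of _ "closure {x. \<phi> x \<noteq> 0}"]) (auto simp: test_fun_def)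

lemma test_fun_C_k: "\<phi> \<in> test_fun \<Omega> \<Longrightarrow> C_k k \<phi>"
  by (simp add: test_fun_def)

lemma test_fun_outside: "\<phi> \<in> test_fun \<Omega> \<Longrightarrow> x \<notin> \<Omega> \<Longrightarrow> \<phi> x = 0"
  using test_fun_support by blast

lemma test_fun_bounded_linear:
  assumes "bounded_linear L" "\<phi> \<in> test_fun \<Omega>"
  shows "(\<lambda>x. L (\<phi> x)) \<in> test_fun \<Omega>"
proof -
  obtain K where "compact K" "K \<subseteq> \<Omega>" "\<forall>x. x \<notin> K \<longrightarrow> \<phi> x = 0"
    using test_fun_support[OF assms(2)] by blast
  then show ?thesis
    using C_k_bounded_linear[OF assms(1) test_fun_C_k[OF assms(2)]] linear_0[OF bounded_linear.linear[OF assms(1)]]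
    by (intro test_funI[of _ K]) auto
qed

lemma test_fun_cnj: "\<phi> \<in> test_fun \<Omega> \<Longrightarrow> (\<lambda>x. cnj (\<phi> x)) \<in> test_fun \<Omega>"
  by (rule test_fun_bounded_linear[OF bounded_linear_cnj])

lemma test_fun_cmult: "\<phi> \<in> test_fun \<Omega> \<Longrightarrow> (\<lambda>x. c * \<phi> x) \<in> test_fun \<Omega>"
  by (rule test_fun_bounded_linear[OF bounded_linear_mult_right])

lemma test_fun_add:
  assumes "\<phi> \<in> test_fun \<Omega>" "\<psi> \<in> test_fun \<Omega>"
  shows "(\<lambda>x. \<phi> x + \<psi> x) \<in> test_fun \<Omega>"
proof -
  obtain K where K: "compact K" "K \<subseteq> \<Omega>" "\<And>x. x \<notin> K \<Longrightarrow> \<phi> x = 0"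
    using test_fun_support[OF assms(1)] by blast
  obtain K' where K': "compact K'" "K' \<subseteq> \<Omega>" "\<And>x. x \<notin> K' \<Longrightarrow> \<psi> x = 0"
    using test_fun_support[OF assms(2)] by blast
  show ?thesis
    using K K' C_k_add[OF test_fun_C_k[OF assms(1)] test_fun_C_k[OF assms(2)]]
    by (intro test_funI[of _ "K \<union> K'"]) auto
qed

lemma test_fun_sum:
  "finite I \<Longrightarrow> (\<And>i. i \<in> I \<Longrightarrow> \<phi> i \<in> test_fun \<Omega>) \<Longrightarrow> (\<lambda>x. \<Sum>i\<in>I. c i * \<phi> i x) \<in> test_fun \<Omega>"
proof (induction I rule: finite_induct)
  case empty
  show ?case by (auto intro: test_funI[of _ "{}"] C_k_zero)
next
  case (insert a I)
  have "(\<lambda>x. c a * \<phi> a x + (\<Sum>i\<in>I. c i * \<phi> i x)) \<in> test_fun \<Omega>"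
    by (rule test_fun_add[OF test_fun_cmult]) (use insert in auto)
  then show ?case using insert by simp
qed

lemma test_fun_differentiable: "\<phi> \<in> test_fun \<Omega> \<Longrightarrow> \<phi> differentiable (at x)"
  using test_fun_C_k[of \<phi> \<Omega> "Suc 0"] by simp

lemma test_fun_has_derivative:
  "\<phi> \<in> test_fun \<Omega> \<Longrightarrow> (\<phi> has_derivative frechet_derivative \<phi> (at x)) (at x)"
  using test_fun_differentiable frechet_derivative_works by blast

lemma test_fun_continuous: "\<phi> \<in> test_fun \<Omega> \<Longrightarrow> continuous_on A \<phi>"
  using test_fun_C_k[of \<phi> \<Omega> 0] continuous_on_subset[of UNIV \<phi> A] by simp

lemma test_fun_partial_deriv:
  assumes "\<phi> \<in> test_fun \<Omega>"
  shows "partial_deriv i \<phi> \<in> test_fun \<Omega>"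
proof -
  obtain K where K: "compact K" "K \<subseteq> \<Omega>" "\<And>x. x \<notin> K \<Longrightarrow> \<phi> x = 0"
    using test_fun_support[OF assms] by blast
  have "C_k k (partial_deriv i \<phi>)" for k
    using test_fun_C_k[OF assms, of "Suc k"] by (simp add: partial_deriv_def[abs_def])
  moreover have "partial_deriv i \<phi> x = 0" if "x \<notin> K" for x
    unfolding partial_deriv_def
    by (rule has_derivative_zero_outside_closed[OF compact_imp_closed[OF K(1)] K(3) that
          test_fun_has_derivative[OF assms]])
  ultimately show ?thesis
    by (rule test_funI[OF _ K(1,2)])
qed

lemma partial_deriv_cmult:
  "\<phi> \<in> test_fun \<Omega> \<Longrightarrow> partial_deriv i (\<lambda>x. c * \<phi> x) x = c * partial_deriv i \<phi> x"
  unfolding partial_deriv_def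
  by (subst frechet_derivative_bounded_linear[OF bounded_linear_mult_right]) (auto intro: test_fun_differentiable)

lemma partial_deriv_sum:
  "finite I \<Longrightarrow> (\<And>i. i \<in> I \<Longrightarrow> \<phi> i \<in> test_fun \<Omega>) \<Longrightarrow>
    partial_deriv j (\<lambda>x. \<Sum>i\<in>I. c i * \<phi> i x) x = (\<Sum>i\<in>I. c i * partial_deriv j (\<phi> i) x)"
proof (induction I rule: finite_induct)
  case empty
  show ?case by (simp add: partial_deriv_def)
next
  case (insert a I)
  have "partial_deriv j (\<lambda>x. c a * \<phi> a x + (\<Sum>i\<in>I. c i * \<phi> i x)) x
      = partial_deriv j (\<lambda>x. c a * \<phi> a x) x + partial_deriv j (\<lambda>x. \<Sum>i\<in>I. c i * \<phi> i x) x"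
    using insert test_fun_sum[of I \<phi> \<Omega> c] test_fun_cmult[of "\<phi> a" \<Omega> "c a"]
    by (simp add: partial_deriv_def frechet_derivative_add test_fun_differentiable[where \<Omega>=\<Omega>])
  then show ?case using insert partial_deriv_cmult[of "\<phi> a" \<Omega> j "c a" x] by simp
qed

lemma test_fun_by_parts:
  assumes "\<phi> \<in> test_fun \<Omega>" "\<psi> \<in> test_fun \<Omega>'"
  shows "(LINT x|lborel. \<phi> x * partial_deriv i \<psi> x) = - (LINT x|lborel. partial_deriv i \<phi> x * \<psi> x)"
proof -
  obtain K where K: "compact K" "\<And>x. x \<notin> K \<Longrightarrow> \<phi> x = 0"
    using test_fun_support[OF assms(1)] by blast
  show ?thesis
    unfolding partial_deriv_def
    by (rule integral_by_parts_compact_support[OF test_fun_has_derivative[OF assms(1)] _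
          test_fun_has_derivative[OF assms(2)] _ K])
       (use test_fun_continuous[OF test_fun_partial_deriv[OF assms(1)], of UNIV i]
         test_fun_continuous[OF test_fun_partial_deriv[OF assms(2)], of UNIV i]
         in \<open>simp_all add: partial_deriv_def[abs_def]\<close>)
qed

section \<open>Fourier series on a square\<close>

text \<open>Coordinates that carry integrals over \<open>real^2\<close> to
  \<open>real \<times> real\<close>, where Fubini splits a wave into its two one-dimensional
  factors.\<close>

definition vec2 :: "real \<times> real \<Rightarrow> real^2"
  where "vec2 p = (\<chi> i. if i = 1 then fst p else snd p)"

lemma vec2_nth [simp]: "vec2 p $ 1 = fst p" "vec2 p $ 2 = snd p"
  by (simp_all add: vec2_def)

lemma continuous_on_vec2: "continuous_on A vec2"
proof -
  have "continuous_on A (\<lambda>p. if i = 1 then fst p else snd p)" for i :: 2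
    by (cases "i = 1") (auto intro!: continuous_intros)
  then show ?thesis unfolding vec2_def by (intro continuous_on_vec_lambda)
qed

lemma borel_measurable_vec2 [measurable]: "vec2 \<in> borel \<rightarrow>\<^sub>M borel"
  by (intro borel_measurable_continuous_onI continuous_on_vec2)

lemma Basis_vec2: "(Basis :: (real^2) set) = {axis 1 1, axis 2 1}"
  by (auto simp: Basis_vec_def UNIV_2)

lemma lborel_distr_vec2: "distr lborel borel vec2 = lborel"
proof (rule lborel_eqI[symmetric])
  fix l u :: "real^2"
  assume le: "\<And>b. b \<in> Basis \<Longrightarrow> l \<bullet> b \<le> u \<bullet> b"
  have ax: "axis 1 1 \<noteq> (axis 2 1 :: real^2)"
    by (simp add: axis_eq_axis)
  have vi: "vec2 -` box l u = box (l $ 1, l $ 2) (u $ 1, u $ 2)"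
    by (auto simp: mem_box_cart forall_2 mem_box Basis_prod_def)
  have "emeasure (distr lborel borel vec2) (box l u) = emeasure lborel (box (l $ 1, l $ 2) (u $ 1, u $ 2))"
    by (simp add: emeasure_distr vi)
  also have "\<dots> = (\<Prod>b\<in>Basis. ((u $ 1, u $ 2) - (l $ 1, l $ 2)) \<bullet> b)"
    using le[of "axis 1 1"] le[of "axis 2 1"]
    by (intro emeasure_lborel_box) (auto simp: Basis_prod_def inner_axis)
  also have "(\<Prod>b\<in>Basis. ((u $ 1, u $ 2) - (l $ 1, l $ 2)) \<bullet> b) = (\<Prod>b\<in>Basis. (u - l) \<bullet> b)"
    by (subst Basis_vec2, simp add: Basis_prod_def ax inner_axis)
  finally show "emeasure (distr lborel borel vec2) (box l u) = (\<Prod>b\<in>Basis. (u - l) \<bullet> b)" .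
qed simp

lemma integral_vec2:
  fixes f :: "real^2 \<Rightarrow> complex"
  assumes [measurable]: "f \<in> borel_measurable borel"
  shows "(LINT x|lborel. f x) = (LINT p|lborel. f (vec2 p))"
proof -
  have "(LINT x|lborel. f x) = (LINT x|distr lborel borel vec2. f x)"
    by (simp add: lborel_distr_vec2)
  also have "\<dots> = (LINT p|lborel. f (vec2 p))"
    by (intro integral_distr) auto
  finally show ?thesis .
qed

section \<open>Plane waves and their orthogonality\<close>

definition wave :: "real \<Rightarrow> int \<times> int \<Rightarrow> real^2 \<Rightarrow> complex"
  where "wave L k x = cis (2 * pi * (of_int (fst k) * x $ 1 + of_int (snd k) * x $ 2) / L)"

definition cell :: "real \<Rightarrow> (real^2) measure"
  where "cell L = restrict_space lborel (cbox (\<chi> i. - (L / 2)) (\<chi> i. L / 2))"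

lemma norm_wave [simp]: "cmod (wave L k x) = 1"
  by (simp add: wave_def)

lemma wave_zero [simp]: "wave L (0, 0) x = 1"
  by (simp add: wave_def)

lemma wave_mult: "wave L j x * wave L k x = wave L (j + k) x"
  by (simp add: wave_def cis_mult add_divide_distrib[symmetric] algebra_simps)

lemma cnj_wave: "cnj (wave L k x) = wave L (- k) x"
  unfolding wave_def cis_cnj by (rule arg_cong[of _ _ cis]) (simp add: divide_inverse algebra_simps)

lemma continuous_on_wave: "continuous_on A (wave L k)"
  unfolding wave_def[abs_def] cis_conv_exp divide_inverse by (intro continuous_intros)

lemma borel_measurable_wave [measurable]: "wave L k \<in> borel_measurable borel"
  by (intro borel_measurable_continuous_onI continuous_on_wave)

lemma mem_cell: "x \<in> cbox (\<chi> i. - (L / 2)) (\<chi> i. L / 2) \<longleftrightarrow> (\<forall>i. - (L / 2) \<le> x $ i \<and> x $ i \<le> (L::real) / 2)"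
  by (simp add: mem_box_cart)

lemma integrable_cell:
  fixes f :: "real^2 \<Rightarrow> 'b::{banach, second_countable_topology}"
  assumes "continuous_on UNIV f"
  shows "integrable (cell L) f"
  unfolding cell_def
  by (subst integrable_restrict_space)
     (auto intro!: borel_integrable_compact continuous_on_subset[OF assms])

lemma integral_cis:
  assumes "L > 0"
  shows "(LINT t|lborel. indicator {- (L / 2)..L / 2} t *\<^sub>R cis (2 * pi * of_int k * t / L)) = (if k = 0 then of_real L else 0)"
proof (cases "k = 0")
  case False
  define c where "c = complex_of_real (2 * pi * of_int k / L)"
  have c: "c \<noteq> 0" using False assms by (simp add: c_def)
  define F where "F t = exp (\<i> * c * of_real t) / (\<i> * c)" for t :: real
  have cis: "cis (2 * pi * of_int k * t / L) = exp (\<i> * c * of_real t)" for t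
    by (simp add: c_def cis_conv_exp mult_ac)
  have "(F has_vector_derivative cis (2 * pi * of_int k * t / L)) (at t within {- (L / 2)..L / 2})" for t
  proof -
    have "((\<lambda>z. exp (\<i> * c * z) / (\<i> * c)) has_field_derivative exp (\<i> * c * of_real t)) (at (of_real t))"
      using c by (auto intro!: derivative_eq_intros)
    then show ?thesis unfolding F_def cis by (rule has_vector_derivative_real_field)
  qed
  then have "(LINT t|lborel. indicator {- (L / 2)..L / 2} t *\<^sub>R cis (2 * pi * of_int k * t / L)) = F (L / 2) - F (- (L / 2))"
    using assms by (intro integral_FTC_Icc) (auto simp: cis intro!: continuous_intros)
  also have "F (L / 2) = F (- (L / 2))"
  proof -
    have "exp (\<i> * c * of_real (L / 2)) = exp (\<i> * c * of_real (- (L / 2)) + \<i> * c * of_real L)"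
      by (rule arg_cong[of _ _ exp]) (simp add: field_simps)
    also have "\<dots> = exp (\<i> * c * of_real (- (L / 2))) * cis (2 * pi * of_int k)"
      using assms cis[of L] by (simp only: exp_add) simp
    also have "cis (2 * pi * of_int k) = 1"
      using cis_multiple_2pi[of "of_int k"] by simp
    finally show ?thesis unfolding F_def by (simp only: mult_1_right)
  qed
  finally show ?thesis using False by simp
qed (use assms in \<open>simp add: scaleR_conv_of_real\<close>)

lemma integral_wave:
  assumes "L > 0"
  shows "(LINT x|cell L. wave L k x) = (if k = (0, 0) then of_real (L\<^sup>2) else 0)"
proof -
  define e where "e n t = indicator {- (L / 2)..L / 2} t *\<^sub>R cis (2 * pi * of_int n * t / L)" for n :: int and t :: real
  have ind: "indicator (cbox (\<chi> i. - (L / 2)) (\<chi> i. L / 2)) (vec2 p) *\<^sub>R wave L k (vec2 p) = e (fst k) (fst p) * e (snd k) (snd p)" for p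
    by (auto simp: e_def indicator_def mem_cell forall_2 wave_def cis_mult add_divide_distrib distrib_left mult.assoc)
  have "(LINT x|cell L. wave L k x) = (LINT x|lborel. indicator (cbox (\<chi> i. - (L / 2)) (\<chi> i. L / 2)) x *\<^sub>R wave L k x)"
    unfolding cell_def by (rule integral_restrict_space) simp
  also have "\<dots> = (LINT p|lborel. e (fst k) (fst p) * e (snd k) (snd p))"
    unfolding ind[symmetric]
    by (rule integral_vec2) measurable
  also have "\<dots> = (LINT p|(lborel \<Otimes>\<^sub>M lborel). e (fst k) (fst p) * e (snd k) (snd p))"
    by (simp add: lborel_prod)
  also have "\<dots> = (LINT s|lborel. LINT t|lborel. e (fst k) s * e (snd k) t)"
  proof (subst lborel_pair.integral_fst'[symmetric])
    have "integrable lborel (\<lambda>p. indicator ({- (L / 2)..L / 2} \<times> {- (L / 2)..L / 2}) p *\<^sub>R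
        (cis (2 * pi * of_int (fst k) * fst p / L) * cis (2 * pi * of_int (snd k) * snd p / L)))"
      using assms by (intro borel_integrable_compact) (auto simp: cis_conv_exp intro!: compact_Times continuous_intros)
    then show "integrable (lborel \<Otimes>\<^sub>M lborel) (\<lambda>p. e (fst k) (fst p) * e (snd k) (snd p))"
      unfolding lborel_prod
      by (rule back_subst[where P="integrable lborel"]) (auto simp: e_def indicator_def fun_eq_iff)
  qed simp
  also have "\<dots> = (LINT s|lborel. e (fst k) s) * (LINT t|lborel. e (snd k) t)"
    by simp
  also have "\<dots> = (if k = (0, 0) then of_real (L\<^sup>2) else 0)"
    unfolding e_def using integral_cis[OF assms] by (cases k) (auto simp: power2_eq_square)
  finally show ?thesis .
qed

section \<open>Partial sums, best approximation and Bessel's inequality\<close>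

text \<open>Unnormalised: the division by the area \<open>L\<^sup>2\<close> is left to
  \<open>fsum\<close>.\<close>

definition fcoeff :: "real \<Rightarrow> (real^2 \<Rightarrow> complex) \<Rightarrow> int \<times> int \<Rightarrow> complex"
  where "fcoeff L f k = (LINT x|cell L. f x * cnj (wave L k x))"

definition fsum :: "real \<Rightarrow> (real^2 \<Rightarrow> complex) \<Rightarrow> (int \<times> int) set \<Rightarrow> real^2 \<Rightarrow> complex"
  where "fsum L f K x = (\<Sum>k\<in>K. fcoeff L f k / of_real (L\<^sup>2) * wave L k x)"

lemma continuous_on_trig_sum: "continuous_on A (\<lambda>x. \<Sum>k\<in>K. d k * wave L k x)"
  by (intro continuous_intros continuous_on_wave)

text \<open>Completing the square in the coefficients \<open>d\<close>. The last term vanishes for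
  the Fourier coefficients and is nonnegative for all others, so this one identity yields the error
  of the partial sum, Bessel's inequality and the best approximation property.\<close>

lemma integral_trig_sum_norm:
  assumes "L > 0" "finite K" and f: "continuous_on UNIV f"
  shows "(LINT x|cell L. (cmod (f x - (\<Sum>k\<in>K. d k * wave L k x)))\<^sup>2)
    = (LINT x|cell L. (cmod (f x))\<^sup>2) - (\<Sum>k\<in>K. (cmod (fcoeff L f k))\<^sup>2) / L\<^sup>2
      + L\<^sup>2 * (\<Sum>k\<in>K. (cmod (d k - fcoeff L f k / of_real (L\<^sup>2)))\<^sup>2)"
proof -
  define s where "s x = (\<Sum>k\<in>K. d k * wave L k x)" for x
  have cs: "continuous_on UNIV s"
    unfolding s_def[abs_def] by (rule continuous_on_trig_sum)
  have norm2: "complex_of_real ((cmod z)\<^sup>2) = z * cnj z" for z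
    by (rule complex_norm_square)
  have int: "integrable (cell L) (\<lambda>x. f x * cnj (f x))" "integrable (cell L) (\<lambda>x. f x * cnj (s x))"
    "integrable (cell L) (\<lambda>x. cnj (f x) * s x)" "integrable (cell L) (\<lambda>x. s x * cnj (s x))"
    by (intro integrable_cell continuous_intros f cs)+
  have fs: "(LINT x|cell L. f x * cnj (s x)) = (\<Sum>k\<in>K. cnj (d k) * fcoeff L f k)"
  proof -
    have "(LINT x|cell L. f x * cnj (s x)) = (LINT x|cell L. (\<Sum>k\<in>K. cnj (d k) * (f x * cnj (wave L k x))))"
      by (simp add: s_def sum_distrib_left mult_ac)
    also have "\<dots> = (\<Sum>k\<in>K. cnj (d k) * (LINT x|cell L. f x * cnj (wave L k x)))"
      by (subst Bochner_Integration.integral_sum)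
         (auto intro!: integrable_cell continuous_intros f continuous_on_wave)
    finally show ?thesis by (simp add: fcoeff_def)
  qed
  have sf: "(LINT x|cell L. cnj (f x) * s x) = (\<Sum>k\<in>K. d k * cnj (fcoeff L f k))"
  proof -
    have "(LINT x|cell L. cnj (f x) * s x) = (LINT x|cell L. cnj (f x * cnj (s x)))"
      by simp
    also have "\<dots> = cnj (LINT x|cell L. f x * cnj (s x))" by (rule Bochner_Integration.integral_cnj)
    finally show ?thesis by (simp add: fs)
  qed
  have ortho: "(LINT x|cell L. wave L k x * cnj (wave L j x)) = (if k = j then of_real (L\<^sup>2) else 0)" for j k
    using integral_wave[OF assms(1), of "k - j"]
    by (auto simp: cnj_wave wave_mult prod_eq_iff)
  have ss: "(LINT x|cell L. s x * cnj (s x)) = (\<Sum>k\<in>K. of_real (L\<^sup>2) * (d k * cnj (d k)))"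
  proof -
    have "(LINT x|cell L. s x * cnj (s x))
        = (LINT x|cell L. (\<Sum>k\<in>K. \<Sum>j\<in>K. (d k * cnj (d j)) * (wave L k x * cnj (wave L j x))))"
      by (simp add: s_def sum_product mult_ac)
    also have "\<dots> = (\<Sum>k\<in>K. \<Sum>j\<in>K. (d k * cnj (d j)) * (LINT x|cell L. wave L k x * cnj (wave L j x)))"
      by (subst Bochner_Integration.integral_sum, force intro!: integrable_cell continuous_intros continuous_on_wave)+
         (auto intro!: sum.cong Bochner_Integration.integral_sum simp: )
    also have "\<dots> = (\<Sum>k\<in>K. of_real (L\<^sup>2) * (d k * cnj (d k)))"
      using assms(2) by (intro sum.cong) (auto simp: ortho if_distrib cong: if_cong)
    finally show ?thesis .
  qed
  have "complex_of_real (LINT x|cell L. (cmod (f x - s x))\<^sup>2)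
      = (LINT x|cell L. complex_of_real ((cmod (f x - s x))\<^sup>2))"
    by (rule integral_complex_of_real[symmetric])
  also have "\<dots> = (LINT x|cell L. f x * cnj (f x) - f x * cnj (s x) - cnj (f x) * s x + s x * cnj (s x))"
    by (simp only: norm2) (simp add: algebra_simps)
  also have "\<dots> = (LINT x|cell L. f x * cnj (f x)) - (\<Sum>k\<in>K. cnj (d k) * fcoeff L f k)
     - (\<Sum>k\<in>K. d k * cnj (fcoeff L f k)) + (\<Sum>k\<in>K. of_real (L\<^sup>2) * (d k * cnj (d k)))"
    using int fs sf ss by simp
  also have "(LINT x|cell L. f x * cnj (f x)) = complex_of_real (LINT x|cell L. (cmod (f x))\<^sup>2)"
    by (simp only: norm2[symmetric] integral_complex_of_real)
  also have "complex_of_real (LINT x|cell L. (cmod (f x))\<^sup>2) - (\<Sum>k\<in>K. cnj (d k) * fcoeff L f k)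
       - (\<Sum>k\<in>K. d k * cnj (fcoeff L f k)) + (\<Sum>k\<in>K. of_real (L\<^sup>2) * (d k * cnj (d k)))
     = complex_of_real (LINT x|cell L. (cmod (f x))\<^sup>2) + (\<Sum>k\<in>K. - (cnj (d k) * fcoeff L f k)
       - d k * cnj (fcoeff L f k) + of_real (L\<^sup>2) * (d k * cnj (d k)))"
    by (simp add: sum.distrib sum_subtractf sum_negf)
  also have "(\<Sum>k\<in>K. - (cnj (d k) * fcoeff L f k) - d k * cnj (fcoeff L f k) + of_real (L\<^sup>2) * (d k * cnj (d k)))
     = (\<Sum>k\<in>K. of_real (- (cmod (fcoeff L f k))\<^sup>2 / L\<^sup>2 + L\<^sup>2 * (cmod (d k - fcoeff L f k / of_real (L\<^sup>2)))\<^sup>2))"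
  proof (rule sum.cong[OF refl])
    fix k
    have "complex_of_real (- (cmod (fcoeff L f k))\<^sup>2 / L\<^sup>2 + L\<^sup>2 * (cmod (d k - fcoeff L f k / of_real (L\<^sup>2)))\<^sup>2)
      = - (fcoeff L f k * cnj (fcoeff L f k)) / of_real (L\<^sup>2)
        + of_real (L\<^sup>2) * ((d k - fcoeff L f k / of_real (L\<^sup>2)) * cnj (d k - fcoeff L f k / of_real (L\<^sup>2)))"
      by (simp only: of_real_add of_real_mult of_real_divide of_real_minus norm2)
    also have "\<dots> = - (cnj (d k) * fcoeff L f k) - d k * cnj (fcoeff L f k) + of_real (L\<^sup>2) * (d k * cnj (d k))"
      using assms(1) by (simp add: field_simps power2_eq_square)
    finally show "- (cnj (d k) * fcoeff L f k) - d k * cnj (fcoeff L f k) + of_real (L\<^sup>2) * (d k * cnj (d k))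
      = of_real (- (cmod (fcoeff L f k))\<^sup>2 / L\<^sup>2 + L\<^sup>2 * (cmod (d k - fcoeff L f k / of_real (L\<^sup>2)))\<^sup>2)" ..
  qed
  finally have "(LINT x|cell L. (cmod (f x - s x))\<^sup>2) = (LINT x|cell L. (cmod (f x))\<^sup>2) +
      (\<Sum>k\<in>K. - (cmod (fcoeff L f k))\<^sup>2 / L\<^sup>2 + L\<^sup>2 * (cmod (d k - fcoeff L f k / of_real (L\<^sup>2)))\<^sup>2)"
    unfolding of_real_sum[symmetric] of_real_add[symmetric] of_real_eq_iff .
  then show ?thesis
    unfolding s_def by (simp add: sum.distrib sum_negf sum_subtractf sum_divide_distrib sum_distrib_left)
qed

lemma integral_fsum_error:
  assumes "L > 0" "finite K" "continuous_on UNIV f"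
  shows "(LINT x|cell L. (cmod (f x - fsum L f K x))\<^sup>2)
    = (LINT x|cell L. (cmod (f x))\<^sup>2) - (\<Sum>k\<in>K. (cmod (fcoeff L f k))\<^sup>2) / L\<^sup>2"
  using integral_trig_sum_norm[OF assms, of "\<lambda>k. fcoeff L f k / of_real (L\<^sup>2)"]
  by (simp add: fsum_def)

lemma fsum_best_approximation:
  assumes "L > 0" "finite K" "continuous_on UNIV f"
  shows "(LINT x|cell L. (cmod (f x - fsum L f K x))\<^sup>2)
    \<le> (LINT x|cell L. (cmod (f x - (\<Sum>k\<in>K. d k * wave L k x)))\<^sup>2)"
  unfolding integral_fsum_error[OF assms] integral_trig_sum_norm[OF assms]
  by (simp add: sum_nonneg)

lemma bessel:
  assumes "L > 0" "finite K" "continuous_on UNIV f"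
  shows "(\<Sum>k\<in>K. (cmod (fcoeff L f k))\<^sup>2) \<le> L\<^sup>2 * (LINT x|cell L. (cmod (f x))\<^sup>2)"
proof -
  have "0 \<le> (LINT x|cell L. (cmod (f x - fsum L f K x))\<^sup>2)" by (rule Bochner_Integration.integral_nonneg) simp
  then show ?thesis
    using assms(1) unfolding integral_fsum_error[OF assms] by (simp add: field_simps)
qed

section \<open>Density of trigonometric polynomials\<close>

definition trig_poly :: "real \<Rightarrow> (real^2 \<Rightarrow> complex) \<Rightarrow> bool"
  where "trig_poly L g \<longleftrightarrow> (\<exists>K d. finite K \<and> (\<forall>x. g x = (\<Sum>k\<in>K. d k * wave L k x)))"

lemma trig_poly_monom: "trig_poly L (\<lambda>x. c * wave L k x)"
  unfolding trig_poly_def by (intro exI[of _ "{k}"] exI[of _ "\<lambda>_. c"]) auto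

lemma trig_poly_const: "trig_poly L (\<lambda>x. c)"
  using trig_poly_monom[of L c "(0, 0)"] by simp

lemma trig_poly_add:
  assumes "trig_poly L f" "trig_poly L g"
  shows "trig_poly L (\<lambda>x. f x + g x)"
proof -
  from assms obtain K d K' d' where K: "finite K" "\<And>x. f x = (\<Sum>k\<in>K. d k * wave L k x)"
    and K': "finite K'" "\<And>x. g x = (\<Sum>k\<in>K'. d' k * wave L k x)"
    unfolding trig_poly_def by blast
  have "f x = (\<Sum>k\<in>K \<union> K'. (if k \<in> K then d k else 0) * wave L k x)" for x
    unfolding K(2) by (rule sum.mono_neutral_cong_left) (use K(1) K'(1) in auto)
  moreover have "g x = (\<Sum>k\<in>K \<union> K'. (if k \<in> K' then d' k else 0) * wave L k x)" for x
    unfolding K'(2) by (rule sum.mono_neutral_cong_left) (use K(1) K'(1) in auto)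
  ultimately have "f x + g x = (\<Sum>k\<in>K \<union> K'. ((if k \<in> K then d k else 0) + (if k \<in> K' then d' k else 0)) * wave L k x)" for x
    by (simp add: sum.distrib distrib_right)
  then show ?thesis
    unfolding trig_poly_def using K(1) K'(1)
    by (intro exI[of _ "K \<union> K'"] exI[of _ "\<lambda>k. (if k \<in> K then d k else 0) + (if k \<in> K' then d' k else 0)"]) auto
qed

lemma trig_poly_sum:
  "finite I \<Longrightarrow> (\<And>i. i \<in> I \<Longrightarrow> trig_poly L (f i)) \<Longrightarrow> trig_poly L (\<lambda>x. \<Sum>i\<in>I. f i x)"
proof (induction I rule: finite_induct)
  case (insert a I)
  then have "trig_poly L (\<lambda>x. f a x + (\<Sum>i\<in>I. f i x))" by (intro trig_poly_add) auto
  then show ?case using insert by simp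
qed (simp add: trig_poly_const)

lemma trig_poly_mult:
  assumes "trig_poly L f" "trig_poly L g"
  shows "trig_poly L (\<lambda>x. f x * g x)"
proof -
  from assms obtain K d K' d' where K: "finite K" "\<And>x. f x = (\<Sum>k\<in>K. d k * wave L k x)"
    and K': "finite K'" "\<And>x. g x = (\<Sum>k\<in>K'. d' k * wave L k x)"
    unfolding trig_poly_def by blast
  have "f x * g x = (\<Sum>k\<in>K. \<Sum>j\<in>K'. (d k * d' j) * wave L (k + j) x)" for x
    unfolding K(2) K'(2) sum_product by (simp add: wave_mult[symmetric] mult_ac)
  moreover have "trig_poly L (\<lambda>x. \<Sum>k\<in>K. \<Sum>j\<in>K'. (d k * d' j) * wave L (k + j) x)"
    by (intro trig_poly_sum trig_poly_monom K(1) K'(1))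
  ultimately show ?thesis by simp
qed

text \<open>The conjugate of a wave is the wave of opposite frequency. Hence the real and imaginary
  parts of the two basic waves are trigonometric polynomials, and sums and products of these stay in
  the class.\<close>

lemma trig_poly_real_polynomial:
  assumes "real_polynomial_function h"
  shows "trig_poly L (\<lambda>x. complex_of_real (h (wave L (1, 0) x, wave L (0, 1) x)))"
  using assms
proof (induction h rule: real_polynomial_function.induct)
  case (linear h)
  interpret bounded_linear h by fact
  let ?p = "\<lambda>a b c d x. a * wave L (1, 0) x + (b * wave L (- 1, 0) x + (c * wave L (0, 1) x + d * wave L (0, - 1) x))"
  have decomp: "h (z, w) = Re z * h (1, 0) + Im z * h (\<i>, 0) + Re w * h (0, 1) + Im w * h (0, \<i>)" for z w
  proof -
    have eq: "(z, w) = Re z *\<^sub>R (1, 0) + Im z *\<^sub>R (\<i>, 0) + Re w *\<^sub>R (0, 1) + Im w *\<^sub>R (0, \<i>)"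
      by (simp add: complex_eq_iff)
    note arg_cong[OF eq, of h]
    also have "h (Re z *\<^sub>R (1, 0) + Im z *\<^sub>R (\<i>, 0) + Re w *\<^sub>R (0, 1) + Im w *\<^sub>R (0, \<i>)) = Re z * h (1, 0) + Im z * h (\<i>, 0) + Re w * h (0, 1) + Im w * h (0, \<i>)"
      by (simp only: add scaleR real_scaleR_def)
    finally show ?thesis .
  qed
  have Re: "complex_of_real (Re z) = (z + cnj z) / 2" and Im: "complex_of_real (Im z) = (z - cnj z) / (2 * \<i>)" for z
    by (simp_all add: complex_eq_iff)
  obtain A B C D where ABCD: "\<And>z w. h (z, w) = Re z * A + Im z * B + Re w * C + Im w * D"
    using decomp by blast
  have "complex_of_real (h (wave L (1, 0) x, wave L (0, 1) x))
    = ?p (A / 2 + B / (2 * \<i>)) (A / 2 - B / (2 * \<i>)) (C / 2 + D / (2 * \<i>)) (C / 2 - D / (2 * \<i>)) x" for x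
    unfolding ABCD of_real_add of_real_mult Re Im cnj_wave by (simp add: field_simps)
  moreover have "trig_poly L (?p a b c d)" for a b c d
    by (intro trig_poly_add trig_poly_monom)
  ultimately show ?case by simp
qed (simp_all add: trig_poly_const trig_poly_add trig_poly_mult)

text \<open>Equal phases force \<open>a = b + n * L\<close>, and the length of the interval leaves
  only \<open>n = -1, 0, 1\<close>: the two end points are the only distinct points that get
  identified.\<close>

lemma cis_eq_period:
  assumes "L > 0" "- (L / 2) \<le> a" "a \<le> L / 2" "- (L / 2) \<le> b" "b \<le> L / 2"
    "cis (2 * pi * a / L) = cis (2 * pi * b / L)"
  shows "a = b \<or> (a = - (L / 2) \<and> b = L / 2) \<or> (a = L / 2 \<and> b = - (L / 2))"
proof -
  from assms(6) have "sin (2 * pi * a / L) = sin (2 * pi * b / L) \<and> cos (2 * pi * a / L) = cos (2 * pi * b / L)"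
    by (simp add: complex_eq_iff)
  then obtain n :: int where "2 * pi * a / L = 2 * pi * b / L + 2 * pi * n"
    unfolding sin_cos_eq_iff by (auto simp: mult_ac)
  then have "2 * pi * a = 2 * pi * (b + n * L)"
    using assms(1) by (simp add: field_simps)
  then have n: "a = b + n * L" by simp
  have "n * L \<le> 1 * L" "(-1) * L \<le> n * L" using n assms by linarith+
  then have "n \<le> 1" "-1 \<le> n" using assms(1) by (simp_all only: mult_le_cancel_right) auto
  then have "n = -1 \<or> n = 0 \<or> n = 1" by linarith
  then show ?thesis using n assms by auto
qed

text \<open>Stone-Weierstrass on the torus, realised as the compact image of the square under the
  two basic waves. The function \<open>f\<close> descends to the torus because it vanishes on the
  edges, and \<open>q\<close> glues only edge points together.\<close>

lemma trig_poly_dense: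
  assumes L: "L > 0" and f: "continuous_on UNIV f"
    and f0: "\<And>x. \<exists>i. x $ i \<le> - (L / 2) \<or> x $ i \<ge> L / 2 \<Longrightarrow> f x = 0" and "e > 0"
  shows "\<exists>g. trig_poly L g \<and> (\<forall>x\<in>cbox (\<chi> i. - (L / 2)) (\<chi> i. L / 2). cmod (f x - g x) < e)"
proof -
  define C :: "(real^2) set" where "C = cbox (\<chi> i. - (L / 2)) (\<chi> i. L / 2)"
  define q where "q x = (wave L (1, 0) x, wave L (0, 1) x)" for x
  \<comment> \<open>The preimage is picked arbitrarily; \<open>Fq\<close> shows that the value of
    \<open>f\<close> does not depend on the pick.\<close>
  define F where "F y = f (SOME x. x \<in> C \<and> q x = y)" for y
  have contq: "continuous_on A q" for A
    unfolding q_def[abs_def] by (intro continuous_intros continuous_on_wave)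
  have Fq: "F (q x) = f x" if x: "x \<in> C" for x
  proof -
    define x' where "x' = (SOME x'. x' \<in> C \<and> q x' = q x)"
    have x': "x' \<in> C \<and> q x' = q x"
      unfolding x'_def by (rule someI[of _ x]) (use x in auto)
    have comp: "x' $ i = x $ i \<or> (x' $ i = - (L / 2) \<and> x $ i = L / 2) \<or> (x' $ i = L / 2 \<and> x $ i = - (L / 2))" for i
    proof (rule cis_eq_period[OF L])
      have "i = 1 \<or> i = 2" using exhaust_2 by blast
      then show "cis (2 * pi * x' $ i / L) = cis (2 * pi * x $ i / L)"
        using x' by (auto simp: q_def wave_def)
    qed (use x x' in \<open>auto simp: C_def mem_cell\<close>)
    have "f x' = f x"
    proof (cases "x' = x")
      case False
      then obtain i where "x' $ i \<noteq> x $ i" by (auto simp: vec_eq_iff)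
      then have "x' $ i \<le> - (L / 2) \<or> x' $ i \<ge> L / 2" "x $ i \<le> - (L / 2) \<or> x $ i \<ge> L / 2"
        using comp[of i] by auto
      then have "f x' = 0" "f x = 0" using f0 by blast+
      then show ?thesis by simp
    qed simp
    then show ?thesis by (simp add: F_def x'_def)
  qed
  \<comment> \<open>On the compact square \<open>q\<close> is a closed map, so the preimage under
    \<open>F\<close> of a closed set is the \<open>q\<close>-image of a compact set and therefore
    closed.\<close>
  have contF: "continuous_on (q ` C) F"
    unfolding continuous_on_closed_invariant
  proof (intro allI impI)
    fix B :: "complex set" assume "closed B"
    then have "closed (f -` B)"
      using f by (simp add: continuous_on_closed_vimage)
    then have "compact (q ` (C \<inter> f -` B))"
      by (intro compact_continuous_image contq compact_Int_closed) (auto simp: C_def)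
    then have "closed (q ` (C \<inter> f -` B))" by (rule compact_imp_closed)
    moreover have "q ` (C \<inter> f -` B) \<inter> q ` C = F -` B \<inter> q ` C"
      using Fq by auto
    ultimately show "\<exists>A. closed A \<and> A \<inter> q ` C = F -` B \<inter> q ` C" by blast
  qed
  obtain p where p: "polynomial_function p" "\<And>y. y \<in> q ` C \<Longrightarrow> cmod (F y - p y) < e"
    using Stone_Weierstrass_polynomial_function[OF _ contF \<open>e > 0\<close>]
    by (metis C_def compact_cbox compact_continuous_image contq)
  have ri: "real_polynomial_function (\<lambda>y. Re (p y))" "real_polynomial_function (\<lambda>y. Im (p y))"
    using p(1) bounded_linear_Re bounded_linear_Im by (auto simp: polynomial_function_def o_def)
  have "trig_poly L (\<lambda>x. of_real (Re (p (q x))) + \<i> * of_real (Im (p (q x))))"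
    unfolding q_def by (intro trig_poly_add trig_poly_mult trig_poly_const trig_poly_real_polynomial ri)
  then have "trig_poly L (\<lambda>x. p (q x))"
    by (simp flip: complex_eq)
  moreover have "\<forall>x\<in>C. cmod (f x - p (q x)) < e"
  proof
    fix x assume "x \<in> C"
    then show "cmod (f x - p (q x)) < e" using p(2)[of "q x"] Fq[of x] by simp
  qed
  ultimately show ?thesis unfolding C_def by blast
qed

definition kbox :: "nat \<Rightarrow> (int \<times> int) set"
  where "kbox M = {- int M..int M} \<times> {- int M..int M}"

lemma finite_kbox [simp]: "finite (kbox M)"
  by (simp add: kbox_def)

lemma kbox_mono: "M \<le> N \<Longrightarrow> kbox M \<subseteq> kbox N"
  by (auto simp: kbox_def)

lemma finite_subset_kbox:
  assumes "finite K"
  shows "\<exists>M. K \<subseteq> kbox M"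
  using assms
proof (induction K rule: finite_induct)
  case (insert k K)
  then obtain M where M: "K \<subseteq> kbox M" by blast
  define N where "N = M + nat \<bar>fst k\<bar> + nat \<bar>snd k\<bar>"
  have "k \<in> kbox N" by (cases k) (auto simp: kbox_def N_def)
  moreover have "K \<subseteq> kbox N" using M kbox_mono[of M N] by (auto simp: N_def)
  ultimately have "insert k K \<subseteq> kbox N" by simp
  then show ?case by blast
qed auto

text \<open>A uniform approximation \<open>g\<close> by a trigonometric polynomial has all its
  frequencies in \<open>kbox M\<close> for large \<open>M\<close>; from then on it competes with the
  partial sum and loses by best approximation.\<close>

lemma fsum_converges:
  assumes L: "L > 0" and f: "continuous_on UNIV f"
    and f0: "\<And>x. \<exists>i. x $ i \<le> - (L / 2) \<or> x $ i \<ge> L / 2 \<Longrightarrow> f x = 0"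
  shows "(\<lambda>M. LINT x|cell L. (cmod (f x - fsum L f (kbox M) x))\<^sup>2) \<longlonglongrightarrow> 0"
proof (rule LIMSEQ_I)
  fix r :: real assume r: "r > 0"
  define m where "m = measure (cell L) (space (cell L))"
  have m: "m \<ge> 0" by (simp add: m_def)
  \<comment> \<open>Writing \<open>m + 1\<close> in place of the area \<open>m\<close> keeps the
    denominator positive, and the factor 2 makes the final inequality strict.\<close>
  define e where "e = sqrt (r / (2 * (m + 1)))"
  have e: "e > 0" and e2: "m * e\<^sup>2 < r"
    using r m mult_nonneg_nonneg[of m r] by (auto simp: e_def field_simps add_nonneg_pos)
  obtain g where "trig_poly L g" and g: "\<And>x. x \<in> cbox (\<chi> i. - (L / 2)) (\<chi> i. L / 2) \<Longrightarrow> cmod (f x - g x) < e"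
    using trig_poly_dense[OF L f f0 e] by blast
  then obtain K d where K: "finite K" "\<And>x. g x = (\<Sum>k\<in>K. d k * wave L k x)"
    unfolding trig_poly_def by blast
  obtain M0 where M0: "K \<subseteq> kbox M0" using finite_subset_kbox[OF K(1)] by blast
  have "(LINT x|cell L. (cmod (f x - fsum L f (kbox M) x))\<^sup>2) < r" if "M \<ge> M0" for M
  proof -
    have KM: "K \<subseteq> kbox M" using M0 kbox_mono[OF that] by blast
    have g': "g x = (\<Sum>k\<in>kbox M. (if k \<in> K then d k else 0) * wave L k x)" for x
      unfolding K(2) by (rule sum.mono_neutral_cong_left) (use KM in auto)
    have cg: "continuous_on UNIV g"
      unfolding K(2) by (rule continuous_on_trig_sum)
    have "(LINT x|cell L. (cmod (f x - fsum L f (kbox M) x))\<^sup>2) \<le> (LINT x|cell L. (cmod (f x - g x))\<^sup>2)"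
      unfolding g' by (rule fsum_best_approximation[OF L finite_kbox f])
    also have "\<dots> \<le> (LINT x|cell L. e\<^sup>2)"
    proof (rule integral_mono)
      show "(cmod (f x - g x))\<^sup>2 \<le> e\<^sup>2" if "x \<in> space (cell L)" for x
        using g[of x] that by (intro power_mono) (auto simp: cell_def space_restrict_space)
    qed (intro integrable_cell continuous_intros f cg)+
    also have "\<dots> = m * e\<^sup>2" by (simp add: m_def)
    finally show ?thesis using e2 by simp
  qed
  then show "\<exists>M0. \<forall>M\<ge>M0. norm ((LINT x|cell L. (cmod (f x - fsum L f (kbox M) x))\<^sup>2) - 0) < r"
    by (intro exI[of _ M0]) (auto simp: Bochner_Integration.integral_nonneg)
qed

section \<open>Low and high frequencies\<close>

definition freq :: "int \<times> int \<Rightarrow> 2 \<Rightarrow> int"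
  where "freq k i = (if i = 1 then fst k else snd k)"

definition freq2 :: "int \<times> int \<Rightarrow> real"
  where "freq2 k = (of_int (fst k))\<^sup>2 + (of_int (snd k))\<^sup>2"

text \<open>For \<open>l = E * L\<^sup>2\<close> this is the value on the diagonal of the resolvent
  kernel of \<open>- \<Delta> + E\<close> on the torus of side \<open>L\<close>, truncated to the
  frequencies in \<open>kbox M\<close>.\<close>

definition low_sum :: "real \<Rightarrow> nat \<Rightarrow> real"
  where "low_sum l M = (\<Sum>k\<in>kbox M. 1 / (4 * pi\<^sup>2 * freq2 k + l))"

lemma freq2_nonneg: "0 \<le> freq2 k"
  by (simp add: freq2_def)

lemma freq2_outside_kbox: "k \<notin> kbox M \<Longrightarrow> (real (M + 1))\<^sup>2 \<le> freq2 k"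
proof -
  assume k: "k \<notin> kbox M"
  have *: "(real (M + 1))\<^sup>2 \<le> (real_of_int a)\<^sup>2" if "\<not> \<bar>a\<bar> \<le> int M" for a
  proof -
    have "int (M + 1) \<le> \<bar>a\<bar>" using that by simp
    then have "real_of_int (int (M + 1)) \<le> real_of_int \<bar>a\<bar>" by (simp only: of_int_le_iff)
    then have "(real (M + 1))\<^sup>2 \<le> (real_of_int \<bar>a\<bar>)\<^sup>2" by (intro power_mono) auto
    then show ?thesis by simp
  qed
  have "\<not> \<bar>fst k\<bar> \<le> int M \<or> \<not> \<bar>snd k\<bar> \<le> int M"
    using k by (cases k) (auto simp: kbox_def)
  then show ?thesis
    using *[of "fst k"] *[of "snd k"] zero_le_power2[of "real_of_int (fst k)"] zero_le_power2[of "real_of_int (snd k)"]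
    unfolding freq2_def by linarith
qed

lemma card_kbox: "card (kbox M) = (2 * M + 1)\<^sup>2"
proof -
  have "card {- int M..int M} = 2 * M + 1"
    unfolding card_atLeastAtMost_int by linarith
  then show ?thesis by (simp add: kbox_def card_cartesian_product power2_eq_square)
qed

lemma sum_odd_eq_square: "(\<Sum>M<n. 2 * real M + 1) = (real n)\<^sup>2"
  by (induction n) (auto simp: power2_eq_square algebra_simps)

text \<open>The step from \<open>M\<close> to \<open>M + 1\<close> adds a shell of
  \<open>8 * (M + 1)\<close> frequencies with terms at most \<open>1 / b\<close>. Linear growth of
  the shells against a quadratic symbol leaves the increment of a logarithm. The leading 1 pays for
  the zero frequency, whose term is \<open>1 / l\<close>.\<close>

lemma low_sum_le:
  assumes l: "l \<ge> 1"
  shows "low_sum l M \<le> 1 + 8 * ln (1 + (real M)\<^sup>2 / l)"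
proof (induction M)
  case 0
  have "kbox 0 = {(0, 0)}" by (auto simp: kbox_def)
  then show ?case using l by (simp add: low_sum_def freq2_def)
next
  case (Suc M)
  define a b where "a = (real M)\<^sup>2 + l" and "b = (real (Suc M))\<^sup>2 + l"
  have ab: "0 < a" "0 < b" using l by (auto simp: a_def b_def intro: add_nonneg_pos)
  have sub: "kbox M \<subseteq> kbox (Suc M)" by (intro kbox_mono) simp
  have card: "card (kbox (Suc M) - kbox M) = 8 * (M + 1)"
    using card_Diff_subset[OF finite_kbox sub] by (simp add: card_kbox power2_eq_square algebra_simps)
  have "low_sum l (Suc M) = low_sum l M + (\<Sum>k\<in>kbox (Suc M) - kbox M. 1 / (4 * pi\<^sup>2 * freq2 k + l))"
    unfolding low_sum_def by (subst sum.subset_diff[OF sub finite_kbox]) simp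
  also have "(\<Sum>k\<in>kbox (Suc M) - kbox M. 1 / (4 * pi\<^sup>2 * freq2 k + l)) \<le> (\<Sum>k\<in>kbox (Suc M) - kbox M. 1 / b)"
  proof (rule sum_mono)
    fix k assume "k \<in> kbox (Suc M) - kbox M"
    then have "(real (M + 1))\<^sup>2 \<le> freq2 k" by (intro freq2_outside_kbox) simp
    moreover have "1 * freq2 k \<le> 4 * pi\<^sup>2 * freq2 k"
    proof (rule mult_right_mono)
      have "1 \<le> pi\<^sup>2" using pi_gt3 by (intro one_le_power) simp
      then show "1 \<le> 4 * pi\<^sup>2" by simp
    qed (rule freq2_nonneg)
    ultimately show "1 / (4 * pi\<^sup>2 * freq2 k + l) \<le> 1 / b"
      using ab by (intro divide_left_mono mult_pos_pos) (auto simp: b_def)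
  qed
  also have "\<dots> = 8 * ((real M + 1) / b)"
    by (simp add: card)
  \<comment> \<open>This turns the shell into an increment of the logarithm, since
    \<open>b - a = 2 * M + 1\<close> is at least \<open>M + 1\<close>.\<close>
  also have "(real M + 1) / b \<le> ln (b / a)"
  proof -
    have "1 - a / b \<le> - ln (a / b)"
      using ln_le_minus_one[of "a / b"] ab by simp
    also have "- ln (a / b) = ln (b / a)" using ab by (simp add: ln_div)
    finally have "(b - a) / b \<le> ln (b / a)" using ab by (simp add: diff_divide_distrib)
    moreover have "(real M + 1) / b \<le> (b - a) / b"
      using ab by (intro divide_right_mono) (auto simp: a_def b_def power2_eq_square algebra_simps)
    ultimately show ?thesis by linarith
  qed
  also have "low_sum l M + 8 * ln (b / a) \<le> 1 + 8 * (ln (1 + (real M)\<^sup>2 / l) + ln (b / a))"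
    using Suc by simp
  also have "ln (1 + (real M)\<^sup>2 / l) = ln (a / l)" using l by (simp add: a_def field_simps)
  also have "ln (a / l) + ln (b / a) = ln (b / l)" using ab l by (simp add: ln_div)
  also have "b / l = 1 + (real (Suc M))\<^sup>2 / l" using l by (simp add: b_def field_simps)
  finally show ?case by simp
qed

section \<open>Low-pass and high-pass estimates for one function\<close>

definition grad_sq :: "(real^2 \<Rightarrow> complex) \<Rightarrow> real"
  where "grad_sq f = (\<Sum>i\<in>UNIV. LINT x|lborel. (cmod (partial_deriv i f x))\<^sup>2)"

definition energy :: "real \<Rightarrow> (real^2 \<Rightarrow> complex) \<Rightarrow> real"
  where "energy E f = grad_sq f + E * (LINT x|lborel. (cmod (f x))\<^sup>2)"

lemma integral_cell_eq_lborel: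
  fixes g :: "real^2 \<Rightarrow> 'b::{banach, second_countable_topology}"
  assumes "\<And>x. x \<notin> cbox (\<chi> i. - (L / 2)) (\<chi> i. L / 2) \<Longrightarrow> g x = 0"
  shows "(LINT x|cell L. g x) = (LINT x|lborel. g x)"
proof -
  have "(LINT x|cell L. g x) = (LINT x|lborel. indicator (cbox (\<chi> i. - (L / 2)) (\<chi> i. L / 2)) x *\<^sub>R g x)"
    unfolding cell_def by (rule integral_restrict_space) simp
  also have "\<dots> = (LINT x|lborel. g x)"
    by (rule Bochner_Integration.integral_cong) (use assms in \<open>auto simp: indicator_def\<close>)
  finally show ?thesis .
qed

lemma wave_has_derivative:
  "(wave L k has_derivative
     (\<lambda>h. of_real (2 * pi / L * (of_int (fst k) * h $ 1 + of_int (snd k) * h $ 2)) * \<i> * wave L k x)) (at x)"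
proof -
  have 1: "(exp has_derivative (\<lambda>h. h * exp z)) (at z)" for z :: complex
    using DERIV_exp[of z] by (simp add: has_field_derivative_def mult_commute_abs)
  define l where "l y = of_real (2 * pi / L * (of_int (fst k) * y $ 1 + of_int (snd k) * y $ 2)) * \<i>" for y :: "real^2"
  have "bounded_linear l"
    unfolding l_def[abs_def]
    by (intro bounded_linear_mult_const[of _ \<i>] bounded_linear_compose[OF bounded_linear_of_real]
        bounded_linear_const_mult bounded_linear_add bounded_linear_vec_nth)
  then have "(l has_derivative l) (at x)" by (rule bounded_linear_imp_has_derivative)
  from has_derivative_compose[OF this 1]
  have "((\<lambda>y. exp (l y)) has_derivative (\<lambda>h. l h * exp (l x))) (at x)" .
  moreover have "exp (l y) = wave L k y" for y
    by (simp add: l_def wave_def cis_conv_exp mult_ac)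
  ultimately show ?thesis by (simp add: l_def)
qed

text \<open>The function vanishes on the edges as well as outside. Its periodic extension is
  therefore smooth, integration over the square leaves no boundary terms, and
  \<open>fsum_converges\<close> applies.\<close>

locale supported =
  fixes L :: real and f :: "real^2 \<Rightarrow> complex"
  assumes L: "L > 0" and test: "f \<in> test_fun UNIV"
    and support: "\<And>x. \<exists>i. x $ i \<le> - (L / 2) \<or> x $ i \<ge> L / 2 \<Longrightarrow> f x = 0"
begin

lemma f_outside: "x \<notin> cbox (\<chi> i. - (L / 2)) (\<chi> i. L / 2) \<Longrightarrow> f x = 0"
  by (rule support) (auto simp: mem_cell not_le intro: less_imp_le)

lemma partial_outside: "x \<notin> cbox (\<chi> i. - (L / 2)) (\<chi> i. L / 2) \<Longrightarrow> partial_deriv i f x = 0"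
  unfolding partial_deriv_def
  by (rule has_derivative_zero_outside_closed[OF closed_cbox f_outside _ test_fun_has_derivative[OF test]])

lemma cont: "continuous_on UNIV f"
  by (rule test_fun_continuous[OF test])

lemma cont_partial: "continuous_on UNIV (partial_deriv i f)"
  by (rule test_fun_continuous[OF test_fun_partial_deriv[OF test]])

lemma fcoeff_partial:
  "fcoeff L (partial_deriv i f) k = \<i> * of_real (2 * pi * of_int (freq k i) / L) * fcoeff L f k"
proof -
  let ?D = "\<lambda>x h. of_real (2 * pi / L * (of_int (fst (- k)) * h $ 1 + of_int (snd (- k)) * h $ 2)) * \<i> * wave L (- k) x"
  have D: "?D x (axis i 1) = - \<i> * of_real (2 * pi * of_int (freq k i) / L) * cnj (wave L k x)" for x
  proof -
    have "i = 1 \<or> i = 2" using exhaust_2 by blast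
    then show ?thesis by (auto simp: axis_def freq_def cnj_wave)
  qed
  have "fcoeff L (partial_deriv i f) k = (LINT x|lborel. partial_deriv i f x * cnj (wave L k x))"
    unfolding fcoeff_def by (rule integral_cell_eq_lborel) (simp add: partial_outside)
  also have "\<dots> = - (LINT x|lborel. f x * ?D x (axis i 1))"
    unfolding partial_deriv_def cnj_wave
    by (subst integral_by_parts_compact_support[OF test_fun_has_derivative[OF test] _ wave_has_derivative _ compact_cbox f_outside])
       (use cont_partial L in \<open>auto simp: partial_deriv_def[abs_def] intro!: continuous_intros continuous_on_wave\<close>)
  also have "\<dots> = \<i> * of_real (2 * pi * of_int (freq k i) / L) * (LINT x|lborel. f x * cnj (wave L k x))"
    unfolding D mult.left_commute[of "f _"] by (subst integral_mult_right_zero) simp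
  also have "(LINT x|lborel. f x * cnj (wave L k x)) = fcoeff L f k"
    unfolding fcoeff_def by (rule integral_cell_eq_lborel[symmetric]) (simp add: f_outside)
  finally show ?thesis .
qed

text \<open>Bessel's inequality for the partial derivatives. One factor \<open>L\<^sup>2\<close>
  comes from Bessel, the other clears the denominator of the symbol
  \<open>(2 * pi * freq k i / L)\<^sup>2\<close>.\<close>

lemma grad_bessel:
  assumes "finite K"
  shows "(\<Sum>k\<in>K. 4 * pi\<^sup>2 * freq2 k * (cmod (fcoeff L f k))\<^sup>2) \<le> L ^ 4 * grad_sq f"
proof -
  have "(\<Sum>k\<in>K. (2 * pi * of_int (freq k i) / L)\<^sup>2 * (cmod (fcoeff L f k))\<^sup>2)
      \<le> L\<^sup>2 * (LINT x|lborel. (cmod (partial_deriv i f x))\<^sup>2)" for i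
  proof -
    have "(\<Sum>k\<in>K. (2 * pi * of_int (freq k i) / L)\<^sup>2 * (cmod (fcoeff L f k))\<^sup>2)
        = (\<Sum>k\<in>K. (cmod (fcoeff L (partial_deriv i f) k))\<^sup>2)"
      unfolding fcoeff_partial norm_mult norm_of_real power_mult_distrib power2_abs by simp
    also have "\<dots> \<le> L\<^sup>2 * (LINT x|cell L. (cmod (partial_deriv i f x))\<^sup>2)"
      by (rule bessel[OF L assms cont_partial])
    also have "(LINT x|cell L. (cmod (partial_deriv i f x))\<^sup>2) = (LINT x|lborel. (cmod (partial_deriv i f x))\<^sup>2)"
      by (rule integral_cell_eq_lborel) (simp add: partial_outside)
    finally show ?thesis .
  qed
  from sum_mono[of UNIV, OF this]
  have "(\<Sum>i\<in>UNIV. \<Sum>k\<in>K. (2 * pi * of_int (freq k i) / L)\<^sup>2 * (cmod (fcoeff L f k))\<^sup>2) \<le> L\<^sup>2 * grad_sq f"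
    by (simp add: grad_sq_def sum_distrib_left)
  moreover have "(\<Sum>i\<in>UNIV. \<Sum>k\<in>K. (2 * pi * of_int (freq k i) / L)\<^sup>2 * (cmod (fcoeff L f k))\<^sup>2)
      = (\<Sum>k\<in>K. 4 * pi\<^sup>2 * freq2 k * (cmod (fcoeff L f k))\<^sup>2) / L\<^sup>2"
    by (simp add: sum_2 freq_def freq2_def sum.distrib[symmetric] sum_divide_distrib power_divide power_mult_distrib
        add_divide_distrib distrib_left distrib_right)
  ultimately have "(\<Sum>k\<in>K. 4 * pi\<^sup>2 * freq2 k * (cmod (fcoeff L f k))\<^sup>2) \<le> (L\<^sup>2 * grad_sq f) * L\<^sup>2"
    using L by (simp add: pos_divide_le_eq)
  then show ?thesis by (simp add: power4_eq_xxxx power2_eq_square mult_ac)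
qed

lemma energy_bessel:
  assumes "finite K" "E \<ge> 0"
  shows "(\<Sum>k\<in>K. (4 * pi\<^sup>2 * freq2 k + E * L\<^sup>2) * (cmod (fcoeff L f k))\<^sup>2) \<le> L ^ 4 * energy E f"
proof -
  have "(\<Sum>k\<in>K. (cmod (fcoeff L f k))\<^sup>2) \<le> L\<^sup>2 * (LINT x|lborel. (cmod (f x))\<^sup>2)"
    using bessel[OF L assms(1) cont] integral_cell_eq_lborel[of L "\<lambda>x. (cmod (f x))\<^sup>2"] f_outside by simp
  then have "E * L\<^sup>2 * (\<Sum>k\<in>K. (cmod (fcoeff L f k))\<^sup>2) \<le> E * L\<^sup>2 * (L\<^sup>2 * (LINT x|lborel. (cmod (f x))\<^sup>2))"
    using assms(2) by (intro mult_left_mono) auto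
  moreover have "(\<Sum>k\<in>K. (4 * pi\<^sup>2 * freq2 k + E * L\<^sup>2) * (cmod (fcoeff L f k))\<^sup>2)
    = (\<Sum>k\<in>K. 4 * pi\<^sup>2 * freq2 k * (cmod (fcoeff L f k))\<^sup>2) + E * L\<^sup>2 * (\<Sum>k\<in>K. (cmod (fcoeff L f k))\<^sup>2)"
    by (simp add: distrib_right sum.distrib sum_distrib_left)
  ultimately show ?thesis
    using grad_bessel[OF assms(1)] by (simp add: energy_def distrib_left power4_eq_xxxx power2_eq_square mult_ac)
qed

text \<open>Cauchy-Schwarz with the weights \<open>sqrt (m k)\<close>: the weighted coefficients are
  paid for by the energy, and the inverse weights add up to the truncated resolvent kernel.\<close>

lemma low_pass_bound:
  assumes "E > 0"
  shows "(cmod (fsum L f (kbox M) x))\<^sup>2 \<le> low_sum (E * L\<^sup>2) M * energy E f"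
proof -
  define m where "m k = 4 * pi\<^sup>2 * freq2 k + E * L\<^sup>2" for k
  have m: "m k > 0" for k
    unfolding m_def using assms L by (intro add_nonneg_pos mult_nonneg_nonneg freq2_nonneg) auto
  have "cmod (fsum L f (kbox M) x) \<le> (\<Sum>k\<in>kbox M. cmod (fcoeff L f k / of_real (L\<^sup>2) * wave L k x))"
    unfolding fsum_def by (rule norm_sum)
  also have "\<dots> = (\<Sum>k\<in>kbox M. (1 / sqrt (m k)) * (sqrt (m k) * cmod (fcoeff L f k))) / L\<^sup>2"
    using L m by (simp add: norm_mult norm_divide sum_divide_distrib less_imp_neq[OF m, symmetric] norm_power)
  finally have "(cmod (fsum L f (kbox M) x))\<^sup>2 \<le> ((\<Sum>k\<in>kbox M. (1 / sqrt (m k)) * (sqrt (m k) * cmod (fcoeff L f k))) / L\<^sup>2)\<^sup>2"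
    by (intro power_mono) auto
  also have "\<dots> = (\<Sum>k\<in>kbox M. (1 / sqrt (m k)) * (sqrt (m k) * cmod (fcoeff L f k)))\<^sup>2 / L ^ 4"
    by (simp add: power_divide power_mult[symmetric])
  also have "\<dots> \<le> (\<Sum>k\<in>kbox M. (1 / sqrt (m k))\<^sup>2) * (\<Sum>k\<in>kbox M. (sqrt (m k) * cmod (fcoeff L f k))\<^sup>2) / L ^ 4"
    by (intro divide_right_mono Cauchy_Schwarz_ineq_sum) auto
  also have "(\<Sum>k\<in>kbox M. (1 / sqrt (m k))\<^sup>2) = low_sum (E * L\<^sup>2) M"
    using m less_imp_le[OF m] by (simp add: low_sum_def m_def power_divide)
  also have "(\<Sum>k\<in>kbox M. (sqrt (m k) * cmod (fcoeff L f k))\<^sup>2) = (\<Sum>k\<in>kbox M. m k * (cmod (fcoeff L f k))\<^sup>2)"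
    using less_imp_le[OF m] by (simp add: power_mult_distrib)
  also have "low_sum (E * L\<^sup>2) M * (\<Sum>k\<in>kbox M. m k * (cmod (fcoeff L f k))\<^sup>2) / L ^ 4
      \<le> low_sum (E * L\<^sup>2) M * (L ^ 4 * energy E f) / L ^ 4"
    using energy_bessel[OF finite_kbox, of E M] assms less_imp_le[OF m]
    by (intro divide_right_mono mult_left_mono) (auto simp: m_def low_sum_def intro!: sum_nonneg)
  also have "\<dots> = low_sum (E * L\<^sup>2) M * energy E f" using L by simp
  finally show ?thesis .
qed

text \<open>The weights \<open>2 M + 1\<close> with \<open>M < m\<close> sum to \<open>m\<^sup>2\<close>, so summing over the cutoffs \<open>M\<close> recovers
  the symbol of the Laplacian.\<close>

lemma high_pass_bound:
  "(\<Sum>M<N. (2 * pi / L)\<^sup>2 * (2 * real M + 1) * (LINT x|cell L. (cmod (f x - fsum L f (kbox M) x))\<^sup>2)) \<le> grad_sq f"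
proof -
  define T where "T M = (LINT x|cell L. (cmod (f x - fsum L f (kbox M) x))\<^sup>2)" for M
  define w where "w M = (2 * pi / L)\<^sup>2 * (2 * real M + 1)" for M :: nat
  define a where "a k = (cmod (fcoeff L f k))\<^sup>2" for k
  \<comment> \<open>Subtracting \<open>T N'\<close> turns each tail of the Fourier series into a
    finite sum over \<open>kbox N'\<close>, where the order of summation can be exchanged
    freely.\<close>
  have fin: "(\<Sum>M<N. w M * (T M - T N')) \<le> grad_sq f" if "N' \<ge> N" for N'
  proof -
    have "T M - T N' = (\<Sum>k\<in>kbox N'. if k \<in> kbox M then 0 else a k) / L\<^sup>2" if "M < N" for M
    proof -
      have sub: "kbox M \<subseteq> kbox N'" using that \<open>N' \<ge> N\<close> by (intro kbox_mono) simp
      have "T M - T N' = (sum a (kbox N') - sum a (kbox M)) / L\<^sup>2"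
        unfolding T_def integral_fsum_error[OF L finite_kbox cont] a_def by (simp add: diff_divide_distrib)
      also have "sum a (kbox N') - sum a (kbox M) = sum a (kbox N' - kbox M)"
        using sum_diff[OF finite_kbox sub, of a] by simp
      also have "sum a (kbox N' - kbox M) = (\<Sum>k\<in>kbox N'. if k \<in> kbox M then 0 else a k)"
        by (rule sum.mono_neutral_cong_left) auto
      finally show ?thesis .
    qed
    then have "(\<Sum>M<N. w M * (T M - T N')) = (\<Sum>M<N. \<Sum>k\<in>kbox N'. w M * (if k \<in> kbox M then 0 else a k) / L\<^sup>2)"
      by (simp add: sum_distrib_left sum_divide_distrib)
    also have "\<dots> = (\<Sum>k\<in>kbox N'. \<Sum>M<N. w M * (if k \<in> kbox M then 0 else a k) / L\<^sup>2)"
      by (rule sum.swap)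
    also have "\<dots> \<le> (\<Sum>k\<in>kbox N'. 4 * pi\<^sup>2 * freq2 k * a k / L ^ 4)"
    proof (rule sum_mono)
      fix k
      \<comment> \<open>The cutoffs \<open>M\<close> whose box misses \<open>k\<close> form an
        initial segment. If \<open>n\<close> is still among them, the weights up to \<open>n\<close>
        add up to \<open>(n + 1)\<^sup>2\<close>, which is at most \<open>freq2 k\<close>; otherwise
        \<open>n\<close> adds nothing.\<close>
      have bound: "(\<Sum>M<n. (if k \<in> kbox M then 0 else 2 * real M + 1)) \<le> freq2 k" for n
      proof (induction n)
        case 0
        show ?case by (simp add: freq2_nonneg)
      next
        case (Suc n)
        show ?case
        proof (cases "k \<in> kbox n")
          case True
          then show ?thesis using Suc by simp
        next
          case False
          have "(\<Sum>M<Suc n. (if k \<in> kbox M then 0 else 2 * real M + 1)) \<le> (\<Sum>M<Suc n. 2 * real M + 1)"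
            by (intro sum_mono) auto
          also have "\<dots> = (real (n + 1))\<^sup>2" unfolding sum_odd_eq_square by simp
          also have "\<dots> \<le> freq2 k" by (rule freq2_outside_kbox[OF False])
          finally show ?thesis .
        qed
      qed
      have "(\<Sum>M<N. w M * (if k \<in> kbox M then 0 else a k) / L\<^sup>2)
        = (\<Sum>M<N. (if k \<in> kbox M then 0 else 2 * real M + 1)) * (4 * pi\<^sup>2 * a k / L ^ 4)"
        unfolding sum_distrib_right w_def
        by (intro sum.cong) (auto simp: power_divide power_mult_distrib power2_eq_square power4_eq_xxxx field_simps)
      also have "\<dots> \<le> freq2 k * (4 * pi\<^sup>2 * a k / L ^ 4)"
        by (intro mult_right_mono bound) (auto simp: a_def)
      finally show "(\<Sum>M<N. w M * (if k \<in> kbox M then 0 else a k) / L\<^sup>2) \<le> 4 * pi\<^sup>2 * freq2 k * a k / L ^ 4"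
        by (simp add: mult_ac)
    qed
    also have "\<dots> = (\<Sum>k\<in>kbox N'. 4 * pi\<^sup>2 * freq2 k * a k) / L ^ 4"
      by (simp add: sum_divide_distrib)
    also have "\<dots> \<le> L ^ 4 * grad_sq f / L ^ 4"
      unfolding a_def by (intro divide_right_mono grad_bessel) auto
    finally show ?thesis using L by simp
  qed
  \<comment> \<open>Completeness of the waves enters here: it removes the correction
    \<open>T N'\<close> in the limit.\<close>
  have "T \<longlonglongrightarrow> 0"
    unfolding T_def[abs_def] by (rule fsum_converges[OF L cont support])
  then have "(\<lambda>N'. \<Sum>M<N. w M * (T M - T N')) \<longlonglongrightarrow> (\<Sum>M<N. w M * (T M - 0))"
    by (intro tendsto_intros)
  then have "(\<Sum>M<N. w M * (T M - 0)) \<le> grad_sq f"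
    by (rule LIMSEQ_le_const2) (use fin in blast)
  then show ?thesis by (simp add: T_def w_def)
qed

end

section \<open>The collective Trudinger inequality\<close>

text \<open>The density of a family is estimated through its linear combinations, so truncation has
  to commute with them.\<close>

lemma fsum_linear:
  assumes "finite I" "\<And>i. i \<in> I \<Longrightarrow> continuous_on UNIV (f i)"
  shows "fsum L (\<lambda>x. \<Sum>i\<in>I. c i * f i x) K x = (\<Sum>i\<in>I. c i * fsum L (f i) K x)"
proof -
  have "fcoeff L (\<lambda>x. \<Sum>i\<in>I. c i * f i x) k = (\<Sum>i\<in>I. c i * fcoeff L (f i) k)" for k
  proof -
    have "fcoeff L (\<lambda>x. \<Sum>i\<in>I. c i * f i x) k = (LINT x|cell L. (\<Sum>i\<in>I. c i * (f i x * cnj (wave L k x))))"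
      by (simp add: fcoeff_def sum_distrib_right mult.assoc)
    also have "\<dots> = (\<Sum>i\<in>I. LINT x|cell L. c i * (f i x * cnj (wave L k x)))"
      by (rule Bochner_Integration.integral_sum)
         (intro integrable_cell continuous_intros assms(2) continuous_on_wave)
    finally show ?thesis by (simp add: fcoeff_def)
  qed
  then have "fsum L (\<lambda>x. \<Sum>i\<in>I. c i * f i x) K x
      = (\<Sum>k\<in>K. \<Sum>i\<in>I. c i * (fcoeff L (f i) k / of_real (L\<^sup>2) * wave L k x))"
    by (simp add: fsum_def sum_distrib_right sum_divide_distrib mult.assoc)
  also have "\<dots> = (\<Sum>i\<in>I. \<Sum>k\<in>K. c i * (fcoeff L (f i) k / of_real (L\<^sup>2) * wave L k x))"
    by (rule sum.swap)
  finally show ?thesis by (simp add: fsum_def sum_distrib_left)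
qed

lemma exp_eighth_le: "exp (1 / 8 :: real) \<le> 2"
proof -
  have "exp (1 / 8 :: real) \<le> 1 + 1 / 8 + (1 / 8)\<^sup>2" by (rule exp_bound) auto
  also have "\<dots> \<le> 2" by (simp add: power2_eq_square)
  finally show ?thesis .
qed

lemma norm_add_sq_le:
  fixes a b :: "'a::real_normed_vector"
  shows "(norm (a + b))\<^sup>2 \<le> 2 * (norm a)\<^sup>2 + 2 * (norm b)\<^sup>2"
proof -
  have "(norm (a + b))\<^sup>2 \<le> (norm a + norm b)\<^sup>2" by (intro power_mono norm_triangle_ineq) auto
  also have "\<dots> \<le> 2 * (norm a)\<^sup>2 + 2 * (norm b)\<^sup>2"
    using sum_squares_bound[of "norm a" "norm b"] by (simp add: power2_sum)
  finally show ?thesis .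
qed

lemma test_fun_mono: "\<Omega> \<subseteq> \<Omega>' \<Longrightarrow> \<phi> \<in> test_fun \<Omega> \<Longrightarrow> \<phi> \<in> test_fun \<Omega>'"
  by (auto simp: test_fun_def)

text \<open>Hypothesis \<open>sub\<close> says that the Gram matrix of the energy form is at most
  the identity. The inequality is the right form of orthonormality here: it survives the
  approximation by test functions after a rescaling, and it is all that duality uses.\<close>

theorem collective_trudinger:
  fixes \<phi> :: "'i \<Rightarrow> real^2 \<Rightarrow> complex"
  assumes fin: "finite I" and test: "\<And>i. i \<in> I \<Longrightarrow> \<phi> i \<in> test_fun UNIV" and E: "E > 0"
    and sub: "\<And>c. energy E (\<lambda>x. \<Sum>i\<in>I. c i * \<phi> i x) \<le> (\<Sum>i\<in>I. (cmod (c i))\<^sup>2)"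
  defines "\<rho> \<equiv> \<lambda>x. \<Sum>i\<in>I. (cmod (\<phi> i x))\<^sup>2"
  shows "(\<integral>\<^sup>+x. ennreal (E * \<rho> x * exp (\<rho> x / 64)) \<partial>lborel) \<le> ennreal (4 * real (card I))"
proof -
  have cont: "continuous_on UNIV (\<phi> i)" if "i \<in> I" for i
    by (rule test_fun_continuous[OF test[OF that]])
  have "\<exists>K. compact K \<and> (\<forall>i\<in>I. \<forall>x. x \<notin> K \<longrightarrow> \<phi> i x = 0)"
    using fin test
  proof (induction I rule: finite_induct)
    case (insert j I)
    have "\<exists>K. compact K \<and> (\<forall>i\<in>I. \<forall>x. x \<notin> K \<longrightarrow> \<phi> i x = 0)"
      by (rule insert.IH) (rule insert.prems, simp)
    then obtain K where K: "compact K" "\<forall>i\<in>I. \<forall>x. x \<notin> K \<longrightarrow> \<phi> i x = 0" by blast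
    have "\<phi> j \<in> test_fun UNIV" by (rule insert.prems) simp
    then obtain K' where K': "compact K'" "\<forall>x. x \<notin> K' \<longrightarrow> \<phi> j x = 0"
      using test_fun_support by blast
    show ?case
      using K K' by (intro exI[of _ "K \<union> K'"]) (auto intro: compact_Un)
  qed auto
  then obtain K where K: "compact K" "\<And>i x. i \<in> I \<Longrightarrow> x \<notin> K \<Longrightarrow> \<phi> i x = 0" by blast
  then obtain R where R: "\<And>x. x \<in> K \<Longrightarrow> norm x \<le> R"
    using compact_imp_bounded[OF K(1)] by (auto simp: bounded_iff)
  \<comment> \<open>The first entry makes the open square contain all supports; the second gives
    \<open>l \<ge> 1\<close>, as \<open>low_sum_le\<close> demands.\<close>
  define L where "L = max (2 * (\<bar>R\<bar> + 1)) (1 / sqrt E)"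
  define l where "l = E * L\<^sup>2"
  have L: "L > 0" using E by (simp add: L_def less_max_iff_disj)
  have l: "l \<ge> 1"
  proof -
    have "(1 / sqrt E)\<^sup>2 \<le> L\<^sup>2" using E by (intro power_mono) (auto simp: L_def)
    then have "E * (1 / sqrt E)\<^sup>2 \<le> E * L\<^sup>2" using E by (intro mult_left_mono) auto
    then show ?thesis using E by (simp add: l_def power_divide)
  qed
  have outside: "\<phi> i x = 0" if "i \<in> I" "\<exists>j. x $ j \<le> - (L / 2) \<or> x $ j \<ge> L / 2" for i x
  proof (rule K(2)[OF that(1)])
    from that(2) obtain j where "x $ j \<le> - (L / 2) \<or> x $ j \<ge> L / 2" by blast
    then have "\<bar>x $ j\<bar> \<ge> L / 2" by arith
    then have "norm x \<ge> L / 2" using component_le_norm_cart[of x j] by linarith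
    moreover have "L / 2 \<ge> \<bar>R\<bar> + 1" by (simp add: L_def)
    ultimately show "x \<notin> K" using R[of x] by force
  qed
  have supp_sum: "supported L (\<lambda>x. \<Sum>i\<in>I. c i * \<phi> i x)" for c
    by unfold_locales (use L outside test in \<open>auto intro!: test_fun_sum[OF fin] sum.neutral\<close>)
  have supp: "supported L (\<phi> i)" if "i \<in> I" for i
    by unfold_locales (use L outside test that in auto)
  have energy1: "energy E (\<phi> i) \<le> 1" if "i \<in> I" for i
    using sub[of "\<lambda>j. if j = i then 1 else 0"] fin that by (simp add: if_distrib if_distribR cong: if_cong)
  have grad_nonneg: "0 \<le> grad_sq f" for f
    by (simp add: grad_sq_def sum_nonneg Bochner_Integration.integral_nonneg)
  have grad1: "grad_sq (\<phi> i) \<le> 1" and mass1: "E * (LINT x|lborel. (cmod (\<phi> i x))\<^sup>2) \<le> 1" if "i \<in> I" for i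
  proof -
    have "0 \<le> E * (LINT x|lborel. (cmod (\<phi> i x))\<^sup>2)"
      using E by (simp add: Bochner_Integration.integral_nonneg)
    then show "grad_sq (\<phi> i) \<le> 1" "E * (LINT x|lborel. (cmod (\<phi> i x))\<^sup>2) \<le> 1"
      using energy1[OF that] grad_nonneg[of "\<phi> i"] unfolding energy_def by linarith+
  qed
  define P where "P M i x = fsum L (\<phi> i) (kbox M) x" for M i x
  have contP: "continuous_on UNIV (P M i)" for M i
    unfolding P_def[abs_def] fsum_def by (rule continuous_on_trig_sum)
  \<comment> \<open>Duality: with the coefficients \<open>cnj (P M i x)\<close> the combination has
    low-pass value \<open>s\<close> at \<open>x\<close> and energy at most \<open>s\<close>, so the
    bound for one function reads \<open>s\<^sup>2 \<le> low_sum l M * s\<close>.\<close>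
  have low: "(\<Sum>i\<in>I. (cmod (P M i x))\<^sup>2) \<le> low_sum l M" for M x
  proof -
    define s where "s = (\<Sum>i\<in>I. (cmod (P M i x))\<^sup>2)"
    have s: "0 \<le> s" by (simp add: s_def sum_nonneg)
    have "(\<Sum>i\<in>I. cnj (P M i x) * P M i x) = of_real s"
      unfolding s_def of_real_sum complex_norm_square by (simp add: mult.commute)
    then have "fsum L (\<lambda>y. \<Sum>i\<in>I. cnj (P M i x) * \<phi> i y) (kbox M) x = of_real s"
      by (subst fsum_linear[OF fin cont]) (auto simp: P_def)
    then have "s\<^sup>2 \<le> low_sum l M * energy E (\<lambda>y. \<Sum>i\<in>I. cnj (P M i x) * \<phi> i y)"
      using supported.low_pass_bound[OF supp_sum E, of "\<lambda>i. cnj (P M i x)" M x] by (simp add: l_def)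
    also have "\<dots> \<le> low_sum l M * s"
    proof (rule mult_left_mono)
      show "energy E (\<lambda>y. \<Sum>i\<in>I. cnj (P M i x) * \<phi> i y) \<le> s"
        using sub[of "\<lambda>i. cnj (P M i x)"] by (simp add: s_def)
      show "0 \<le> low_sum l M"
        using l unfolding low_sum_def by (intro sum_nonneg) (auto simp: freq2_nonneg)
    qed
    finally have "s * s \<le> low_sum l M * s" by (simp add: power2_eq_square)
    moreover have "0 \<le> low_sum l M"
      using l unfolding low_sum_def by (intro sum_nonneg) (auto simp: freq2_nonneg)
    ultimately have "s \<le> low_sum l M"
      using s by (cases "s = 0") (auto simp: mult_le_cancel_right)
    then show ?thesis by (simp add: s_def)
  qed
  define h where "h M x = (\<Sum>i\<in>I. (cmod (\<phi> i x - P M i x))\<^sup>2)" for M x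
  define w where "w M = (2 * pi / L)\<^sup>2 * (2 * real M + 1)" for M :: nat
  have w: "0 \<le> w M" for M by (simp add: w_def)
  have h: "0 \<le> h M x" for M x by (simp add: h_def sum_nonneg)
  have conth: "continuous_on UNIV (h M)" for M
    unfolding h_def[abs_def] by (intro continuous_intros cont contP)
  have cont\<rho>: "continuous_on UNIV \<rho>"
    unfolding \<rho>_def by (intro continuous_intros cont)
  have \<rho>0: "\<rho> x = 0" if "x \<notin> K" for x
    using K(2)[OF _ that] by (simp add: \<rho>_def)
  have \<rho>_nonneg: "0 \<le> \<rho> x" for x by (simp add: \<rho>_def sum_nonneg)
  \<comment> \<open>This spends only the gradient part of the energy, at most one unit for each
    function.\<close>
  have high: "(\<Sum>M<N. w M * (LINT x|cell L. h M x)) \<le> real (card I)" for N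
  proof -
    have "(\<Sum>M<N. w M * (LINT x|cell L. h M x))
        = (\<Sum>M<N. \<Sum>i\<in>I. w M * (LINT x|cell L. (cmod (\<phi> i x - P M i x))\<^sup>2))"
      unfolding h_def
      by (subst Bochner_Integration.integral_sum)
         (auto intro!: integrable_cell continuous_intros cont contP simp: sum_distrib_left)
    also have "\<dots> = (\<Sum>i\<in>I. \<Sum>M<N. w M * (LINT x|cell L. (cmod (\<phi> i x - P M i x))\<^sup>2))"
      by (rule sum.swap)
    also have "\<dots> \<le> (\<Sum>i\<in>I. 1)"
      using supported.high_pass_bound[OF supp] grad1
      by (intro sum_mono) (fastforce simp: w_def P_def intro: order_trans)
    finally show ?thesis by simp
  qed
  have "bounded (\<rho> ` K)"
    by (intro compact_imp_bounded compact_continuous_image K(1) continuous_on_subset[OF cont\<rho>]) auto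
  then obtain B0 where B0: "\<And>x. x \<in> K \<Longrightarrow> norm (\<rho> x) \<le> B0"
    by (auto simp: bounded_iff)
  define B where "B = max 0 B0"
  have B: "\<rho> x \<le> B" for x
    using B0[of x] \<rho>0[of x] by (cases "x \<in> K") (auto simp: B_def)
  \<comment> \<open>Since \<open>\<rho>\<close> is bounded by \<open>B\<close>, this many cutoffs
    suffice at every point, and \<open>G\<close> is a finite sum of continuous functions.\<close>
  define N where "N = nat \<lceil>sqrt (l * exp (B / 64))\<rceil> + 1"
  define G where "G x = (\<Sum>M<N. w M * h M x)" for x
  have contG: "continuous_on UNIV G"
    unfolding G_def[abs_def] by (intro continuous_intros conth)
  have G_nonneg: "0 \<le> G x" for x by (simp add: G_def sum_nonneg w h)
  \<comment> \<open>The low frequencies are to carry at most \<open>\<rho> x / 4\<close>. As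
    \<open>1 \<le> \<rho> x / 8\<close>, the bound \<open>1 + 8 * ln (1 + M\<^sup>2 / l)\<close>
    achieves this while the logarithm is at most \<open>\<rho> x / 64\<close>, that is, while
    \<open>M\<^sup>2 \<le> r\<close>. For these cutoffs
    \<open>\<rho> x \<le> \<rho> x / 2 + 2 * h M x\<close>, so \<open>h M x\<close> is at least
    \<open>\<rho> x / 4\<close>.\<close>
  have G_ge: "E * \<rho> x * (exp (\<rho> x / 64) - 1) \<le> G x" if "\<rho> x \<ge> 8" for x
  proof -
    define r where "r = l * (exp (\<rho> x / 64) - 1)"
    have r: "0 \<le> r" using l \<rho>_nonneg[of x] by (auto simp: r_def)
    \<comment> \<open>The admissible cutoffs are \<open>0, ..., m\<close>. Counting all
      \<open>m + 1\<close> of them matters: their odd weights sum to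
      \<open>(m + 1)\<^sup>2 \<ge> r\<close>, whereas \<open>m\<^sup>2\<close> may fall below
      \<open>r\<close>.\<close>
    define m where "m = nat \<lfloor>sqrt r\<rfloor>"
    have m1: "real m \<le> sqrt r" and m2: "sqrt r \<le> real (m + 1)"
      using r real_of_int_floor_add_one_ge[of "sqrt r"] by (auto simp: m_def add.commute)
    have "sqrt r \<le> sqrt (l * exp (B / 64))"
      using l B[of x] unfolding r_def
      by (intro real_sqrt_le_mono mult_left_mono) (auto intro: order_trans[of _ "exp (\<rho> x / 64)"])
    then have "\<lfloor>sqrt r\<rfloor> \<le> \<lceil>sqrt (l * exp (B / 64))\<rceil>"
      using floor_mono floor_le_ceiling order_trans by blast
    then have "m + 1 \<le> N"
      unfolding m_def N_def by (intro add_mono nat_mono) auto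
    have hM: "\<rho> x / 4 \<le> h M x" if "M < m + 1" for M
    proof -
      have "real M \<le> sqrt r" using that m1 by linarith
      then have "(real M)\<^sup>2 \<le> (sqrt r)\<^sup>2" by (intro power_mono) auto
      then have "(real M)\<^sup>2 \<le> l * (exp (\<rho> x / 64) - 1)" using r by (simp add: r_def)
      then have "1 + (real M)\<^sup>2 / l \<le> exp (\<rho> x / 64)" using l by (simp add: field_simps)
      then have "ln (1 + (real M)\<^sup>2 / l) \<le> ln (exp (\<rho> x / 64))"
        using l by (subst ln_le_cancel_iff) (auto intro!: add_pos_nonneg)
      then have "low_sum l M \<le> \<rho> x / 4"
        using low_sum_le[OF l, of M] \<open>\<rho> x \<ge> 8\<close> by simp
      then have "(\<Sum>i\<in>I. (cmod (P M i x))\<^sup>2) \<le> \<rho> x / 4" using low[of M x] by linarith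
      moreover have "\<rho> x \<le> 2 * (\<Sum>i\<in>I. (cmod (P M i x))\<^sup>2) + 2 * h M x"
        unfolding \<rho>_def h_def sum_distrib_left sum.distrib[symmetric]
        using norm_add_sq_le[of "P M i x" "\<phi> i x - P M i x" for i] by (intro sum_mono) simp
      ultimately show ?thesis by linarith
    qed
    have "E * \<rho> x * (exp (\<rho> x / 64) - 1) \<le> pi\<^sup>2 * (E * \<rho> x * (exp (\<rho> x / 64) - 1))"
    proof -
      have "1 \<le> pi\<^sup>2" using pi_gt3 by (intro one_le_power) simp
      moreover have "0 \<le> E * \<rho> x * (exp (\<rho> x / 64) - 1)"
        using E \<rho>_nonneg[of x] by simp
      ultimately show ?thesis by (metis mult_right_mono mult_1)
    qed
    \<comment> \<open>The side of the square drops out here, because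
      \<open>(2 * pi / L)\<^sup>2 * l = 4 * pi\<^sup>2 * E\<close>.\<close>
    also have "\<dots> = (\<rho> x / 4) * ((2 * pi / L)\<^sup>2 * r)"
      using L by (simp add: r_def l_def power_divide power_mult_distrib)
    also have "\<dots> \<le> (\<rho> x / 4) * ((2 * pi / L)\<^sup>2 * (real (m + 1))\<^sup>2)"
    proof (intro mult_left_mono)
      have "(sqrt r)\<^sup>2 \<le> (real (m + 1))\<^sup>2" using m2 r by (intro power_mono) auto
      then show "r \<le> (real (m + 1))\<^sup>2" using r by simp
    qed (use \<rho>_nonneg[of x] in auto)
    also have "\<dots> = (\<Sum>M<m + 1. w M * (\<rho> x / 4))"
      unfolding sum_odd_eq_square[symmetric] w_def sum_distrib_left by (intro sum.cong) auto
    also have "\<dots> \<le> (\<Sum>M<m + 1. w M * h M x)"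
      by (intro sum_mono mult_left_mono hM w) auto
    also have "\<dots> \<le> G x"
      unfolding G_def using \<open>m + 1 \<le> N\<close> w h by (intro sum_mono2) auto
    finally show ?thesis .
  qed
  define F where "F x = E * \<rho> x * exp (\<rho> x / 64)" for x
  \<comment> \<open>Where \<open>\<rho> x \<ge> 8\<close>, undoing the \<open>- 1\<close> in
    \<open>G_ge\<close> costs one \<open>E * \<rho> x\<close>; elsewhere the exponential is at most
    \<open>exp (1 / 8) \<le> 2\<close>. After integration the two terms contribute at most
    \<open>card I\<close> and \<open>2 * card I\<close>.\<close>
  have F_le: "F x \<le> G x + 2 * (E * \<rho> x)" for x
  proof (cases "\<rho> x \<ge> 8")
    case True
    have "0 \<le> E * \<rho> x" using E \<rho>_nonneg[of x] by simp
    then show ?thesis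
      using G_ge[OF True] by (simp add: F_def right_diff_distrib)
  next
    case False
    then have "exp (\<rho> x / 64) \<le> exp (1 / 8)" by simp
    also note exp_eighth_le
    finally have "(E * \<rho> x) * exp (\<rho> x / 64) \<le> (E * \<rho> x) * 2"
      using E \<rho>_nonneg[of x] by (intro mult_left_mono) auto
    then show ?thesis using G_nonneg[of x] by (simp add: F_def)
  qed
  have contF: "continuous_on UNIV F"
    unfolding F_def[abs_def] by (intro continuous_intros cont\<rho>) auto
  have K_cell: "x \<notin> K" if "x \<notin> cbox (\<chi> i. - (L / 2)) (\<chi> i. L / 2)" for x
  proof
    assume "x \<in> K"
    have "- (L / 2) \<le> x $ j \<and> x $ j \<le> L / 2" for j
    proof -
      have "\<bar>x $ j\<bar> \<le> L / 2"
        using component_le_norm_cart[of x j] R[OF \<open>x \<in> K\<close>] by (simp add: L_def)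
      from abs_le_D1[OF this] abs_le_D2[OF this] show ?thesis by simp
    qed
    then show False using that by (simp add: mem_cell)
  qed
  have "(LINT x|lborel. F x) = (LINT x|cell L. F x)"
    by (rule integral_cell_eq_lborel[symmetric]) (auto simp: F_def \<rho>0 K_cell)
  also have "\<dots> \<le> (LINT x|cell L. G x + 2 * (E * \<rho> x))"
    by (intro integral_mono integrable_cell contF continuous_intros contG cont\<rho> F_le)
  also have "\<dots> = (LINT x|cell L. G x) + 2 * (E * (LINT x|cell L. \<rho> x))"
    by (subst Bochner_Integration.integral_add) (auto intro!: integrable_cell continuous_intros contG cont\<rho>)
  also have "(LINT x|cell L. G x) = (\<Sum>M<N. w M * (LINT x|cell L. h M x))"
    unfolding G_def by (subst Bochner_Integration.integral_sum) (auto intro!: integrable_cell continuous_intros conth)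
  also have "E * (LINT x|cell L. \<rho> x) = (\<Sum>i\<in>I. E * (LINT x|lborel. (cmod (\<phi> i x))\<^sup>2))"
  proof -
    have "(LINT x|cell L. \<rho> x) = (\<Sum>i\<in>I. LINT x|cell L. (cmod (\<phi> i x))\<^sup>2)"
      unfolding \<rho>_def by (rule Bochner_Integration.integral_sum) (intro integrable_cell continuous_intros cont)
    also have "\<dots> = (\<Sum>i\<in>I. LINT x|lborel. (cmod (\<phi> i x))\<^sup>2)"
      by (intro sum.cong integral_cell_eq_lborel) (auto simp: K(2) K_cell)
    finally show ?thesis by (simp add: sum_distrib_left)
  qed
  also have "(\<Sum>M<N. w M * (LINT x|cell L. h M x)) + 2 * (\<Sum>i\<in>I. E * (LINT x|lborel. (cmod (\<phi> i x))\<^sup>2))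
      \<le> real (card I) + 2 * (\<Sum>i\<in>I. 1)"
    using high by (intro add_mono mult_left_mono sum_mono mass1) auto
  also have "\<dots> \<le> 4 * real (card I)" by simp
  finally have "(LINT x|lborel. F x) \<le> 4 * real (card I)" .
  moreover have "(\<integral>\<^sup>+x. ennreal (F x) \<partial>lborel) = ennreal (LINT x|lborel. F x)"
  proof (rule nn_integral_eq_integral)
    show "integrable lborel F"
      by (rule integrable_continuous_compact_support[OF contF K(1)]) (simp add: F_def \<rho>0)
  qed (use E \<rho>_nonneg in \<open>auto simp: F_def\<close>)
  ultimately show ?thesis
    unfolding F_def by (simp add: ennreal_leI)
qed

section \<open>Square-integrable functions and the form domain\<close>

lemma L2_measurable: "u \<in> L2 \<Omega> \<Longrightarrow> u \<in> borel_measurable (lebesgue_on \<Omega>)"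
  by (simp add: L2_def)

lemma L2_integrable: "u \<in> L2 \<Omega> \<Longrightarrow> integrable (lebesgue_on \<Omega>) (\<lambda>x. (cmod (u x))\<^sup>2)"
  by (simp add: L2_def)

lemma L2_zero: "(\<lambda>x. 0) \<in> L2 \<Omega>"
  by (simp add: L2_def)

lemma L2_cmult: "u \<in> L2 \<Omega> \<Longrightarrow> (\<lambda>x. c * u x) \<in> L2 \<Omega>"
  by (auto simp: L2_def norm_mult power_mult_distrib)

lemma L2_cnj: "u \<in> L2 \<Omega> \<Longrightarrow> (\<lambda>x. cnj (u x)) \<in> L2 \<Omega>"
  by (auto simp: L2_def borel_measurable_complex_iff)

lemma L2_add:
  assumes "u \<in> L2 \<Omega>" "v \<in> L2 \<Omega>"
  shows "(\<lambda>x. u x + v x) \<in> L2 \<Omega>"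
proof -
  note [measurable] = L2_measurable[OF assms(1)] L2_measurable[OF assms(2)]
  have "integrable (lebesgue_on \<Omega>) (\<lambda>x. (cmod (u x + v x))\<^sup>2)"
  proof (rule Bochner_Integration.integrable_bound)
    show "integrable (lebesgue_on \<Omega>) (\<lambda>x. 2 * (cmod (u x))\<^sup>2 + 2 * (cmod (v x))\<^sup>2)"
      using L2_integrable[OF assms(1)] L2_integrable[OF assms(2)] by simp
    show "AE x in lebesgue_on \<Omega>. norm ((cmod (u x + v x))\<^sup>2) \<le> norm (2 * (cmod (u x))\<^sup>2 + 2 * (cmod (v x))\<^sup>2)"
      using norm_add_sq_le[of "u x" "v x" for x] by (intro AE_I2) simp
  qed measurable
  then show ?thesis by (simp add: L2_def)
qed

lemma L2_sum:
  "finite I \<Longrightarrow> (\<And>i. i \<in> I \<Longrightarrow> u i \<in> L2 \<Omega>) \<Longrightarrow> (\<lambda>x. \<Sum>i\<in>I. c i * u i x) \<in> L2 \<Omega>"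
proof (induction I rule: finite_induct)
  case (insert a I)
  have "(\<lambda>x. c a * u a x + (\<Sum>i\<in>I. c i * u i x)) \<in> L2 \<Omega>"
    by (rule L2_add[OF L2_cmult]) (use insert in auto)
  then show ?case using insert by simp
qed (simp add: L2_zero)

lemma L2_diff: "u \<in> L2 \<Omega> \<Longrightarrow> v \<in> L2 \<Omega> \<Longrightarrow> (\<lambda>x. u x - v x) \<in> L2 \<Omega>"
  using L2_add[of u \<Omega> "\<lambda>x. (-1) * v x"] L2_cmult[of v \<Omega> "-1"] by simp

lemma L2_mult_integrable:
  assumes "u \<in> L2 \<Omega>" "v \<in> L2 \<Omega>"
  shows "integrable (lebesgue_on \<Omega>) (\<lambda>x. u x * v x)"
proof -
  note [measurable] = L2_measurable[OF assms(1)] L2_measurable[OF assms(2)]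
  show ?thesis
  proof (rule Bochner_Integration.integrable_bound)
    show "integrable (lebesgue_on \<Omega>) (\<lambda>x. (cmod (u x))\<^sup>2 + (cmod (v x))\<^sup>2)"
      using L2_integrable[OF assms(1)] L2_integrable[OF assms(2)] by simp
    have "cmod (u x * v x) \<le> (cmod (u x))\<^sup>2 + (cmod (v x))\<^sup>2" for x
    proof -
      have "0 \<le> cmod (u x) * cmod (v x)" by simp
      then show ?thesis
        using sum_squares_bound[of "cmod (u x)" "cmod (v x)"] unfolding norm_mult by linarith
    qed
    then show "AE x in lebesgue_on \<Omega>. norm (u x * v x) \<le> norm ((cmod (u x))\<^sup>2 + (cmod (v x))\<^sup>2)"
      by (intro AE_I2) simp
  qed measurable
qed

definition sqn :: "('a::euclidean_space) set \<Rightarrow> ('a \<Rightarrow> complex) \<Rightarrow> real"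
  where "sqn \<Omega> u = (LINT x|lebesgue_on \<Omega>. (cmod (u x))\<^sup>2)"

lemma sqn_nonneg: "0 \<le> sqn \<Omega> u"
  by (simp add: sqn_def Bochner_Integration.integral_nonneg)

lemma sqn_cmult: "sqn \<Omega> (\<lambda>x. c * u x) = (cmod c)\<^sup>2 * sqn \<Omega> u"
  by (simp add: sqn_def norm_mult power_mult_distrib)

text \<open>The cross term is split with weight \<open>t\<close>. For small \<open>t\<close> the
  first summand keeps a constant close to one, which the factor \<open>1 + \<eta>\<close> in
  \<open>h10_pair_approximation\<close> requires.\<close>

lemma norm_add_sq_le_weighted:
  fixes a b :: "'a::real_normed_vector"
  assumes "t > 0"
  shows "(norm (a + b))\<^sup>2 \<le> (1 + t) * (norm a)\<^sup>2 + (1 + 1 / t) * (norm b)\<^sup>2"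
proof -
  have "(norm (a + b))\<^sup>2 \<le> (norm a + norm b)\<^sup>2" by (intro power_mono norm_triangle_ineq) auto
  also have "\<dots> \<le> (1 + t) * (norm a)\<^sup>2 + (1 + 1 / t) * (norm b)\<^sup>2"
  proof -
    have "0 \<le> (sqrt t * norm a - norm b / sqrt t)\<^sup>2" by simp
    also have "\<dots> = t * (norm a)\<^sup>2 + (norm b)\<^sup>2 / t - 2 * norm a * norm b"
      using assms by (simp add: power2_diff power_mult_distrib power_divide)
    finally show ?thesis by (simp add: power2_sum algebra_simps)
  qed
  finally show ?thesis .
qed

lemma sqn_add_le:
  assumes "u \<in> L2 \<Omega>" "v \<in> L2 \<Omega>" "t > 0"
  shows "sqn \<Omega> (\<lambda>x. u x + v x) \<le> (1 + t) * sqn \<Omega> u + (1 + 1 / t) * sqn \<Omega> v"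
proof -
  have "sqn \<Omega> (\<lambda>x. u x + v x) \<le> (LINT x|lebesgue_on \<Omega>. (1 + t) * (cmod (u x))\<^sup>2 + (1 + 1 / t) * (cmod (v x))\<^sup>2)"
    unfolding sqn_def
    using L2_integrable[OF L2_add[OF assms(1,2)]] L2_integrable[OF assms(1)] L2_integrable[OF assms(2)]
    by (intro integral_mono norm_add_sq_le_weighted[OF assms(3)]) auto
  also have "\<dots> = (1 + t) * sqn \<Omega> u + (1 + 1 / t) * sqn \<Omega> v"
    unfolding sqn_def using L2_integrable[OF assms(1)] L2_integrable[OF assms(2)]
    by (subst Bochner_Integration.integral_add) auto
  finally show ?thesis .
qed

lemma norm_sum_mult_sq_le:
  fixes c z :: "'i \<Rightarrow> complex"
  shows "(cmod (\<Sum>i\<in>I. c i * z i))\<^sup>2 \<le> (\<Sum>i\<in>I. (cmod (c i))\<^sup>2) * (\<Sum>i\<in>I. (cmod (z i))\<^sup>2)"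
proof -
  have "cmod (\<Sum>i\<in>I. c i * z i) \<le> (\<Sum>i\<in>I. cmod (c i) * cmod (z i))"
    using norm_sum[of "\<lambda>i. c i * z i" I] by (simp add: norm_mult)
  then have "(cmod (\<Sum>i\<in>I. c i * z i))\<^sup>2 \<le> (\<Sum>i\<in>I. cmod (c i) * cmod (z i))\<^sup>2"
    by (intro power_mono) auto
  also have "\<dots> \<le> (\<Sum>i\<in>I. (cmod (c i))\<^sup>2) * (\<Sum>i\<in>I. (cmod (z i))\<^sup>2)"
    by (rule Cauchy_Schwarz_ineq_sum)
  finally show ?thesis .
qed

text \<open>Cauchy-Schwarz in the coefficients makes approximation errors uniform in
  \<open>c\<close>, relative to the sum of the squares of its entries.\<close>

lemma sqn_sum_le:
  assumes "finite I" "\<And>i. i \<in> I \<Longrightarrow> u i \<in> L2 \<Omega>"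
  shows "sqn \<Omega> (\<lambda>x. \<Sum>i\<in>I. c i * u i x) \<le> (\<Sum>i\<in>I. (cmod (c i))\<^sup>2) * (\<Sum>i\<in>I. sqn \<Omega> (u i))"
proof -
  have "sqn \<Omega> (\<lambda>x. \<Sum>i\<in>I. c i * u i x)
      \<le> (LINT x|lebesgue_on \<Omega>. (\<Sum>i\<in>I. (cmod (c i))\<^sup>2) * (\<Sum>i\<in>I. (cmod (u i x))\<^sup>2))"
    unfolding sqn_def
    by (intro integral_mono norm_sum_mult_sq_le L2_integrable L2_sum assms integrable_mult_right
        Bochner_Integration.integrable_sum) (auto intro: L2_integrable assms)
  also have "\<dots> = (\<Sum>i\<in>I. (cmod (c i))\<^sup>2) * (\<Sum>i\<in>I. sqn \<Omega> (u i))"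
    unfolding sqn_def
    by (subst Bochner_Integration.integral_sum[symmetric]) (auto intro: L2_integrable assms)
  finally show ?thesis .
qed

text \<open>Pythagoras: the real part of the cross term integrates to zero.\<close>

lemma sqn_le_orthogonal:
  assumes "u \<in> L2 \<Omega>" "v \<in> L2 \<Omega>" "(LINT x|lebesgue_on \<Omega>. v x * cnj (u x)) = 0"
  shows "sqn \<Omega> u \<le> sqn \<Omega> (\<lambda>x. u x + v x)"
proof -
  have int: "integrable (lebesgue_on \<Omega>) (\<lambda>x. v x * cnj (u x))"
    by (rule L2_mult_integrable[OF assms(2) L2_cnj[OF assms(1)]])
  have Re0: "(LINT x|lebesgue_on \<Omega>. Re (v x * cnj (u x))) = 0"
    using integral_Re[OF int] assms(3) by simp
  have "(cmod (u x))\<^sup>2 \<le> (cmod (u x + v x))\<^sup>2 - 2 * Re (v x * cnj (u x))" for x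
    unfolding cmod_power2 by (simp add: power2_eq_square algebra_simps)
  moreover have intRe: "integrable (lebesgue_on \<Omega>) (\<lambda>x. 2 * Re (v x * cnj (u x)))"
    by (intro integrable_mult_right integrable_Re int)
  ultimately have "sqn \<Omega> u \<le> (LINT x|lebesgue_on \<Omega>. (cmod (u x + v x))\<^sup>2 - 2 * Re (v x * cnj (u x)))"
    unfolding sqn_def
    by (intro integral_mono Bochner_Integration.integrable_diff L2_integrable[OF L2_add[OF assms(1,2)]] L2_integrable[OF assms(1)])
  also have "\<dots> = sqn \<Omega> (\<lambda>x. u x + v x) - 2 * (LINT x|lebesgue_on \<Omega>. Re (v x * cnj (u x)))"
    unfolding sqn_def
    by (subst Bochner_Integration.integral_diff[OF L2_integrable[OF L2_add[OF assms(1,2)]] intRe])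
       (simp only: integral_mult_right_zero)
  finally show ?thesis using Re0 by simp
qed

section \<open>Test functions on a domain\<close>

lemma norm_sq_complex_vec: "(norm (z :: complex^'n))\<^sup>2 = (\<Sum>i\<in>UNIV. (cmod (z $ i))\<^sup>2)"
  by (simp add: norm_vec_def L2_set_def sum_nonneg)

lemma open_sets_lebesgue: "open \<Omega> \<Longrightarrow> \<Omega> \<in> sets lebesgue"
  by (simp add: sets_completionI_sets)

lemma borel_measurable_lebesgue_on:
  "f \<in> borel_measurable borel \<Longrightarrow> f \<in> borel_measurable (lebesgue_on \<Omega>)"
  by (intro measurable_restrict_space1 measurable_completion) simp

lemma lebesgue_on_vanishing_outside:
  fixes g :: "'a::euclidean_space \<Rightarrow> 'b::euclidean_space"
  assumes "open \<Omega>" "g \<in> borel_measurable borel" "\<And>x. x \<notin> \<Omega> \<Longrightarrow> g x = 0"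
  shows "(LINT x|lebesgue_on \<Omega>. g x) = (LINT x|lborel. g x)"
    and "integrable (lebesgue_on \<Omega>) g \<longleftrightarrow> integrable lborel g"
proof -
  have g: "(\<lambda>x. if x \<in> \<Omega> then g x else 0) = g" using assms(3) by auto
  have g': "g \<in> borel_measurable lborel" using assms(2) by simp
  show "(LINT x|lebesgue_on \<Omega>. g x) = (LINT x|lborel. g x)"
    using Lebesgue_Measure.integral_restrict_UNIV[OF open_sets_lebesgue[OF assms(1)], of g] g'
    by (simp add: g integral_completion)
  show "integrable (lebesgue_on \<Omega>) g \<longleftrightarrow> integrable lborel g"
    using Lebesgue_Measure.integrable_restrict_UNIV[OF open_sets_lebesgue[OF assms(1)], of g] g'
    by (simp add: g integrable_completion)
qed

lemma test_fun_borel: "\<phi> \<in> test_fun \<Omega> \<Longrightarrow> \<phi> \<in> borel_measurable borel"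
  by (intro borel_measurable_continuous_onI test_fun_continuous)

lemma test_fun_L2:
  assumes "open \<Omega>" "\<phi> \<in> test_fun \<Omega>"
  shows "\<phi> \<in> L2 \<Omega>"
proof -
  obtain K where K: "compact K" "\<forall>x. x \<notin> K \<longrightarrow> \<phi> x = 0"
    using test_fun_support[OF assms(2)] by blast
  have "continuous_on UNIV (\<lambda>x. (cmod (\<phi> x))\<^sup>2)"
    by (intro continuous_intros test_fun_continuous[OF assms(2)])
  then have "integrable lborel (\<lambda>x. (cmod (\<phi> x))\<^sup>2)"
    by (rule integrable_continuous_compact_support[OF _ K(1)]) (use K(2) in auto)
  then have "integrable (lebesgue_on \<Omega>) (\<lambda>x. (cmod (\<phi> x))\<^sup>2)"
    using test_fun_borel[OF assms(2)] test_fun_outside[OF assms(2)]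
    by (subst lebesgue_on_vanishing_outside(2)[OF assms(1)]) auto
  then show ?thesis
    by (simp add: L2_def borel_measurable_lebesgue_on test_fun_borel[OF assms(2)])
qed

lemma test_fun_sqn:
  assumes "open \<Omega>" "\<phi> \<in> test_fun \<Omega>"
  shows "sqn \<Omega> \<phi> = (LINT x|lborel. (cmod (\<phi> x))\<^sup>2)"
  unfolding sqn_def using test_fun_borel[OF assms(2)] test_fun_outside[OF assms(2)]
  by (subst lebesgue_on_vanishing_outside(1)[OF assms(1)]) auto

lemma test_fun_by_parts_on:
  assumes "open \<Omega>" "\<phi> \<in> test_fun \<Omega>" "\<psi> \<in> test_fun \<Omega>"
  shows "(LINT x|lebesgue_on \<Omega>. \<phi> x * partial_deriv i \<psi> x) = - (LINT x|lebesgue_on \<Omega>. partial_deriv i \<phi> x * \<psi> x)"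
proof -
  note m = test_fun_borel[OF assms(2)] test_fun_borel[OF assms(3)]
    test_fun_borel[OF test_fun_partial_deriv[OF assms(2)], of i] test_fun_borel[OF test_fun_partial_deriv[OF assms(3)], of i]
  have "(LINT x|lebesgue_on \<Omega>. \<phi> x * partial_deriv i \<psi> x) = (LINT x|lborel. \<phi> x * partial_deriv i \<psi> x)"
    by (rule lebesgue_on_vanishing_outside(1)[OF assms(1)]) (use m test_fun_outside[OF assms(2)] in auto)
  moreover have "(LINT x|lebesgue_on \<Omega>. partial_deriv i \<phi> x * \<psi> x) = (LINT x|lborel. partial_deriv i \<phi> x * \<psi> x)"
    by (rule lebesgue_on_vanishing_outside(1)[OF assms(1)]) (use m test_fun_outside[OF assms(3)] in auto)
  ultimately show ?thesis
    using test_fun_by_parts[OF assms(2,3)] by simp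
qed

section \<open>Functions of the form domain with a prescribed gradient\<close>

text \<open>Since \<open>weak_grad\<close> is an arbitrary choice, the gradient chosen for a sum
  need not be the sum of the chosen gradients pointwise. A pair carries its own gradient
  \<open>G\<close> and is stable under linear combinations. The field \<open>D\<close> plays the
  part of the gradient of \<open>u - \<phi>\<close>, but \<open>G - D\<close> and the gradient of
  \<open>\<phi>\<close> are compared only against test functions.\<close>

definition h10_pair :: "(real^'n) set \<Rightarrow> (real^'n \<Rightarrow> complex) \<Rightarrow> (real^'n \<Rightarrow> complex^'n) \<Rightarrow> bool"
  where "h10_pair \<Omega> u G \<longleftrightarrow> u \<in> L2 \<Omega> \<and> (\<forall>i. (\<lambda>x. G x $ i) \<in> L2 \<Omega>) \<and>
    (\<forall>\<epsilon>>0. \<exists>\<phi>\<in>test_fun \<Omega>. \<exists>D. (\<forall>i. (\<lambda>x. D x $ i) \<in> L2 \<Omega>) \<and>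
      (\<Sum>i\<in>UNIV. sqn \<Omega> (\<lambda>x. D x $ i)) + sqn \<Omega> (\<lambda>x. u x - \<phi> x) < \<epsilon> \<and>
      (\<forall>\<psi>\<in>test_fun \<Omega>. \<forall>i. (LINT x|lebesgue_on \<Omega>. (G x $ i - D x $ i - partial_deriv i \<phi> x) * \<psi> x) = 0))"

lemma is_weak_grad_weak_grad: "is_weak_grad \<Omega> u G \<Longrightarrow> is_weak_grad \<Omega> u (weak_grad \<Omega> u)"
  unfolding weak_grad_def by (rule someI[of "is_weak_grad \<Omega> u"])

text \<open>Both the gradient chosen for \<open>u - \<phi>\<close> and the difference of
  \<open>G\<close> and the classical gradient of \<open>\<phi>\<close> are weak gradients of the
  same function, hence indistinguishable to test functions.\<close>

lemma H10_h10_pair: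
  assumes "open \<Omega>" "u \<in> H10 \<Omega>"
  shows "h10_pair \<Omega> u (weak_grad \<Omega> u)"
proof -
  define G where "G = weak_grad \<Omega> u"
  have u: "u \<in> L2 \<Omega>" and ex: "\<exists>G. is_weak_grad \<Omega> u G"
    using assms(2) by (auto simp: H10_def H1_def)
  have G: "is_weak_grad \<Omega> u G"
    using ex is_weak_grad_weak_grad by (auto simp: G_def)
  then have G_L2: "(\<lambda>x. G x $ i) \<in> L2 \<Omega>" for i by (simp add: is_weak_grad_def)
  have "\<exists>\<phi>\<in>test_fun \<Omega>. \<exists>D. (\<forall>i. (\<lambda>x. D x $ i) \<in> L2 \<Omega>) \<and>
      (\<Sum>i\<in>UNIV. sqn \<Omega> (\<lambda>x. D x $ i)) + sqn \<Omega> (\<lambda>x. u x - \<phi> x) < \<epsilon> \<and>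
      (\<forall>\<psi>\<in>test_fun \<Omega>. \<forall>i. (LINT x|lebesgue_on \<Omega>. (G x $ i - D x $ i - partial_deriv i \<phi> x) * \<psi> x) = 0)"
    if "\<epsilon> > 0" for \<epsilon>
  proof -
    have "\<exists>\<phi>\<in>test_fun \<Omega>. H1_norm \<Omega> (\<lambda>x. u x - \<phi> x) < sqrt \<epsilon>"
      using assms(2) that by (simp add: H10_def)
    then obtain \<phi> where \<phi>: "\<phi> \<in> test_fun \<Omega>" and lt: "H1_norm \<Omega> (\<lambda>x. u x - \<phi> x) < sqrt \<epsilon>" by blast
    define D where "D = weak_grad \<Omega> (\<lambda>x. u x - \<phi> x)"
    have \<phi>_L2: "\<phi> \<in> L2 \<Omega>" by (rule test_fun_L2[OF assms(1) \<phi>])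
    have d\<phi>: "partial_deriv i \<phi> \<in> L2 \<Omega>" for i
      by (rule test_fun_L2[OF assms(1) test_fun_partial_deriv[OF \<phi>]])
    have split: "(LINT x|lebesgue_on \<Omega>. (u x - \<phi> x) * partial_deriv i \<psi> x)
        = - (LINT x|lebesgue_on \<Omega>. (G x $ i - partial_deriv i \<phi> x) * \<psi> x)" if \<psi>: "\<psi> \<in> test_fun \<Omega>" for \<psi> i
    proof -
      have \<psi>_L2: "\<psi> \<in> L2 \<Omega>" "partial_deriv i \<psi> \<in> L2 \<Omega>"
        using test_fun_L2[OF assms(1)] \<psi> test_fun_partial_deriv by blast+
      have "(LINT x|lebesgue_on \<Omega>. (u x - \<phi> x) * partial_deriv i \<psi> x)
        = (LINT x|lebesgue_on \<Omega>. u x * partial_deriv i \<psi> x) - (LINT x|lebesgue_on \<Omega>. \<phi> x * partial_deriv i \<psi> x)"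
        unfolding left_diff_distrib
        by (intro Bochner_Integration.integral_diff L2_mult_integrable u \<phi>_L2 \<psi>_L2)
      also have "\<dots> = - (LINT x|lebesgue_on \<Omega>. G x $ i * \<psi> x) + (LINT x|lebesgue_on \<Omega>. partial_deriv i \<phi> x * \<psi> x)"
        using G \<psi> test_fun_by_parts_on[OF assms(1) \<phi> \<psi>, of i] by (simp add: is_weak_grad_def)
      also have "\<dots> = - (LINT x|lebesgue_on \<Omega>. (G x $ i - partial_deriv i \<phi> x) * \<psi> x)"
        unfolding left_diff_distrib
        by (subst Bochner_Integration.integral_diff) (simp_all add: L2_mult_integrable G_L2 d\<phi> \<psi>_L2)
      finally show ?thesis .
    qed
    have "is_weak_grad \<Omega> (\<lambda>x. u x - \<phi> x) (\<lambda>x. \<chi> i. G x $ i - partial_deriv i \<phi> x)"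
      unfolding is_weak_grad_def using split by (simp add: L2_diff G_L2 d\<phi>)
    then have D: "is_weak_grad \<Omega> (\<lambda>x. u x - \<phi> x) D"
      unfolding D_def by (rule is_weak_grad_weak_grad)
    then have D_L2: "(\<lambda>x. D x $ i) \<in> L2 \<Omega>" for i by (simp add: is_weak_grad_def)
    have "(LINT x|lebesgue_on \<Omega>. (norm (D x))\<^sup>2 + (cmod (u x - \<phi> x))\<^sup>2) < \<epsilon>"
      using lt by (simp add: H1_norm_def D_def)
    also have "(LINT x|lebesgue_on \<Omega>. (norm (D x))\<^sup>2 + (cmod (u x - \<phi> x))\<^sup>2)
       = (\<Sum>i\<in>UNIV. sqn \<Omega> (\<lambda>x. D x $ i)) + sqn \<Omega> (\<lambda>x. u x - \<phi> x)"
      unfolding norm_sq_complex_vec sqn_def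
      using L2_integrable[OF D_L2] L2_integrable[OF L2_diff[OF u \<phi>_L2]]
      by (subst Bochner_Integration.integral_add) auto
    finally have small: "(\<Sum>i\<in>UNIV. sqn \<Omega> (\<lambda>x. D x $ i)) + sqn \<Omega> (\<lambda>x. u x - \<phi> x) < \<epsilon>" .
    have "(LINT x|lebesgue_on \<Omega>. (G x $ i - D x $ i - partial_deriv i \<phi> x) * \<psi> x) = 0"
      if \<psi>: "\<psi> \<in> test_fun \<Omega>" for \<psi> i
    proof -
      have \<psi>_L2: "\<psi> \<in> L2 \<Omega>" using test_fun_L2[OF assms(1) \<psi>] .
      have "(LINT x|lebesgue_on \<Omega>. (G x $ i - D x $ i - partial_deriv i \<phi> x) * \<psi> x)
         = (LINT x|lebesgue_on \<Omega>. (G x $ i - partial_deriv i \<phi> x) * \<psi> x - D x $ i * \<psi> x)"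
        by (rule Bochner_Integration.integral_cong) (auto simp: algebra_simps)
      also have "\<dots> = (LINT x|lebesgue_on \<Omega>. (G x $ i - partial_deriv i \<phi> x) * \<psi> x) - (LINT x|lebesgue_on \<Omega>. D x $ i * \<psi> x)"
        by (intro Bochner_Integration.integral_diff L2_mult_integrable L2_diff G_L2 d\<phi> D_L2 \<psi>_L2)
      also have "\<dots> = 0"
        using split[OF \<psi>, of i] D \<psi> by (simp add: is_weak_grad_def)
      finally show ?thesis .
    qed
    then show ?thesis using \<phi> D_L2 small by blast
  qed
  then show ?thesis
    unfolding h10_pair_def G_def[symmetric] using u G_L2 by blast
qed

lemma h10_pair_cmult:
  assumes "open \<Omega>" "h10_pair \<Omega> u G"
  shows "h10_pair \<Omega> (\<lambda>x. c * u x) (\<lambda>x. \<chi> i. c * G x $ i)"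
  unfolding h10_pair_def
proof (intro conjI allI impI)
  show "(\<lambda>x. c * u x) \<in> L2 \<Omega>" "(\<lambda>x. (\<chi> i. c * G x $ i) $ i) \<in> L2 \<Omega>" for i
    using assms by (auto simp: h10_pair_def intro: L2_cmult)
  fix \<epsilon> :: real assume "\<epsilon> > 0"
  \<comment> \<open>The \<open>+ 1\<close> covers the case \<open>c = 0\<close>.\<close>
  define \<delta> where "\<delta> = \<epsilon> / ((cmod c)\<^sup>2 + 1)"
  have "\<delta> > 0" using \<open>\<epsilon> > 0\<close> by (simp add: \<delta>_def add_nonneg_pos)
  then obtain \<phi> D where \<phi>: "\<phi> \<in> test_fun \<Omega>" and D: "\<forall>i. (\<lambda>x. D x $ i) \<in> L2 \<Omega>"
    and lt: "(\<Sum>i\<in>UNIV. sqn \<Omega> (\<lambda>x. D x $ i)) + sqn \<Omega> (\<lambda>x. u x - \<phi> x) < \<delta>"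
    and orth: "\<forall>\<psi>\<in>test_fun \<Omega>. \<forall>i. (LINT x|lebesgue_on \<Omega>. (G x $ i - D x $ i - partial_deriv i \<phi> x) * \<psi> x) = 0"
    using assms(2) unfolding h10_pair_def by blast
  have "(cmod c)\<^sup>2 * ((\<Sum>i\<in>UNIV. sqn \<Omega> (\<lambda>x. D x $ i)) + sqn \<Omega> (\<lambda>x. u x - \<phi> x)) \<le> (cmod c)\<^sup>2 * \<delta>"
    using lt by (intro mult_left_mono) auto
  also have "\<dots> < ((cmod c)\<^sup>2 + 1) * \<delta>" using \<open>\<delta> > 0\<close> by simp
  also have "\<dots> = \<epsilon>" using zero_le_power2[of "cmod c"] by (simp add: \<delta>_def field_simps add_nonneg_eq_0_iff)
  finally have "(\<Sum>i\<in>UNIV. sqn \<Omega> (\<lambda>x. (\<chi> i. c * D x $ i) $ i)) + sqn \<Omega> (\<lambda>x. c * u x - c * \<phi> x) < \<epsilon>"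
    by (simp add: sqn_cmult sum_distrib_left distrib_left flip: right_diff_distrib)
  moreover have "(LINT x|lebesgue_on \<Omega>. ((\<chi> i. c * G x $ i) $ i - (\<chi> i. c * D x $ i) $ i - partial_deriv i (\<lambda>x. c * \<phi> x) x) * \<psi> x) = 0"
    if "\<psi> \<in> test_fun \<Omega>" for \<psi> i
  proof -
    have "(LINT x|lebesgue_on \<Omega>. ((\<chi> i. c * G x $ i) $ i - (\<chi> i. c * D x $ i) $ i - partial_deriv i (\<lambda>x. c * \<phi> x) x) * \<psi> x)
      = (LINT x|lebesgue_on \<Omega>. c * ((G x $ i - D x $ i - partial_deriv i \<phi> x) * \<psi> x))"
      by (rule Bochner_Integration.integral_cong) (auto simp: partial_deriv_cmult[OF \<phi>] algebra_simps)
    then show ?thesis using orth that by simp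
  qed
  ultimately show "\<exists>\<phi>\<in>test_fun \<Omega>. \<exists>D. (\<forall>i. (\<lambda>x. D x $ i) \<in> L2 \<Omega>) \<and>
      (\<Sum>i\<in>UNIV. sqn \<Omega> (\<lambda>x. D x $ i)) + sqn \<Omega> (\<lambda>x. c * u x - \<phi> x) < \<epsilon> \<and>
      (\<forall>\<psi>\<in>test_fun \<Omega>. \<forall>i. (LINT x|lebesgue_on \<Omega>. ((\<chi> i. c * G x $ i) $ i - D x $ i - partial_deriv i \<phi> x) * \<psi> x) = 0)"
    using test_fun_cmult[OF \<phi>, of c] D
    by (intro bexI[of _ "\<lambda>x. c * \<phi> x"] exI[of _ "\<lambda>x. \<chi> i. c * D x $ i"]) (auto intro: L2_cmult)
qed

lemma h10_pair_zero:
  assumes "open \<Omega>"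
  shows "h10_pair \<Omega> (\<lambda>x. 0) (\<lambda>x. \<chi> i. 0)"
  unfolding h10_pair_def
proof (intro conjI allI impI)
  fix \<epsilon> :: real assume "\<epsilon> > 0"
  have "(\<lambda>x. 0) \<in> test_fun \<Omega>"
    by (rule test_funI[of _ "{}"]) (auto intro: C_k_zero)
  then show "\<exists>\<phi>\<in>test_fun \<Omega>. \<exists>D. (\<forall>i. (\<lambda>x. D x $ i) \<in> L2 \<Omega>) \<and>
      (\<Sum>i\<in>UNIV. sqn \<Omega> (\<lambda>x. D x $ i)) + sqn \<Omega> (\<lambda>x. 0 - \<phi> x) < \<epsilon> \<and>
      (\<forall>\<psi>\<in>test_fun \<Omega>. \<forall>i. (LINT x|lebesgue_on \<Omega>. ((\<chi> i. 0) $ i - D x $ i - partial_deriv i \<phi> x) * \<psi> x) = 0)"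
    using \<open>\<epsilon> > 0\<close>
    by (intro bexI[of _ "\<lambda>x. 0"] exI[of _ "\<lambda>x. \<chi> i. 0"]) (auto simp: L2_zero sqn_def partial_deriv_def)
qed (auto simp: L2_zero)

lemma h10_pair_add:
  assumes "open \<Omega>" "h10_pair \<Omega> u G" "h10_pair \<Omega> v H"
  shows "h10_pair \<Omega> (\<lambda>x. u x + v x) (\<lambda>x. \<chi> i. G x $ i + H x $ i)"
  unfolding h10_pair_def
proof (intro conjI allI impI)
  have u: "u \<in> L2 \<Omega>" "\<And>i. (\<lambda>x. G x $ i) \<in> L2 \<Omega>" and v: "v \<in> L2 \<Omega>" "\<And>i. (\<lambda>x. H x $ i) \<in> L2 \<Omega>"
    using assms by (auto simp: h10_pair_def)
  show "(\<lambda>x. u x + v x) \<in> L2 \<Omega>" "(\<lambda>x. (\<chi> i. G x $ i + H x $ i) $ i) \<in> L2 \<Omega>" for i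
    using u v by (auto intro: L2_add)
  fix \<epsilon> :: real assume "\<epsilon> > 0"
  \<comment> \<open>A quarter each, because squared norms of sums are bounded with a factor
    2.\<close>
  then have "\<epsilon> / 4 > 0" by simp
  then obtain \<phi> D where \<phi>: "\<phi> \<in> test_fun \<Omega>" and D: "\<forall>i. (\<lambda>x. D x $ i) \<in> L2 \<Omega>"
    and lt: "(\<Sum>i\<in>UNIV. sqn \<Omega> (\<lambda>x. D x $ i)) + sqn \<Omega> (\<lambda>x. u x - \<phi> x) < \<epsilon> / 4"
    and orth: "\<forall>\<psi>\<in>test_fun \<Omega>. \<forall>i. (LINT x|lebesgue_on \<Omega>. (G x $ i - D x $ i - partial_deriv i \<phi> x) * \<psi> x) = 0"
    using assms(2) unfolding h10_pair_def by blast
  from \<open>\<epsilon> / 4 > 0\<close> obtain \<phi>' D' where \<phi>': "\<phi>' \<in> test_fun \<Omega>" and D': "\<forall>i. (\<lambda>x. D' x $ i) \<in> L2 \<Omega>"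
    and lt': "(\<Sum>i\<in>UNIV. sqn \<Omega> (\<lambda>x. D' x $ i)) + sqn \<Omega> (\<lambda>x. v x - \<phi>' x) < \<epsilon> / 4"
    and orth': "\<forall>\<psi>\<in>test_fun \<Omega>. \<forall>i. (LINT x|lebesgue_on \<Omega>. (H x $ i - D' x $ i - partial_deriv i \<phi>' x) * \<psi> x) = 0"
    using assms(3) unfolding h10_pair_def by blast
  note L2s = test_fun_L2[OF assms(1) \<phi>] test_fun_L2[OF assms(1) \<phi>']
    test_fun_L2[OF assms(1) test_fun_partial_deriv[OF \<phi>]] test_fun_L2[OF assms(1) test_fun_partial_deriv[OF \<phi>']]
  have "(\<Sum>i\<in>UNIV. sqn \<Omega> (\<lambda>x. (\<chi> i. D x $ i + D' x $ i) $ i)) \<le> (\<Sum>i\<in>UNIV. 2 * sqn \<Omega> (\<lambda>x. D x $ i) + 2 * sqn \<Omega> (\<lambda>x. D' x $ i))"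
    using sqn_add_le[of "\<lambda>x. D x $ i" \<Omega> "\<lambda>x. D' x $ i" 1 for i] D D' by (intro sum_mono) simp
  moreover have "sqn \<Omega> (\<lambda>x. u x + v x - (\<phi> x + \<phi>' x)) \<le> 2 * sqn \<Omega> (\<lambda>x. u x - \<phi> x) + 2 * sqn \<Omega> (\<lambda>x. v x - \<phi>' x)"
  proof -
    have "(\<lambda>x. u x + v x - (\<phi> x + \<phi>' x)) = (\<lambda>x. (u x - \<phi> x) + (v x - \<phi>' x))"
      by (simp add: algebra_simps)
    then show ?thesis
      using sqn_add_le[OF L2_diff[OF u(1) L2s(1)] L2_diff[OF v(1) L2s(2)], of 1] by simp
  qed
  ultimately have small: "(\<Sum>i\<in>UNIV. sqn \<Omega> (\<lambda>x. (\<chi> i. D x $ i + D' x $ i) $ i)) + sqn \<Omega> (\<lambda>x. u x + v x - (\<phi> x + \<phi>' x)) < \<epsilon>"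
    using lt lt' unfolding sum.distrib sum_distrib_left[symmetric] by linarith
  have orth_add: "(LINT x|lebesgue_on \<Omega>. ((\<chi> i. G x $ i + H x $ i) $ i - (\<chi> i. D x $ i + D' x $ i) $ i - partial_deriv i (\<lambda>x. \<phi> x + \<phi>' x) x) * \<psi> x) = 0"
    if \<psi>: "\<psi> \<in> test_fun \<Omega>" for \<psi> i
  proof -
    have pd: "partial_deriv i (\<lambda>x. \<phi> x + \<phi>' x) x = partial_deriv i \<phi> x + partial_deriv i \<phi>' x" for x
      unfolding partial_deriv_def
      by (subst frechet_derivative_add) (auto intro: test_fun_differentiable[OF \<phi>] test_fun_differentiable[OF \<phi>'])
    have "(LINT x|lebesgue_on \<Omega>. ((\<chi> i. G x $ i + H x $ i) $ i - (\<chi> i. D x $ i + D' x $ i) $ i - partial_deriv i (\<lambda>x. \<phi> x + \<phi>' x) x) * \<psi> x)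
      = (LINT x|lebesgue_on \<Omega>. (G x $ i - D x $ i - partial_deriv i \<phi> x) * \<psi> x + (H x $ i - D' x $ i - partial_deriv i \<phi>' x) * \<psi> x)"
      unfolding pd by (rule Bochner_Integration.integral_cong) (auto simp: algebra_simps)
    also have "\<dots> = (LINT x|lebesgue_on \<Omega>. (G x $ i - D x $ i - partial_deriv i \<phi> x) * \<psi> x)
        + (LINT x|lebesgue_on \<Omega>. (H x $ i - D' x $ i - partial_deriv i \<phi>' x) * \<psi> x)"
      using D D' by (intro Bochner_Integration.integral_add L2_mult_integrable L2_diff u v L2s test_fun_L2[OF assms(1) \<psi>]) auto
    finally show ?thesis using orth orth' \<psi> by simp
  qed
  show "\<exists>\<phi>\<in>test_fun \<Omega>. \<exists>D. (\<forall>i. (\<lambda>x. D x $ i) \<in> L2 \<Omega>) \<and>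
      (\<Sum>i\<in>UNIV. sqn \<Omega> (\<lambda>x. D x $ i)) + sqn \<Omega> (\<lambda>x. u x + v x - \<phi> x) < \<epsilon> \<and>
      (\<forall>\<psi>\<in>test_fun \<Omega>. \<forall>i. (LINT x|lebesgue_on \<Omega>. ((\<chi> i. G x $ i + H x $ i) $ i - D x $ i - partial_deriv i \<phi> x) * \<psi> x) = 0)"
    by (rule bexI[OF _ test_fun_add[OF \<phi> \<phi>']], rule exI[of _ "\<lambda>x. \<chi> i. D x $ i + D' x $ i"])
       (use D D' small orth_add in \<open>auto intro: L2_add\<close>)
qed

lemma h10_pair_sum:
  assumes "open \<Omega>"
  shows "finite I \<Longrightarrow> (\<And>i. i \<in> I \<Longrightarrow> h10_pair \<Omega> (u i) (G i)) \<Longrightarrow>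
    h10_pair \<Omega> (\<lambda>x. \<Sum>i\<in>I. c i * u i x) (\<lambda>x. \<chi> j. \<Sum>i\<in>I. c i * G i x $ j)"
proof (induction I rule: finite_induct)
  case empty
  then show ?case using h10_pair_zero[OF assms] by simp
next
  case (insert a I)
  have "h10_pair \<Omega> (\<lambda>x. c a * u a x + (\<Sum>i\<in>I. c i * u i x))
      (\<lambda>x. \<chi> j. (\<chi> j. c a * G a x $ j) $ j + (\<chi> j. \<Sum>i\<in>I. c i * G i x $ j) $ j)"
    by (rule h10_pair_add[OF assms h10_pair_cmult[OF assms]]) (use insert in auto)
  then show ?case using insert by simp
qed

section \<open>Approximation by test functions and passage to the limit\<close>

definition pair_energy :: "(real^'n) set \<Rightarrow> real \<Rightarrow> (real^'n \<Rightarrow> complex) \<Rightarrow> (real^'n \<Rightarrow> complex^'n) \<Rightarrow> real"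
  where "pair_energy \<Omega> E u G = (\<Sum>j\<in>UNIV. sqn \<Omega> (\<lambda>x. G x $ j)) + E * sqn \<Omega> u"

lemma test_fun_energy:
  assumes "open \<Omega>" "\<phi> \<in> test_fun \<Omega>"
  shows "energy E \<phi> = (\<Sum>j\<in>UNIV. sqn \<Omega> (partial_deriv j \<phi>)) + E * sqn \<Omega> \<phi>"
  by (simp add: energy_def grad_sq_def test_fun_sqn[OF assms] test_fun_sqn[OF assms(1) test_fun_partial_deriv[OF assms(2)]])

text \<open>The defect \<open>G - D - \<nabla>\<phi>\<close> is orthogonal to gradients of test functions, so \<open>\<nabla>\<phi>\<close> is no longer
  than \<open>G - D\<close>. This makes uniqueness of weak gradients unnecessary.\<close>

lemma h10_pair_approximation:
  fixes u :: "'i \<Rightarrow> real^2 \<Rightarrow> complex"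
  assumes \<Omega>: "open \<Omega>" and fin: "finite I" and pair: "\<And>i. i \<in> I \<Longrightarrow> h10_pair \<Omega> (u i) (G i)"
    and E: "E > 0" and \<eta>: "\<eta> > 0"
    and sub: "\<And>c. pair_energy \<Omega> E (\<lambda>x. \<Sum>i\<in>I. c i * u i x) (\<lambda>x. \<chi> j. \<Sum>i\<in>I. c i * G i x $ j)
      \<le> (\<Sum>i\<in>I. (cmod (c i))\<^sup>2)"
  shows "\<exists>\<phi>. (\<forall>i\<in>I. \<phi> i \<in> test_fun \<Omega> \<and> sqn \<Omega> (\<lambda>x. u i x - \<phi> i x) \<le> \<eta>) \<and>
    (\<forall>c. energy E (\<lambda>x. \<Sum>i\<in>I. c i * \<phi> i x) \<le> (1 + \<eta>) * (\<Sum>i\<in>I. (cmod (c i))\<^sup>2))"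
proof -
  define t where "t = \<eta> / 2"
  have t: "t > 0" using \<eta> by (simp add: t_def)
  \<comment> \<open>One half of \<open>\<eta>\<close>, called \<open>t\<close>, goes into the factor
    \<open>1 + t\<close>; the other half absorbs the error, whence
    \<open>A * \<delta> \<le> t\<close>. In \<open>A\<close> the factor \<open>1 + 1 / t\<close>
    comes from the weighted splitting, the number of functions from \<open>sqn_sum_le\<close>, and
    \<open>max 1 E\<close> puts gradient and mass errors on the same footing.\<close>
  define A where "A = (1 + 1 / t) * (real (card I) + 1) * max 1 E"
  have A: "A > 0" using t by (simp add: A_def add_pos_pos)
  define \<delta> where "\<delta> = min \<eta> (t / A)"
  have \<delta>: "\<delta> > 0" using \<eta> t A by (simp add: \<delta>_def)
  have "\<forall>i\<in>I. \<exists>\<phi> D. \<phi> \<in> test_fun \<Omega> \<and> (\<forall>j. (\<lambda>x. D x $ j) \<in> L2 \<Omega>) \<and>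
      (\<Sum>j\<in>UNIV. sqn \<Omega> (\<lambda>x. D x $ j)) + sqn \<Omega> (\<lambda>x. u i x - \<phi> x) < \<delta> \<and>
      (\<forall>\<psi>\<in>test_fun \<Omega>. \<forall>j. (LINT x|lebesgue_on \<Omega>. (G i x $ j - D x $ j - partial_deriv j \<phi> x) * \<psi> x) = 0)"
    using pair \<delta> unfolding h10_pair_def by blast
  then obtain \<phi> D where \<phi>: "\<And>i. i \<in> I \<Longrightarrow> \<phi> i \<in> test_fun \<Omega>"
    and D: "\<And>i j. i \<in> I \<Longrightarrow> (\<lambda>x. D i x $ j) \<in> L2 \<Omega>"
    and lt: "\<And>i. i \<in> I \<Longrightarrow> (\<Sum>j\<in>UNIV. sqn \<Omega> (\<lambda>x. D i x $ j)) + sqn \<Omega> (\<lambda>x. u i x - \<phi> i x) < \<delta>"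
    and orth: "\<And>i j \<psi>. i \<in> I \<Longrightarrow> \<psi> \<in> test_fun \<Omega> \<Longrightarrow>
      (LINT x|lebesgue_on \<Omega>. (G i x $ j - D i x $ j - partial_deriv j (\<phi> i) x) * \<psi> x) = 0"
    unfolding bchoice_iff by (elim exE) blast
  have u: "u i \<in> L2 \<Omega>" and G: "(\<lambda>x. G i x $ j) \<in> L2 \<Omega>" if "i \<in> I" for i j
    using pair[OF that] by (auto simp: h10_pair_def)
  have close: "sqn \<Omega> (\<lambda>x. u i x - \<phi> i x) \<le> \<eta>" if "i \<in> I" for i
  proof -
    have "0 \<le> (\<Sum>j\<in>UNIV. sqn \<Omega> (\<lambda>x. D i x $ j))" by (intro sum_nonneg sqn_nonneg)
    then show ?thesis using lt[OF that] by (simp add: \<delta>_def)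
  qed
  have "energy E (\<lambda>x. \<Sum>i\<in>I. c i * \<phi> i x) \<le> (1 + \<eta>) * (\<Sum>i\<in>I. (cmod (c i))\<^sup>2)" for c
  proof -
    define C where "C = (\<Sum>i\<in>I. (cmod (c i))\<^sup>2)"
    have C: "0 \<le> C" by (simp add: C_def sum_nonneg)
    define \<Phi> where "\<Phi> = (\<lambda>x. \<Sum>i\<in>I. c i * \<phi> i x)"
    have \<Phi>: "\<Phi> \<in> test_fun \<Omega>" unfolding \<Phi>_def by (rule test_fun_sum[OF fin \<phi>])
    have \<Phi>_L2: "\<Phi> \<in> L2 \<Omega>" "partial_deriv j \<Phi> \<in> L2 \<Omega>" for j
      using test_fun_L2[OF \<Omega>] \<Phi> test_fun_partial_deriv by blast+
    define Gc where "Gc j x = (\<Sum>i\<in>I. c i * G i x $ j)" for j x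
    define Dc where "Dc j x = (\<Sum>i\<in>I. c i * D i x $ j)" for j x
    define uc where "uc x = (\<Sum>i\<in>I. c i * u i x)" for x
    define dc where "dc x = (\<Sum>i\<in>I. c i * (u i x - \<phi> i x))" for x
    have L2s: "Gc j \<in> L2 \<Omega>" "Dc j \<in> L2 \<Omega>" "uc \<in> L2 \<Omega>" "dc \<in> L2 \<Omega>" for j
      unfolding Gc_def[abs_def] Dc_def[abs_def] uc_def[abs_def] dc_def[abs_def]
      by (intro L2_sum fin G D u L2_diff test_fun_L2[OF \<Omega> \<phi>]; assumption)+
    have dc_eq: "\<Phi> x = uc x + (-1) * dc x" for x
      by (simp add: \<Phi>_def uc_def dc_def right_diff_distrib sum_subtractf)
    have grad_le: "sqn \<Omega> (partial_deriv j \<Phi>) \<le> (1 + t) * sqn \<Omega> (Gc j) + (1 + 1 / t) * sqn \<Omega> (Dc j)" for j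
    proof -
      have pd: "partial_deriv j \<Phi> x = (\<Sum>i\<in>I. c i * partial_deriv j (\<phi> i) x)" for x
        unfolding \<Phi>_def by (rule partial_deriv_sum[OF fin \<phi>])
      define \<kappa> where "\<kappa> x = Gc j x - Dc j x - partial_deriv j \<Phi> x" for x
      have \<kappa>: "\<kappa> \<in> L2 \<Omega>"
        unfolding \<kappa>_def[abs_def] by (intro L2_diff L2s \<Phi>_L2)
      have "(LINT x|lebesgue_on \<Omega>. \<kappa> x * cnj (partial_deriv j \<Phi> x)) = 0"
      proof -
        define \<psi> where "\<psi> x = cnj (partial_deriv j \<Phi> x)" for x
        have \<psi>: "\<psi> \<in> test_fun \<Omega>"
          unfolding \<psi>_def[abs_def] by (rule test_fun_cnj[OF test_fun_partial_deriv[OF \<Phi>]])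
        have "(LINT x|lebesgue_on \<Omega>. \<kappa> x * \<psi> x)
          = (LINT x|lebesgue_on \<Omega>. (\<Sum>i\<in>I. c i * ((G i x $ j - D i x $ j - partial_deriv j (\<phi> i) x) * \<psi> x)))"
          unfolding \<kappa>_def Gc_def Dc_def pd sum_subtractf[symmetric] sum_distrib_right
          by (intro Bochner_Integration.integral_cong sum.cong refl) (simp add: algebra_simps)
        also have "\<dots> = (\<Sum>i\<in>I. LINT x|lebesgue_on \<Omega>. c i * ((G i x $ j - D i x $ j - partial_deriv j (\<phi> i) x) * \<psi> x))"
          by (intro Bochner_Integration.integral_sum integrable_mult_right L2_mult_integrable L2_diff G D
              test_fun_L2[OF \<Omega> \<psi>] test_fun_L2[OF \<Omega> test_fun_partial_deriv[OF \<phi>]]; assumption)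
        also have "\<dots> = 0"
          by (intro sum.neutral ballI) (simp add: orth[OF _ \<psi>])
        finally show ?thesis by (simp add: \<psi>_def)
      qed
      then have "sqn \<Omega> (partial_deriv j \<Phi>) \<le> sqn \<Omega> (\<lambda>x. partial_deriv j \<Phi> x + \<kappa> x)"
        by (rule sqn_le_orthogonal[OF \<Phi>_L2(2) \<kappa>])
      also have "(\<lambda>x. partial_deriv j \<Phi> x + \<kappa> x) = (\<lambda>x. Gc j x + (-1) * Dc j x)"
        by (simp add: \<kappa>_def)
      also have "sqn \<Omega> \<dots> \<le> (1 + t) * sqn \<Omega> (Gc j) + (1 + 1 / t) * sqn \<Omega> (\<lambda>x. (-1) * Dc j x)"
        by (rule sqn_add_le[OF L2s(1) L2_cmult[OF L2s(2)] t])
      finally show ?thesis unfolding sqn_cmult by simp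
    qed
    have mass_le: "sqn \<Omega> \<Phi> \<le> (1 + t) * sqn \<Omega> uc + (1 + 1 / t) * sqn \<Omega> dc"
    proof -
      have "sqn \<Omega> (\<lambda>x. uc x + (-1) * dc x) \<le> (1 + t) * sqn \<Omega> uc + (1 + 1 / t) * sqn \<Omega> (\<lambda>x. (-1) * dc x)"
        by (rule sqn_add_le[OF L2s(3) L2_cmult[OF L2s(4)] t])
      moreover have "\<Phi> = (\<lambda>x. uc x + (-1) * dc x)" using dc_eq by blast
      ultimately show ?thesis unfolding sqn_cmult by simp
    qed
    have "energy E \<Phi> = (\<Sum>j\<in>UNIV. sqn \<Omega> (partial_deriv j \<Phi>)) + E * sqn \<Omega> \<Phi>"
      by (rule test_fun_energy[OF \<Omega> \<Phi>])
    also have "\<dots> \<le> (\<Sum>j\<in>UNIV. (1 + t) * sqn \<Omega> (Gc j) + (1 + 1 / t) * sqn \<Omega> (Dc j))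
        + E * ((1 + t) * sqn \<Omega> uc + (1 + 1 / t) * sqn \<Omega> dc)"
      using E by (intro add_mono sum_mono grad_le mult_left_mono mass_le) auto
    also have "\<dots> = (1 + t) * ((\<Sum>j\<in>UNIV. sqn \<Omega> (Gc j)) + E * sqn \<Omega> uc)
        + (1 + 1 / t) * ((\<Sum>j\<in>UNIV. sqn \<Omega> (Dc j)) + E * sqn \<Omega> dc)"
      by (simp add: sum.distrib sum_distrib_left distrib_left mult_ac)
    also have "\<dots> \<le> (1 + t) * C + (1 + 1 / t) * (max 1 E * (C * (real (card I) * \<delta>)))"
    proof (intro add_mono mult_left_mono)
      show "(\<Sum>j\<in>UNIV. sqn \<Omega> (Gc j)) + E * sqn \<Omega> uc \<le> C"
        using sub[of c] by (simp add: pair_energy_def C_def Gc_def[abs_def] uc_def[abs_def])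
      have "(\<Sum>j\<in>UNIV. sqn \<Omega> (Dc j)) + E * sqn \<Omega> dc
          \<le> (\<Sum>j\<in>UNIV. max 1 E * sqn \<Omega> (Dc j)) + max 1 E * sqn \<Omega> dc"
        using mult_right_mono[OF max.cobounded1[of 1 E] sqn_nonneg[of \<Omega> "Dc j" for j]]
        by (intro add_mono sum_mono mult_right_mono sqn_nonneg) auto
      also have "\<dots> = max 1 E * ((\<Sum>j\<in>UNIV. sqn \<Omega> (Dc j)) + sqn \<Omega> dc)"
        by (simp add: sum_distrib_left distrib_left)
      also have "\<dots> \<le> max 1 E * ((\<Sum>j\<in>UNIV. C * (\<Sum>i\<in>I. sqn \<Omega> (\<lambda>x. D i x $ j))) + C * (\<Sum>i\<in>I. sqn \<Omega> (\<lambda>x. u i x - \<phi> i x)))"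
        unfolding C_def Dc_def[abs_def] dc_def[abs_def]
        by (intro mult_left_mono add_mono sum_mono sqn_sum_le fin D L2_diff u test_fun_L2[OF \<Omega> \<phi>]) auto
      also have "\<dots> = max 1 E * (C * (\<Sum>i\<in>I. (\<Sum>j\<in>UNIV. sqn \<Omega> (\<lambda>x. D i x $ j)) + sqn \<Omega> (\<lambda>x. u i x - \<phi> i x)))"
        by (simp add: sum.distrib sum_distrib_left[symmetric] distrib_left[symmetric] sum.swap[of _ UNIV I])
      also have "\<dots> \<le> max 1 E * (C * (\<Sum>i\<in>I. \<delta>))"
        using C by (intro mult_left_mono sum_mono lt[THEN less_imp_le]) auto
      finally show "(\<Sum>j\<in>UNIV. sqn \<Omega> (Dc j)) + E * sqn \<Omega> dc \<le> max 1 E * (C * (real (card I) * \<delta>))" by simp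
    qed (use t in auto)
    also have "\<dots> \<le> (1 + t) * C + t * C"
    proof -
      have "(1 + 1 / t) * (max 1 E * (C * (real (card I) * \<delta>))) \<le> (1 + 1 / t) * (max 1 E * (C * ((real (card I) + 1) * \<delta>)))"
        using C \<delta> t by (intro mult_left_mono mult_right_mono) auto
      also have "\<dots> = (A * \<delta>) * C" by (simp add: A_def mult_ac)
      also have "\<dots> \<le> t * C"
      proof (rule mult_right_mono[OF _ C])
        have "A * \<delta> \<le> A * (t / A)" using A by (intro mult_left_mono) (auto simp: \<delta>_def)
        then show "A * \<delta> \<le> t" using A by simp
      qed
      finally show ?thesis by simp
    qed
    also have "\<dots> = (1 + \<eta>) * C" by (simp add: t_def distrib_right)
    finally show ?thesis by (simp add: \<Phi>_def C_def)
  qed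
  then show ?thesis using \<phi> close by blast
qed

lemma nn_integral_lebesgue_on_le_lborel:
  assumes "open \<Omega>"
  shows "(\<integral>\<^sup>+x. f x \<partial>lebesgue_on \<Omega>) \<le> (\<integral>\<^sup>+x. f x \<partial>lborel)"
proof -
  have "(\<integral>\<^sup>+x. f x \<partial>lebesgue_on \<Omega>) = (\<integral>\<^sup>+x. f x * indicator \<Omega> x \<partial>lebesgue)"
    using open_sets_lebesgue[OF assms] by (intro nn_integral_restrict_space) simp
  also have "\<dots> \<le> (\<integral>\<^sup>+x. f x \<partial>lebesgue)"
    by (intro nn_integral_mono) (auto simp: indicator_def)
  finally show ?thesis by (simp add: nn_integral_completion)
qed

text \<open>Fatou's lemma carries the bound over from test functions: the integrand depends
  continuously on the density and is nonnegative, so convergence almost everywhere of the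
  approximating densities is enough.\<close>

theorem h10_pair_trudinger:
  fixes u :: "'i \<Rightarrow> real^2 \<Rightarrow> complex"
  assumes \<Omega>: "open \<Omega>" and fin: "finite I" and pair: "\<And>i. i \<in> I \<Longrightarrow> h10_pair \<Omega> (u i) (G i)"
    and E: "E > 0"
    and sub: "\<And>c. pair_energy \<Omega> E (\<lambda>x. \<Sum>i\<in>I. c i * u i x) (\<lambda>x. \<chi> j. \<Sum>i\<in>I. c i * G i x $ j)
      \<le> (\<Sum>i\<in>I. (cmod (c i))\<^sup>2)"
  defines "\<rho> \<equiv> \<lambda>x. \<Sum>i\<in>I. (cmod (u i x))\<^sup>2"
  shows "(\<integral>\<^sup>+x. ennreal (E * \<rho> x * exp (\<rho> x / 64)) \<partial>lebesgue_on \<Omega>) \<le> ennreal (4 * real (card I))"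
proof -
  define \<eta> where "\<eta> k = 1 / real (Suc k)" for k
  have \<eta>: "\<eta> k > 0" for k by (simp add: \<eta>_def)
  have \<eta>_lim: "\<eta> \<longlonglongrightarrow> 0"
    unfolding \<eta>_def[abs_def] by (rule LIMSEQ_Suc[OF lim_1_over_n])
  have "\<forall>k. \<exists>\<phi>. (\<forall>i\<in>I. \<phi> i \<in> test_fun \<Omega> \<and> sqn \<Omega> (\<lambda>x. u i x - \<phi> i x) \<le> \<eta> k) \<and>
    (\<forall>c. energy E (\<lambda>x. \<Sum>i\<in>I. c i * \<phi> i x) \<le> (1 + \<eta> k) * (\<Sum>i\<in>I. (cmod (c i))\<^sup>2))"
    using h10_pair_approximation[OF \<Omega> fin pair E \<eta> sub] by blast
  then obtain \<Phi> where \<Phi>: "\<And>k i. i \<in> I \<Longrightarrow> \<Phi> k i \<in> test_fun \<Omega>"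
    and close: "\<And>k i. i \<in> I \<Longrightarrow> sqn \<Omega> (\<lambda>x. u i x - \<Phi> k i x) \<le> \<eta> k"
    and energy: "\<And>k c. energy E (\<lambda>x. \<Sum>i\<in>I. c i * \<Phi> k i x) \<le> (1 + \<eta> k) * (\<Sum>i\<in>I. (cmod (c i))\<^sup>2)"
    unfolding choice_iff by (elim exE) blast
  have u: "u i \<in> L2 \<Omega>" if "i \<in> I" for i
    using pair[OF that] by (simp add: h10_pair_def)
  \<comment> \<open>Dividing by \<open>sqrt (1 + \<eta> k)\<close> makes the approximating family
    satisfy the hypothesis of \<open>collective_trudinger\<close> exactly; the factor tends to
    one.\<close>
  define s where "s k = complex_of_real (1 / sqrt (1 + \<eta> k))" for k
  have s2: "(cmod (s k))\<^sup>2 = 1 / (1 + \<eta> k)" for k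
    unfolding s_def norm_of_real power2_abs using \<eta>[of k] by (simp add: power_divide)
  define \<rho>k where "\<rho>k k x = (\<Sum>i\<in>I. (cmod (s k * \<Phi> k i x))\<^sup>2)" for k x
  have bound: "(\<integral>\<^sup>+x. ennreal (E * \<rho>k k x * exp (\<rho>k k x / 64)) \<partial>lebesgue_on \<Omega>) \<le> ennreal (4 * real (card I))" for k
  proof (rule order_trans[OF nn_integral_lebesgue_on_le_lborel[OF \<Omega>]])
    show "(\<integral>\<^sup>+x. ennreal (E * \<rho>k k x * exp (\<rho>k k x / 64)) \<partial>lborel) \<le> ennreal (4 * real (card I))"
      unfolding \<rho>k_def
    proof (rule collective_trudinger[OF fin _ E])
      show "(\<lambda>x. s k * \<Phi> k i x) \<in> test_fun UNIV" if "i \<in> I" for i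
        by (rule test_fun_cmult[OF test_fun_mono[OF subset_UNIV \<Phi>[OF that]]])
      fix c
      have "energy E (\<lambda>x. \<Sum>i\<in>I. c i * (s k * \<Phi> k i x)) = energy E (\<lambda>x. \<Sum>i\<in>I. (c i * s k) * \<Phi> k i x)"
        by (simp add: mult.assoc)
      also have "\<dots> \<le> (1 + \<eta> k) * (\<Sum>i\<in>I. (cmod (c i * s k))\<^sup>2)" by (rule energy)
      also have "\<dots> = (\<Sum>i\<in>I. (cmod (c i))\<^sup>2)"
        using \<eta>[of k] by (simp add: norm_mult power_mult_distrib s2 sum_divide_distrib[symmetric])
      finally show "energy E (\<lambda>x. \<Sum>i\<in>I. c i * (s k * \<Phi> k i x)) \<le> (\<Sum>i\<in>I. (cmod (c i))\<^sup>2)" .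
    qed
  qed
  define g where "g k x = (\<Sum>i\<in>I. (cmod (u i x - \<Phi> k i x))\<^sup>2)" for k x
  have g_int: "integrable (lebesgue_on \<Omega>) (g k)" for k
    unfolding g_def[abs_def]
    by (intro Bochner_Integration.integrable_sum L2_integrable L2_diff u test_fun_L2[OF \<Omega> \<Phi>])
  have g_nonneg: "0 \<le> g k x" for k x by (simp add: g_def sum_nonneg)
  have g_le: "(LINT x|lebesgue_on \<Omega>. norm (g k x)) \<le> real (card I) * \<eta> k" for k
  proof -
    have "(LINT x|lebesgue_on \<Omega>. norm (g k x)) = (LINT x|lebesgue_on \<Omega>. g k x)"
      by (simp add: g_nonneg)
    also have "\<dots> = (\<Sum>i\<in>I. sqn \<Omega> (\<lambda>x. u i x - \<Phi> k i x))"
      unfolding g_def sqn_def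
      by (intro Bochner_Integration.integral_sum L2_integrable L2_diff u test_fun_L2[OF \<Omega> \<Phi>])
    also have "\<dots> \<le> (\<Sum>i\<in>I. \<eta> k)" by (intro sum_mono close)
    finally show ?thesis by simp
  qed
  have "(\<lambda>k. LINT x|lebesgue_on \<Omega>. norm (g k x)) \<longlonglongrightarrow> 0"
  proof (rule tendsto_sandwich[of "\<lambda>_. 0"])
    show "(\<lambda>k. real (card I) * \<eta> k) \<longlonglongrightarrow> 0" using tendsto_mult_left[OF \<eta>_lim] by simp
    show "\<forall>\<^sub>F k in sequentially. (LINT x|lebesgue_on \<Omega>. norm (g k x)) \<le> real (card I) * \<eta> k"
      by (intro always_eventually allI g_le)
  qed (auto intro: Bochner_Integration.integral_nonneg)
  \<comment> \<open>Convergence in mean yields convergence almost everywhere only along a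
    subsequence.\<close>
  then obtain r :: "nat \<Rightarrow> nat" where r: "strict_mono r" and AE0: "AE x in lebesgue_on \<Omega>. (\<lambda>k. g (r k) x) \<longlonglongrightarrow> 0"
    using tendsto_L1_AE_subseq[of "lebesgue_on \<Omega>" g] g_int by blast
  have s_lim: "(\<lambda>k. s (r k)) \<longlonglongrightarrow> 1"
  proof -
    have "(\<lambda>k. \<eta> (r k)) \<longlonglongrightarrow> 0"
      using LIMSEQ_subseq_LIMSEQ[OF \<eta>_lim r] by (simp add: o_def)
    then have "(\<lambda>k. complex_of_real (1 / sqrt (1 + \<eta> (r k)))) \<longlonglongrightarrow> complex_of_real (1 / sqrt (1 + 0))"
      by (intro tendsto_intros) auto
    then show ?thesis by (simp add: s_def)
  qed
  define F where "F t = ennreal (E * t * exp (t / 64))" for t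
  have AE_lim: "AE x in lebesgue_on \<Omega>. (\<lambda>k. F (\<rho>k (r k) x)) \<longlonglongrightarrow> F (\<rho> x)"
    using AE0
  proof eventually_elim
    fix x assume g0: "(\<lambda>k. g (r k) x) \<longlonglongrightarrow> 0"
    have "(\<lambda>k. \<Phi> (r k) i x) \<longlonglongrightarrow> u i x" if "i \<in> I" for i
    proof -
      have "(\<lambda>k. sqrt (g (r k) x)) \<longlonglongrightarrow> sqrt 0" by (intro tendsto_intros g0)
      moreover have "cmod (u i x - \<Phi> (r k) i x) \<le> sqrt (g (r k) x)" for k
      proof (rule real_le_rsqrt)
        show "(cmod (u i x - \<Phi> (r k) i x))\<^sup>2 \<le> g (r k) x"
          unfolding g_def using fin that by (intro member_le_sum) auto
      qed
      ultimately have "(\<lambda>k. u i x - \<Phi> (r k) i x) \<longlonglongrightarrow> 0"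
        by (intro Lim_null_comparison[of "\<lambda>k. u i x - \<Phi> (r k) i x" "\<lambda>k. sqrt (g (r k) x)"]) auto
      then have "(\<lambda>k. u i x - (u i x - \<Phi> (r k) i x)) \<longlonglongrightarrow> u i x - 0" by (intro tendsto_intros)
      then show ?thesis by simp
    qed
    then have "(\<lambda>k. \<rho>k (r k) x) \<longlonglongrightarrow> (\<Sum>i\<in>I. (cmod (1 * u i x))\<^sup>2)"
      unfolding \<rho>k_def by (intro tendsto_intros s_lim)
    then show "(\<lambda>k. F (\<rho>k (r k) x)) \<longlonglongrightarrow> F (\<rho> x)"
      unfolding F_def \<rho>_def by (intro tendsto_ennrealI tendsto_intros) auto
  qed
  have "(\<integral>\<^sup>+x. F (\<rho> x) \<partial>lebesgue_on \<Omega>) = (\<integral>\<^sup>+x. liminf (\<lambda>k. F (\<rho>k (r k) x)) \<partial>lebesgue_on \<Omega>)"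
  proof (rule nn_integral_cong_AE)
    show "AE x in lebesgue_on \<Omega>. F (\<rho> x) = liminf (\<lambda>k. F (\<rho>k (r k) x))"
      using AE_lim by eventually_elim (simp add: lim_imp_Liminf)
  qed
  also have "\<dots> \<le> liminf (\<lambda>k. \<integral>\<^sup>+x. F (\<rho>k (r k) x) \<partial>lebesgue_on \<Omega>)"
  proof (rule nn_integral_liminf)
    fix k
    have [measurable]: "\<Phi> (r k) i \<in> borel_measurable (lebesgue_on \<Omega>)" if "i \<in> I" for i
      using L2_measurable[OF test_fun_L2[OF \<Omega> \<Phi>[OF that]]] .
    show "(\<lambda>x. F (\<rho>k (r k) x)) \<in> borel_measurable (lebesgue_on \<Omega>)"
      unfolding F_def \<rho>k_def by measurable
  qed
  also have "\<dots> \<le> limsup (\<lambda>k. \<integral>\<^sup>+x. F (\<rho>k (r k) x) \<partial>lebesgue_on \<Omega>)"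
    by (rule Liminf_le_Limsup) simp
  also have "\<dots> \<le> ennreal (4 * real (card I))"
    using bound by (intro Limsup_bounded) (auto simp: F_def)
  finally show ?thesis by (simp add: F_def)
qed

section \<open>Negative eigenvalues\<close>

text \<open>The form lives on coefficient vectors because functions are identified only up to null
  sets. Linear independence almost everywhere is then exactly what makes the form positive on
  vectors that do not vanish on \<open>I\<close>.\<close>

lemma gram_schmidt:
  fixes B :: "('i \<Rightarrow> complex) \<Rightarrow> ('i \<Rightarrow> complex) \<Rightarrow> complex"
  assumes "finite I"
    and lin: "\<And>c d e s. B (\<lambda>i. c i + s * d i) e = B c e + s * B d e"
    and herm: "\<And>c d. B d c = cnj (B c d)"
    and pos: "\<And>c. \<exists>i\<in>I. c i \<noteq> 0 \<Longrightarrow> 0 < Re (B c c)"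
  shows "\<exists>T. \<forall>j\<in>I. \<forall>k\<in>I. B (T j) (T k) = (if j = k then 1 else 0)"
proof -
  have lin_sum: "B (\<lambda>i. c i + (\<Sum>j\<in>J. s j * d j i)) e = B c e + (\<Sum>j\<in>J. s j * B (d j) e)"
    if "finite J" for c s d e and J :: "'i set"
    using that
  proof (induction J rule: finite_induct)
    case (insert a J)
    have "(\<lambda>i. c i + (\<Sum>j\<in>insert a J. s j * d j i)) = (\<lambda>i. (c i + (\<Sum>j\<in>J. s j * d j i)) + s a * d a i)"
      using insert by (simp add: fun_eq_iff algebra_simps)
    then show ?case using insert lin[of "\<lambda>i. c i + (\<Sum>j\<in>J. s j * d j i)" "s a" "d a" e] by simp
  qed simp
  have scale: "B (\<lambda>i. s * d i) e = s * B d e" for s d e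
    using lin[of "\<lambda>i. 0" s d e] lin[of "\<lambda>i. 0" 1 "\<lambda>i. 0" e] by simp
  have scale2: "B e (\<lambda>i. s * d i) = cnj s * B e d" for s d e
  proof -
    have "B e (\<lambda>i. s * d i) = cnj (B (\<lambda>i. s * d i) e)" by (rule herm)
    also have "\<dots> = cnj s * cnj (B d e)" by (simp only: scale complex_cnj_mult)
    also have "cnj (B d e) = B e d" by (rule herm[symmetric])
    finally show ?thesis .
  qed
  \<comment> \<open>Keeping the vectors built so far supported in \<open>J\<close> gives the next
    vector the coefficient 1 at the new index \<open>p\<close>, so that \<open>pos\<close> applies
    to it.\<close>
  have "\<exists>T. (\<forall>j\<in>J. \<forall>i. i \<notin> J \<longrightarrow> T j i = 0) \<and> (\<forall>j\<in>J. \<forall>k\<in>J. B (T j) (T k) = (if j = k then 1 else 0))"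
    if "J \<subseteq> I" for J
    using finite_subset[OF that assms(1)] that
  proof (induction J rule: finite_induct)
    case (insert p J)
    then obtain T where T: "(\<forall>j\<in>J. \<forall>i. i \<notin> J \<longrightarrow> T j i = 0) \<and>
        (\<forall>j\<in>J. \<forall>k\<in>J. B (T j) (T k) = (if j = k then 1 else 0))"
      by auto
    have T0: "T j i = 0" if "j \<in> J" "i \<notin> J" for j i using T that by blast
    have T1: "B (T j) (T k) = (if j = k then 1 else 0)" if "j \<in> J" "k \<in> J" for j k
      using T that by blast
    define \<delta> where "\<delta> i = (if i = p then 1 else 0 :: complex)" for i
    define w where "w i = \<delta> i + (\<Sum>j\<in>J. - B \<delta> (T j) * T j i)" for i
    have wp: "w p = 1" using T0 insert by (simp add: w_def \<delta>_def)
    have w0: "w i = 0" if "i \<notin> insert p J" for i using T0 that by (simp add: w_def \<delta>_def)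
    have orth: "B w (T k) = 0" if "k \<in> J" for k
    proof -
      have "B w (T k) = B \<delta> (T k) + (\<Sum>j\<in>J. - B \<delta> (T j) * B (T j) (T k))"
        unfolding w_def[abs_def] by (rule lin_sum[OF insert.hyps(1)])
      also have "(\<Sum>j\<in>J. - B \<delta> (T j) * B (T j) (T k)) = (\<Sum>j\<in>J. if j = k then - B \<delta> (T k) else 0)"
        using that by (intro sum.cong) (auto simp: T1)
      finally show ?thesis using insert that by simp
    qed
    have orth': "B (T k) w = 0" if "k \<in> J" for k
      using herm[of "T k" w] orth[OF that] by simp
    define r where "r = Re (B w w)"
    have r: "r > 0" unfolding r_def
      by (rule pos) (use wp insert in \<open>auto intro: bexI[of _ p]\<close>)
    have Bww: "B w w = of_real r"
      using herm[of w w] by (simp add: r_def complex_eq_iff)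
    define v where "v i = of_real (1 / sqrt r) * w i" for i
    have vv: "B v v = 1"
      unfolding v_def[abs_def] scale scale2 Bww using r
      by (simp add: of_real_mult[symmetric] of_real_divide[symmetric] del: of_real_mult of_real_divide)
    have vT: "B v (T k) = 0" "B (T k) v = 0" if "k \<in> J" for k
      unfolding v_def[abs_def] scale scale2 using orth orth' that by auto
    show ?case
      using T0 T1 w0 vv vT insert.hyps
      by (intro exI[of _ "T(p := v)"]) (auto simp: v_def[of i for i] fun_upd_def)
  qed simp
  then show ?thesis by blast
qed

section \<open>Duality with the Orlicz norm\<close>

text \<open>A test function with a non-integrable product contributes \<open>\<infinity>\<close> to
  the supremum, so a finite norm forces integrability for every admissible \<open>f\<close>.\<close>

lemma norm_B_admissible:
  assumes "norm_B \<Omega> g < \<infinity>" "f \<in> borel_measurable (lebesgue_on \<Omega>)"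
    "(\<integral>\<^sup>+x. ennreal (young_A (f x)) \<partial>lebesgue_on \<Omega>) \<le> emeasure lebesgue \<Omega>"
  shows "integrable (lebesgue_on \<Omega>) (\<lambda>x. f x * g x)"
    and "ennreal (cmod (LINT x|lebesgue_on \<Omega>. f x * g x)) \<le> norm_B \<Omega> g"
proof -
  have le: "(if integrable (lebesgue_on \<Omega>) (\<lambda>x. f x * g x)
       then ennreal (cmod (LINT x|lebesgue_on \<Omega>. f x * g x)) else \<infinity>) \<le> norm_B \<Omega> g"
    unfolding norm_B_def by (rule SUP_upper) (use assms in simp)
  show int: "integrable (lebesgue_on \<Omega>) (\<lambda>x. f x * g x)"
    using le assms(1) by (auto split: if_splits simp: top_unique)
  show "ennreal (cmod (LINT x|lebesgue_on \<Omega>. f x * g x)) \<le> norm_B \<Omega> g"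
    using le int by simp
qed

text \<open>The inequality \<open>exp t - 1 \<le> t * exp t\<close> makes the bound linear in the
  scaling factor \<open>\<theta>\<close>, while \<open>\<theta> \<le> 1\<close> keeps the exponent
  below \<open>r / 64\<close>. A small \<open>\<theta>\<close> can thus make a multiple of the
  density admissible.\<close>

lemma young_A_le:
  assumes "0 \<le> \<theta>" "\<theta> \<le> 1" "0 \<le> r" "E > 0"
  shows "young_A (complex_of_real (\<theta> * (r / 64))) \<le> \<theta> / (64 * E) * (E * r * exp (r / 64))"
proof -
  define t where "t = \<theta> * (r / 64)"
  have t: "0 \<le> t" "t \<le> r / 64"
    using assms mult_right_mono[of \<theta> 1 "r / 64"] by (auto simp: t_def)
  have "1 - t \<le> exp (- t)" using exp_ge_add_one_self[of "- t"] by simp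
  then have "exp t * (1 - t) \<le> exp t * exp (- t)" by (intro mult_left_mono) auto
  then have "exp t - 1 \<le> t * exp t" by (simp add: exp_minus algebra_simps)
  also have "\<dots> \<le> t * exp (r / 64)" using t by (intro mult_left_mono) auto
  finally have "exp t - 1 - t \<le> t * exp (r / 64)" using t by linarith
  also have "t * exp (r / 64) = \<theta> / (64 * E) * (E * r * exp (r / 64))"
    using assms(4) by (simp add: t_def)
  finally show ?thesis
    using t(1) unfolding young_A_def t_def[symmetric] norm_of_real by simp
qed

lemma young_A_integral_le:
  assumes "0 \<le> \<theta>" "\<theta> \<le> 1" "E > 0" "\<And>x. 0 \<le> \<rho> x" "\<rho> \<in> borel_measurable M"
    "(\<integral>\<^sup>+x. ennreal (E * \<rho> x * exp (\<rho> x / 64)) \<partial>M) \<le> ennreal (4 * n)" "0 \<le> n"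
  shows "(\<integral>\<^sup>+x. ennreal (young_A (complex_of_real (\<theta> * (\<rho> x / 64)))) \<partial>M) \<le> ennreal (\<theta> * n / (16 * E))"
proof -
  note [measurable] = assms(5)
  have "(\<integral>\<^sup>+x. ennreal (young_A (complex_of_real (\<theta> * (\<rho> x / 64)))) \<partial>M)
      \<le> (\<integral>\<^sup>+x. ennreal (\<theta> / (64 * E)) * ennreal (E * \<rho> x * exp (\<rho> x / 64)) \<partial>M)"
  proof (rule nn_integral_mono)
    fix x
    have "ennreal (young_A (complex_of_real (\<theta> * (\<rho> x / 64)))) \<le> ennreal (\<theta> / (64 * E) * (E * \<rho> x * exp (\<rho> x / 64)))"
      by (rule ennreal_leI[OF young_A_le[OF assms(1,2) assms(4) assms(3)]])
    also have "\<dots> = ennreal (\<theta> / (64 * E)) * ennreal (E * \<rho> x * exp (\<rho> x / 64))"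
      using assms(1,3) assms(4)[of x] by (intro ennreal_mult) auto
    finally show "ennreal (young_A (complex_of_real (\<theta> * (\<rho> x / 64)))) \<le> ennreal (\<theta> / (64 * E)) * ennreal (E * \<rho> x * exp (\<rho> x / 64))" .
  qed
  also have "\<dots> = ennreal (\<theta> / (64 * E)) * (\<integral>\<^sup>+x. ennreal (E * \<rho> x * exp (\<rho> x / 64)) \<partial>M)"
    by (rule nn_integral_cmult) measurable
  also have "\<dots> \<le> ennreal (\<theta> / (64 * E)) * ennreal (4 * n)"
    by (intro mult_left_mono assms) simp
  also have "\<dots> = ennreal (\<theta> * n / (16 * E))"
    using assms(1,3,7) by (simp add: ennreal_mult[symmetric])
  finally show ?thesis .
qed

text \<open>The case of a single function in \<open>h10_pair_trudinger\<close>: a multiple of its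
  squared modulus is admissible for the norm of \<open>V\<close>.\<close>

lemma L_B_integrable:
  fixes \<Omega> :: "(real^2) set"
  assumes \<Omega>: "open \<Omega>" and A: "emeasure lebesgue \<Omega> = ennreal A" "A > 0"
    and V: "(\<lambda>x. complex_of_real (V x)) \<in> L_B \<Omega>" and pair: "h10_pair \<Omega> u G"
  shows "integrable (lebesgue_on \<Omega>) (\<lambda>x. V x * (cmod (u x))\<^sup>2)"
proof -
  have u: "u \<in> L2 \<Omega>" using pair by (simp add: h10_pair_def)
  note [measurable] = L2_measurable[OF u]
  define K where "K = pair_energy \<Omega> 1 u G"
  have K: "0 \<le> K" by (simp add: K_def pair_energy_def sqn_nonneg sum_nonneg)
  \<comment> \<open>Scaling to energy at most one; the \<open>+ 1\<close> keeps this meaningful when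
    \<open>K = 0\<close>.\<close>
  define c where "c = complex_of_real (1 / sqrt (K + 1))"
  have c2: "(cmod c)\<^sup>2 = 1 / (K + 1)"
    unfolding c_def norm_of_real power2_abs using K by (simp add: power_divide)
  have c2pos: "(cmod c)\<^sup>2 > 0" unfolding c2 using K by simp
  define \<rho> where "\<rho> x = (cmod c)\<^sup>2 * (cmod (u x))\<^sup>2" for x
  have "(\<integral>\<^sup>+x. ennreal (1 * (\<Sum>i\<in>{()}. (cmod (c * u x))\<^sup>2) * exp ((\<Sum>i\<in>{()}. (cmod (c * u x))\<^sup>2) / 64)) \<partial>lebesgue_on \<Omega>)
      \<le> ennreal (4 * real (card {()}))"
  proof (rule h10_pair_trudinger[OF \<Omega>])
    show "h10_pair \<Omega> (\<lambda>x. c * u x) (\<lambda>x. \<chi> j. c * G x $ j)" by (rule h10_pair_cmult[OF \<Omega> pair])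
    show "pair_energy \<Omega> 1 (\<lambda>x. \<Sum>i\<in>{()}. d i * (c * u x)) (\<lambda>x. \<chi> j. \<Sum>i\<in>{()}. d i * (\<chi> j. c * G x $ j) $ j)
      \<le> (\<Sum>i\<in>{()}. (cmod (d i))\<^sup>2)" for d
    proof -
      have "pair_energy \<Omega> 1 (\<lambda>x. \<Sum>i\<in>{()}. d i * (c * u x)) (\<lambda>x. \<chi> j. \<Sum>i\<in>{()}. d i * (\<chi> j. c * G x $ j) $ j)
        = (cmod (d ()))\<^sup>2 * ((cmod c)\<^sup>2 * K)"
        by (simp add: pair_energy_def K_def sqn_cmult sum_distrib_left distrib_left)
      also have "\<dots> \<le> (cmod (d ()))\<^sup>2 * 1"
        unfolding c2 using K by (intro mult_left_mono) auto
      finally show ?thesis by simp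
    qed
  qed auto
  then have int\<rho>: "(\<integral>\<^sup>+x. ennreal (1 * \<rho> x * exp (\<rho> x / 64)) \<partial>lebesgue_on \<Omega>) \<le> ennreal (4 * 1)"
    by (simp add: \<rho>_def norm_mult power_mult_distrib)
  \<comment> \<open>The bound by 1 is the hypothesis of \<open>young_A_integral_le\<close>; the
    bound by \<open>A\<close> brings the resulting integral, at most \<open>\<theta> / 16\<close>,
    below the measure of the domain.\<close>
  define \<theta> where "\<theta> = min 1 A"
  have \<theta>: "0 < \<theta>" "\<theta> \<le> 1" "\<theta> \<le> A" using A by (auto simp: \<theta>_def)
  have "(\<integral>\<^sup>+x. ennreal (young_A (complex_of_real (\<theta> * (\<rho> x / 64)))) \<partial>lebesgue_on \<Omega>) \<le> ennreal (\<theta> * 1 / (16 * 1))"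
    by (rule young_A_integral_le[OF _ _ _ _ _ int\<rho>]) (use \<theta> in \<open>auto simp: \<rho>_def\<close>)
  also have "\<dots> \<le> emeasure lebesgue \<Omega>"
    unfolding A using \<theta> by (intro ennreal_leI) simp
  finally have int: "integrable (lebesgue_on \<Omega>) (\<lambda>x. complex_of_real (\<theta> * (\<rho> x / 64)) * complex_of_real (V x))"
    by (intro norm_B_admissible(1)) (use V in \<open>auto simp: L_B_def \<rho>_def\<close>)
  have "integrable (lebesgue_on \<Omega>) (\<lambda>x. \<theta> * (\<rho> x / 64) * V x)"
    using integrable_Re[OF int] by (simp only: of_real_mult[symmetric] Re_complex_of_real)
  then have "integrable (lebesgue_on \<Omega>) (\<lambda>x. (64 / (\<theta> * (cmod c)\<^sup>2)) * (\<theta> * (\<rho> x / 64) * V x))"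
    by (rule integrable_mult_right)
  moreover have "(64 / (\<theta> * (cmod c)\<^sup>2)) * (\<theta> * (\<rho> x / 64) * V x) = V x * (cmod (u x))\<^sup>2" for x
    using \<theta> c2pos by (simp add: \<rho>_def field_simps)
  ultimately show ?thesis by simp
qed

lemma L_B_real_measurable:
  assumes "(\<lambda>x. complex_of_real (V x)) \<in> L_B \<Omega>"
  shows "V \<in> borel_measurable (lebesgue_on \<Omega>)"
  using assms borel_measurable_complex_iff[of "\<lambda>x. complex_of_real (V x)" "lebesgue_on \<Omega>"]
  by (simp add: L_B_def)

section \<open>Expansion of quadratic forms in coefficients\<close>

lemma weighted_norm_sum_expand:
  fixes u :: "'i \<Rightarrow> 'a \<Rightarrow> complex"
  assumes "finite I" "\<And>i k. i \<in> I \<Longrightarrow> k \<in> I \<Longrightarrow> integrable M (\<lambda>x. complex_of_real (W x) * u i x * cnj (u k x))"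
  shows "complex_of_real (LINT x|M. W x * (cmod (\<Sum>i\<in>I. c i * u i x))\<^sup>2)
    = (\<Sum>i\<in>I. \<Sum>k\<in>I. c i * cnj (c k) * (LINT x|M. complex_of_real (W x) * u i x * cnj (u k x)))"
proof -
  have eq: "complex_of_real (W x * (cmod (\<Sum>i\<in>I. c i * u i x))\<^sup>2)
    = (\<Sum>i\<in>I. \<Sum>k\<in>I. c i * cnj (c k) * (complex_of_real (W x) * u i x * cnj (u k x)))" for x
  proof -
    have "complex_of_real (W x * (cmod (\<Sum>i\<in>I. c i * u i x))\<^sup>2)
      = complex_of_real (W x) * ((\<Sum>i\<in>I. c i * u i x) * (\<Sum>k\<in>I. cnj (c k) * cnj (u k x)))"
      unfolding of_real_mult complex_norm_square by simp
    also have "\<dots> = (\<Sum>i\<in>I. \<Sum>k\<in>I. c i * cnj (c k) * (complex_of_real (W x) * u i x * cnj (u k x)))"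
      by (subst sum_product) (simp add: sum_distrib_left mult_ac)
    finally show ?thesis .
  qed
  have "complex_of_real (LINT x|M. W x * (cmod (\<Sum>i\<in>I. c i * u i x))\<^sup>2)
    = (LINT x|M. (\<Sum>i\<in>I. \<Sum>k\<in>I. c i * cnj (c k) * (complex_of_real (W x) * u i x * cnj (u k x))))"
    unfolding eq[symmetric] by (rule integral_complex_of_real[symmetric])
  also have "\<dots> = (\<Sum>i\<in>I. \<Sum>k\<in>I. LINT x|M. c i * cnj (c k) * (complex_of_real (W x) * u i x * cnj (u k x)))"
    by (subst Bochner_Integration.integral_sum,
        intro Bochner_Integration.integrable_sum integrable_mult_right assms(2); assumption?)
       (intro sum.cong refl Bochner_Integration.integral_sum integrable_mult_right assms(2))
  finally show "complex_of_real (LINT x|M. W x * (cmod (\<Sum>i\<in>I. c i * u i x))\<^sup>2)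
    = (\<Sum>i\<in>I. \<Sum>k\<in>I. c i * cnj (c k) * (LINT x|M. complex_of_real (W x) * u i x * cnj (u k x)))"
    by simp
qed

lemma sqn_sum_expand:
  fixes u :: "'i \<Rightarrow> 'a::euclidean_space \<Rightarrow> complex"
  assumes "finite I" "\<And>i. i \<in> I \<Longrightarrow> u i \<in> L2 \<Omega>"
  shows "complex_of_real (sqn \<Omega> (\<lambda>x. \<Sum>i\<in>I. c i * u i x))
    = (\<Sum>i\<in>I. \<Sum>k\<in>I. c i * cnj (c k) * (LINT x|lebesgue_on \<Omega>. u i x * cnj (u k x)))"
proof -
  have "integrable (lebesgue_on \<Omega>) (\<lambda>x. complex_of_real 1 * u i x * cnj (u k x))" if "i \<in> I" "k \<in> I" for i k
    using L2_mult_integrable[OF assms(2)[OF that(1)] L2_cnj[OF assms(2)[OF that(2)]]] by simp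
  from weighted_norm_sum_expand[OF assms(1) this, where c = c] show ?thesis by (simp add: sqn_def)
qed

definition ip :: "('a::euclidean_space) set \<Rightarrow> ('a \<Rightarrow> complex) \<Rightarrow> ('a \<Rightarrow> complex) \<Rightarrow> complex"
  where "ip \<Omega> u v = (LINT x|lebesgue_on \<Omega>. u x * cnj (v x))"

lemma ip_cnj: "ip \<Omega> v u = cnj (ip \<Omega> u v)"
  unfolding ip_def Bochner_Integration.integral_cnj[symmetric] by (simp add: mult.commute)

lemma weighted_mult_integrable:
  assumes "V \<in> borel_measurable M" "u \<in> borel_measurable M" "v \<in> borel_measurable M"
    "integrable M (\<lambda>x. V x * (cmod (u x))\<^sup>2)" "integrable M (\<lambda>x. V x * (cmod (v x))\<^sup>2)"
  shows "integrable M (\<lambda>x. complex_of_real (V x) * u x * cnj (v x))"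
proof (rule Bochner_Integration.integrable_bound)
  note [measurable] = assms(1-3)
  show "integrable M (\<lambda>x. \<bar>V x * (cmod (u x))\<^sup>2\<bar> + \<bar>V x * (cmod (v x))\<^sup>2\<bar>)"
    using assms(4,5) by (intro Bochner_Integration.integrable_add integrable_abs)
  have cnj_meas: "(\<lambda>x. cnj (v x)) \<in> borel_measurable M"
    using assms(3) by (simp add: borel_measurable_complex_iff)
  show "(\<lambda>x. complex_of_real (V x) * u x * cnj (v x)) \<in> borel_measurable M"
    by (intro borel_measurable_times cnj_meas) measurable
  have "cmod (complex_of_real (V x) * u x * cnj (v x)) \<le> \<bar>V x * (cmod (u x))\<^sup>2\<bar> + \<bar>V x * (cmod (v x))\<^sup>2\<bar>" for x
  proof -
    have "0 \<le> cmod (u x) * cmod (v x)" by simp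
    then have "cmod (u x) * cmod (v x) \<le> (cmod (u x))\<^sup>2 + (cmod (v x))\<^sup>2"
      using sum_squares_bound[of "cmod (u x)" "cmod (v x)"] by linarith
    then have "\<bar>V x\<bar> * (cmod (u x) * cmod (v x)) \<le> \<bar>V x\<bar> * ((cmod (u x))\<^sup>2 + (cmod (v x))\<^sup>2)"
      by (rule mult_left_mono) simp
    then show ?thesis by (simp add: norm_mult abs_mult distrib_left mult.assoc)
  qed
  then show "AE x in M. norm (complex_of_real (V x) * u x * cnj (v x)) \<le> norm (\<bar>V x * (cmod (u x))\<^sup>2\<bar> + \<bar>V x * (cmod (v x))\<^sup>2\<bar>)"
    by (intro AE_I2) simp
qed

section \<open>Eigenfunctions of the Schroedinger operator\<close>

locale schroedinger =
  fixes \<Omega> :: "(real^2) set" and V :: "real^2 \<Rightarrow> real" and A :: real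
  assumes open_\<Omega>: "open \<Omega>" and measure_\<Omega>: "emeasure lebesgue \<Omega> = ennreal A" "A > 0"
    and V: "(\<lambda>x. complex_of_real (V x)) \<in> L_B \<Omega>"
begin

lemma V_measurable [measurable]: "V \<in> borel_measurable (lebesgue_on \<Omega>)"
  by (rule L_B_real_measurable[OF V])

lemma potential_integrable: "h10_pair \<Omega> u G \<Longrightarrow> integrable (lebesgue_on \<Omega>) (\<lambda>x. V x * (cmod (u x))\<^sup>2)"
  by (rule L_B_integrable[OF open_\<Omega> measure_\<Omega> V])

lemma H10_L2: "u \<in> H10 \<Omega> \<Longrightarrow> u \<in> L2 \<Omega>" "u \<in> H10 \<Omega> \<Longrightarrow> (\<lambda>x. weak_grad \<Omega> u x $ i) \<in> L2 \<Omega>"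
  using H10_h10_pair[OF open_\<Omega>] by (auto simp: h10_pair_def)

lemma potential_mult_integrable:
  assumes "u \<in> H10 \<Omega>" "v \<in> H10 \<Omega>"
  shows "integrable (lebesgue_on \<Omega>) (\<lambda>x. complex_of_real (V x) * u x * cnj (v x))"
  by (intro weighted_mult_integrable V_measurable L2_measurable H10_L2 assms
      potential_integrable[OF H10_h10_pair[OF open_\<Omega>]])

lemma form_split:
  assumes "u \<in> H10 \<Omega>" "v \<in> H10 \<Omega>"
  shows "schroedinger_form \<Omega> V u v =
    (\<Sum>i\<in>UNIV. ip \<Omega> (\<lambda>x. weak_grad \<Omega> u x $ i) (\<lambda>x. weak_grad \<Omega> v x $ i))
      + (LINT x|lebesgue_on \<Omega>. complex_of_real (V x) * u x * cnj (v x))"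
proof -
  have int: "integrable (lebesgue_on \<Omega>) (\<lambda>x. weak_grad \<Omega> u x $ i * cnj (weak_grad \<Omega> v x $ i))" for i
    by (rule L2_mult_integrable[OF H10_L2(2)[OF assms(1)] L2_cnj[OF H10_L2(2)[OF assms(2)]]])
  have "schroedinger_form \<Omega> V u v =
    (LINT x|lebesgue_on \<Omega>. (\<Sum>i\<in>UNIV. weak_grad \<Omega> u x $ i * cnj (weak_grad \<Omega> v x $ i)))
      + (LINT x|lebesgue_on \<Omega>. complex_of_real (V x) * u x * cnj (v x))"
    unfolding schroedinger_form_def
    by (rule Bochner_Integration.integral_add[OF Bochner_Integration.integrable_sum[OF int] potential_mult_integrable[OF assms]])
  then show ?thesis
    unfolding ip_def by (subst Bochner_Integration.integral_sum[symmetric]) (simp_all add: int)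
qed

lemma form_cnj:
  assumes "u \<in> H10 \<Omega>" "v \<in> H10 \<Omega>"
  shows "schroedinger_form \<Omega> V v u = cnj (schroedinger_form \<Omega> V u v)"
proof -
  have "(LINT x|lebesgue_on \<Omega>. complex_of_real (V x) * v x * cnj (u x))
      = cnj (LINT x|lebesgue_on \<Omega>. complex_of_real (V x) * u x * cnj (v x))"
    unfolding Bochner_Integration.integral_cnj[symmetric] by (simp add: mult_ac)
  moreover have "(\<Sum>i\<in>UNIV. ip \<Omega> (\<lambda>x. weak_grad \<Omega> v x $ i) (\<lambda>x. weak_grad \<Omega> u x $ i))
      = cnj (\<Sum>i\<in>UNIV. ip \<Omega> (\<lambda>x. weak_grad \<Omega> u x $ i) (\<lambda>x. weak_grad \<Omega> v x $ i))"
    unfolding cnj_sum by (intro sum.cong refl ip_cnj)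
  ultimately show ?thesis
    unfolding form_split[OF assms] form_split[OF assms(2,1)] by simp
qed

lemma eigenfunction_form:
  assumes "u \<in> eigenspace (schroedinger_op \<Omega> V) l" "v \<in> H10 \<Omega>"
  shows "u \<in> H10 \<Omega>" "schroedinger_form \<Omega> V u v = of_real l * ip \<Omega> u v"
  using assms by (auto simp: eigenspace_def schroedinger_op_def ip_def mult.assoc)

text \<open>The form is Hermitian and the eigenvalues are real, so evaluating it from either side
  gives \<open>l\<close> and \<open>l'\<close> times the same inner product.\<close>

lemma eigenfunctions_orthogonal:
  assumes "u \<in> eigenspace (schroedinger_op \<Omega> V) l" "v \<in> eigenspace (schroedinger_op \<Omega> V) l'" "l \<noteq> l'"
  shows "ip \<Omega> u v = 0"
proof -
  have H: "u \<in> H10 \<Omega>" "v \<in> H10 \<Omega>" using assms by (auto simp: eigenspace_def schroedinger_op_def)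
  have "of_real l * ip \<Omega> u v = cnj (of_real l' * ip \<Omega> v u)"
    using eigenfunction_form(2)[OF assms(1) H(2)] eigenfunction_form(2)[OF assms(2) H(1)] form_cnj[OF H(2,1)] by simp
  also have "\<dots> = of_real l' * ip \<Omega> u v" using ip_cnj[of \<Omega> u v] by simp
  finally show ?thesis using assms(3) by simp
qed

text \<open>The components \<open>w k\<close> for different eigenvalues are mutually orthogonal. If
  they sum to zero, pairing with \<open>w l\<close> shows that \<open>w l\<close> vanishes almost
  everywhere, and independence within one eigenspace finishes.\<close>

lemma eigenfunctions_independent:
  fixes f :: "real \<Rightarrow> nat" and U :: "real \<Rightarrow> nat \<Rightarrow> real^2 \<Rightarrow> complex"
  assumes F: "finite F"
    and U: "\<And>l i. l \<in> F \<Longrightarrow> i < f l \<Longrightarrow> U l i \<in> eigenspace (schroedinger_op \<Omega> V) l"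
    and indep: "\<And>l c. l \<in> F \<Longrightarrow> AE x in lebesgue_on \<Omega>. (\<Sum>i<f l. c i * U l i x) = 0 \<Longrightarrow> \<forall>i<f l. c i = 0"
    and zero: "AE x in lebesgue_on \<Omega>. (\<Sum>l\<in>F. \<Sum>i<f l. c (l, i) * U l i x) = 0"
    and mem: "l \<in> F" "i < f l"
  shows "c (l, i) = 0"
proof -
  define w where "w k x = (\<Sum>i<f k. c (k, i) * U k i x)" for k x
  have UL2: "U k i \<in> L2 \<Omega>" if "k \<in> F" "i < f k" for k i
    using U[OF that] H10_L2(1) by (auto simp: eigenspace_def schroedinger_op_def)
  have w: "w k \<in> L2 \<Omega>" if "k \<in> F" for k
    unfolding w_def[abs_def] by (rule L2_sum) (use UL2 that in auto)
  have orth: "(LINT x|lebesgue_on \<Omega>. w k x * cnj (w l x)) = 0" if "k \<in> F" "k \<noteq> l" for k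
  proof -
    have "(LINT x|lebesgue_on \<Omega>. w k x * cnj (w l x))
      = (LINT x|lebesgue_on \<Omega>. (\<Sum>i<f k. \<Sum>j<f l. c (k, i) * cnj (c (l, j)) * (U k i x * cnj (U l j x))))"
      by (simp add: w_def sum_product mult_ac)
    also have "\<dots> = (\<Sum>i<f k. \<Sum>j<f l. c (k, i) * cnj (c (l, j)) * ip \<Omega> (U k i) (U l j))"
    proof -
      have int: "integrable (lebesgue_on \<Omega>) (\<lambda>x. c (k, i) * cnj (c (l, j)) * (U k i x * cnj (U l j x)))"
        if "i < f k" "j < f l" for i j
        by (intro integrable_mult_right L2_mult_integrable L2_cnj UL2 \<open>k \<in> F\<close> mem that)
      show ?thesis
        by (subst Bochner_Integration.integral_sum)
           (auto simp: ip_def int intro!: Bochner_Integration.integrable_sum sum.cong Bochner_Integration.integral_sum)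
    qed
    also have "\<dots> = 0"
      using eigenfunctions_orthogonal[OF U U \<open>k \<noteq> l\<close>] that mem by (intro sum.neutral ballI) simp
    finally show ?thesis .
  qed
  have "(LINT x|lebesgue_on \<Omega>. w l x * cnj (w l x)) = (\<Sum>k\<in>F. LINT x|lebesgue_on \<Omega>. w k x * cnj (w l x))"
    using F mem orth by (subst sum.remove[of F l]) auto
  also have "\<dots> = (LINT x|lebesgue_on \<Omega>. (\<Sum>k\<in>F. w k x * cnj (w l x)))"
    by (rule Bochner_Integration.integral_sum[symmetric]) (intro L2_mult_integrable L2_cnj w mem; assumption)
  also have "\<dots> = (LINT x|lebesgue_on \<Omega>. 0)"
  proof (rule integral_cong_AE)
    show "(\<lambda>x. \<Sum>k\<in>F. w k x * cnj (w l x)) \<in> borel_measurable (lebesgue_on \<Omega>)"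
      by (intro borel_measurable_sum borel_measurable_times L2_measurable w L2_cnj mem)
    show "AE x in lebesgue_on \<Omega>. (\<Sum>k\<in>F. w k x * cnj (w l x)) = 0"
      using zero by eventually_elim (simp add: w_def[symmetric] sum_distrib_right[symmetric])
  qed simp
  finally have "complex_of_real (LINT x|lebesgue_on \<Omega>. (cmod (w l x))\<^sup>2) = 0"
    unfolding integral_complex_of_real[symmetric] complex_norm_square by simp
  then have "AE x in lebesgue_on \<Omega>. (cmod (w l x))\<^sup>2 = 0"
    using integral_nonneg_eq_0_iff_AE[OF L2_integrable[OF w[OF mem(1)]]] by simp
  then have "AE x in lebesgue_on \<Omega>. (\<Sum>i<f l. c (l, i) * U l i x) = 0"
    by eventually_elim (simp add: w_def)
  from indep[OF mem(1) this] mem show ?thesis by blast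
qed

end

text \<open>An orthonormal basis for the energy form of the span of the eigenfunctions has density \<open>\<rho>\<close> with
  \<open>n \<le> \<integral> (V\<^sub>- + E) \<rho>\<close>. With \<open>E = 8 m / \<bar>\<Omega>\<bar>\<close>, a multiple of \<open>\<rho>\<close> is a test function for the Orlicz norm,
  and \<open>E \<rho>\<close> is controlled by splitting at \<open>\<rho> = 256\<close>, where \<open>exp (\<rho> / 64)\<close> exceeds \<open>16\<close>.\<close>

lemma (in schroedinger) eigenfunctions_card_le:
  fixes u :: "'i \<Rightarrow> real^2 \<Rightarrow> complex" and l :: "'i \<Rightarrow> real"
  assumes I: "finite I" and u: "\<And>i. i \<in> I \<Longrightarrow> u i \<in> eigenspace (schroedinger_op \<Omega> V) (l i)"
    and neg: "\<And>i. i \<in> I \<Longrightarrow> l i < 0"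
    and indep: "\<And>c. AE x in lebesgue_on \<Omega>. (\<Sum>i\<in>I. c i * u i x) = 0 \<Longrightarrow> \<forall>i\<in>I. c i = 0"
    and m: "norm_B \<Omega> (\<lambda>x. complex_of_real (neg_part V x)) \<le> ennreal m" "m > 0"
  shows "real (card I) \<le> 8192 * m"
proof -
  define n where "n = real (card I)"
  define E where "E = 8 * m / A"
  have E: "E > 0" using m measure_\<Omega> by (simp add: E_def)
  define G where "G i = weak_grad \<Omega> (u i)" for i
  have H: "u i \<in> H10 \<Omega>" if "i \<in> I" for i
    using u[OF that] by (simp add: eigenspace_def schroedinger_op_def)
  have uL2: "u i \<in> L2 \<Omega>" and GL2: "(\<lambda>x. G i x $ j) \<in> L2 \<Omega>" if "i \<in> I" for i j
    using H10_L2[OF H[OF that]] by (auto simp: G_def)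
  have pair: "h10_pair \<Omega> (u i) (G i)" if "i \<in> I" for i
    unfolding G_def by (rule H10_h10_pair[OF open_\<Omega> H[OF that]])
  define uc where "uc c x = (\<Sum>i\<in>I. c i * u i x)" for c x
  define Gc where "Gc c x = (\<chi> j. \<Sum>i\<in>I. c i * G i x $ j)" for c x
  have pair_c: "h10_pair \<Omega> (uc c) (Gc c)" for c
    unfolding uc_def[abs_def] Gc_def[abs_def] by (rule h10_pair_sum[OF open_\<Omega> I pair])
  have ucL2: "uc c \<in> L2 \<Omega>" for c using pair_c[of c] by (simp add: h10_pair_def)
  \<comment> \<open>The Gram matrix of the energy form on the eigenfunctions, with \<open>B\<close>
    the form it induces on coefficient vectors. The mass term with \<open>E > 0\<close> turns linear
    independence into positivity.\<close>
  define a where "a i k = (\<Sum>j\<in>UNIV. ip \<Omega> (\<lambda>x. G i x $ j) (\<lambda>x. G k x $ j)) + of_real E * ip \<Omega> (u i) (u k)" for i k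
  define B where "B c d = (\<Sum>i\<in>I. \<Sum>k\<in>I. c i * cnj (d k) * a i k)" for c d
  have sqn_u: "complex_of_real (sqn \<Omega> (uc c)) = (\<Sum>i\<in>I. \<Sum>k\<in>I. c i * cnj (c k) * ip \<Omega> (u i) (u k))" for c
    unfolding uc_def[abs_def] ip_def by (rule sqn_sum_expand[OF I uL2])
  have sqn_G: "complex_of_real (\<Sum>j\<in>UNIV. sqn \<Omega> (\<lambda>x. Gc c x $ j))
      = (\<Sum>i\<in>I. \<Sum>k\<in>I. c i * cnj (c k) * (\<Sum>j\<in>UNIV. ip \<Omega> (\<lambda>x. G i x $ j) (\<lambda>x. G k x $ j)))" for c
  proof -
    have "complex_of_real (sqn \<Omega> (\<lambda>x. Gc c x $ j))
      = (\<Sum>i\<in>I. \<Sum>k\<in>I. c i * cnj (c k) * ip \<Omega> (\<lambda>x. G i x $ j) (\<lambda>x. G k x $ j))" for j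
      unfolding Gc_def ip_def vec_lambda_beta by (rule sqn_sum_expand[OF I GL2])
    then have "complex_of_real (\<Sum>j\<in>UNIV. sqn \<Omega> (\<lambda>x. Gc c x $ j))
      = (\<Sum>j\<in>UNIV. \<Sum>i\<in>I. \<Sum>k\<in>I. c i * cnj (c k) * ip \<Omega> (\<lambda>x. G i x $ j) (\<lambda>x. G k x $ j))"
      by simp
    also have "\<dots> = (\<Sum>i\<in>I. \<Sum>j\<in>UNIV. \<Sum>k\<in>I. c i * cnj (c k) * ip \<Omega> (\<lambda>x. G i x $ j) (\<lambda>x. G k x $ j))"
      by (rule sum.swap)
    also have "\<dots> = (\<Sum>i\<in>I. \<Sum>k\<in>I. \<Sum>j\<in>UNIV. c i * cnj (c k) * ip \<Omega> (\<lambda>x. G i x $ j) (\<lambda>x. G k x $ j))"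
      by (intro sum.cong refl sum.swap)
    finally show ?thesis by (simp add: sum_distrib_left)
  qed
  have B_energy: "B c c = of_real (pair_energy \<Omega> E (uc c) (Gc c))" for c
    unfolding pair_energy_def of_real_add of_real_mult sqn_u sqn_G B_def a_def
    by (simp add: distrib_left sum.distrib sum_distrib_left mult_ac)
  have a_herm: "a k i = cnj (a i k)" for i k
    unfolding a_def by (simp add: ip_cnj[of \<Omega> _ "u i"] ip_cnj[of \<Omega> _ "\<lambda>x. G i x $ j" for j])
  have "\<exists>T. \<forall>j\<in>I. \<forall>k\<in>I. B (T j) (T k) = (if j = k then 1 else 0)"
  proof (rule gram_schmidt[OF I])
    show "B (\<lambda>i. c i + s * d i) e = B c e + s * B d e" for c d e s
      by (simp add: B_def distrib_right sum.distrib sum_distrib_left mult.assoc)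
    show "B d c = cnj (B c d)" for c d
    proof -
      have "cnj (B c d) = (\<Sum>i\<in>I. \<Sum>k\<in>I. cnj (c i) * d k * a k i)"
        unfolding B_def cnj_sum by (simp add: a_herm[symmetric])
      also have "\<dots> = (\<Sum>k\<in>I. \<Sum>i\<in>I. cnj (c i) * d k * a k i)" by (rule sum.swap)
      finally show ?thesis by (simp add: B_def mult.commute)
    qed
    show "0 < Re (B c c)" if "\<exists>i\<in>I. c i \<noteq> 0" for c
    proof -
      have "sqn \<Omega> (uc c) \<noteq> 0"
      proof
        assume "sqn \<Omega> (uc c) = 0"
        then have "AE x in lebesgue_on \<Omega>. (cmod (uc c x))\<^sup>2 = 0"
          unfolding sqn_def using integral_nonneg_eq_0_iff_AE[OF L2_integrable[OF ucL2[of c]]] by simp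
        then have "AE x in lebesgue_on \<Omega>. (\<Sum>i\<in>I. c i * u i x) = 0"
          by eventually_elim (simp add: uc_def)
        from indep[OF this] that show False by blast
      qed
      then have "E * sqn \<Omega> (uc c) > 0" using E sqn_nonneg[of \<Omega> "uc c"] by simp
      then show ?thesis
        unfolding B_energy pair_energy_def by (simp add: add_nonneg_pos sum_nonneg sqn_nonneg)
    qed
  qed
  then obtain T where T: "\<And>j k. j \<in> I \<Longrightarrow> k \<in> I \<Longrightarrow> B (T j) (T k) = (if j = k then 1 else 0)" by blast
  define v where "v j = uc (T j)" for j
  define \<rho> where "\<rho> x = (\<Sum>j\<in>I. (cmod (v j x))\<^sup>2)" for x
  have vL2: "v j \<in> L2 \<Omega>" for j by (simp add: v_def ucL2)
  have \<rho>_int: "integrable (lebesgue_on \<Omega>) \<rho>"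
    unfolding \<rho>_def[abs_def] by (intro Bochner_Integration.integrable_sum L2_integrable vL2)
  have \<rho>_nonneg: "0 \<le> \<rho> x" for x by (simp add: \<rho>_def sum_nonneg)
  note [measurable] = borel_measurable_integrable[OF \<rho>_int]
  have trudinger: "(\<integral>\<^sup>+x. ennreal (E * \<rho> x * exp (\<rho> x / 64)) \<partial>lebesgue_on \<Omega>) \<le> ennreal (4 * n)"
    unfolding \<rho>_def n_def
  proof (rule h10_pair_trudinger[OF open_\<Omega> I _ E])
    show "h10_pair \<Omega> (v j) (Gc (T j))" for j unfolding v_def by (rule pair_c)
    fix c
    define d where "d i = (\<Sum>j\<in>I. c j * T j i)" for i
    have u_eq: "(\<lambda>x. \<Sum>j\<in>I. c j * v j x) = uc d"
    proof
      fix x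
      have "(\<Sum>j\<in>I. c j * v j x) = (\<Sum>j\<in>I. \<Sum>i\<in>I. c j * T j i * u i x)"
        by (simp add: v_def uc_def sum_distrib_left mult.assoc)
      also have "\<dots> = (\<Sum>i\<in>I. \<Sum>j\<in>I. c j * T j i * u i x)" by (rule sum.swap)
      finally show "(\<Sum>j\<in>I. c j * v j x) = uc d x" by (simp add: uc_def d_def sum_distrib_right)
    qed
    have G_eq: "(\<lambda>x. \<chi> i'. \<Sum>j\<in>I. c j * Gc (T j) x $ i') = Gc d"
    proof
      fix x
      have "(\<Sum>j\<in>I. c j * Gc (T j) x $ i') = Gc d x $ i'" for i'
      proof -
        have "(\<Sum>j\<in>I. c j * Gc (T j) x $ i') = (\<Sum>j\<in>I. \<Sum>i\<in>I. c j * T j i * G i x $ i')"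
          by (simp add: Gc_def sum_distrib_left mult.assoc)
        also have "\<dots> = (\<Sum>i\<in>I. \<Sum>j\<in>I. c j * T j i * G i x $ i')" by (rule sum.swap)
        finally show ?thesis by (simp add: Gc_def d_def sum_distrib_right)
      qed
      then show "(\<chi> i'. \<Sum>j\<in>I. c j * Gc (T j) x $ i') = Gc d x" by (simp add: vec_eq_iff)
    qed
    have "B d d = (\<Sum>j\<in>I. \<Sum>k\<in>I. c j * cnj (c k) * B (T j) (T k))"
    proof -
      have "B d d = (\<Sum>i\<in>I. \<Sum>k\<in>I. \<Sum>j\<in>I. \<Sum>j'\<in>I. c j * cnj (c j') * (T j i * cnj (T j' k) * a i k))"
        unfolding B_def
      proof (intro sum.cong refl)
        fix i k
        have "d i * cnj (d k) * a i k = (\<Sum>j\<in>I. c j * T j i) * (\<Sum>j'\<in>I. cnj (c j') * cnj (T j' k)) * a i k"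
          by (simp add: d_def)
        also have "\<dots> = (\<Sum>j\<in>I. \<Sum>j'\<in>I. c j * T j i * (cnj (c j') * cnj (T j' k)) * a i k)"
          unfolding sum_product by (simp only: sum_distrib_right)
        also have "\<dots> = (\<Sum>j\<in>I. \<Sum>j'\<in>I. c j * cnj (c j') * (T j i * cnj (T j' k) * a i k))"
          by (intro sum.cong refl) (simp add: mult_ac)
        finally show "d i * cnj (d k) * a i k = (\<Sum>j\<in>I. \<Sum>j'\<in>I. c j * cnj (c j') * (T j i * cnj (T j' k) * a i k))" .
      qed
      also have "\<dots> = (\<Sum>i\<in>I. \<Sum>j\<in>I. \<Sum>k\<in>I. \<Sum>j'\<in>I. c j * cnj (c j') * (T j i * cnj (T j' k) * a i k))"
        by (intro sum.cong refl sum.swap)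
      also have "\<dots> = (\<Sum>j\<in>I. \<Sum>i\<in>I. \<Sum>k\<in>I. \<Sum>j'\<in>I. c j * cnj (c j') * (T j i * cnj (T j' k) * a i k))"
        by (rule sum.swap)
      also have "\<dots> = (\<Sum>j\<in>I. \<Sum>i\<in>I. \<Sum>j'\<in>I. \<Sum>k\<in>I. c j * cnj (c j') * (T j i * cnj (T j' k) * a i k))"
        by (intro sum.cong refl sum.swap)
      also have "\<dots> = (\<Sum>j\<in>I. \<Sum>j'\<in>I. \<Sum>i\<in>I. \<Sum>k\<in>I. c j * cnj (c j') * (T j i * cnj (T j' k) * a i k))"
        by (intro sum.cong refl sum.swap)
      finally show ?thesis by (simp add: B_def sum_distrib_left)
    qed
    also have "\<dots> = (\<Sum>j\<in>I. c j * cnj (c j))"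
      using I by (intro sum.cong refl) (simp add: T if_distrib cong: if_cong)
    also have "\<dots> = of_real (\<Sum>j\<in>I. (cmod (c j))\<^sup>2)"
      unfolding of_real_sum complex_norm_square ..
    finally have "pair_energy \<Omega> E (uc d) (Gc d) = (\<Sum>j\<in>I. (cmod (c j))\<^sup>2)"
      unfolding B_energy of_real_eq_iff .
    then show "pair_energy \<Omega> E (\<lambda>x. \<Sum>j\<in>I. c j * v j x) (\<lambda>x. \<chi> i'. \<Sum>j\<in>I. c j * Gc (T j) x $ i')
        \<le> (\<Sum>j\<in>I. (cmod (c j))\<^sup>2)"
      unfolding u_eq G_eq by simp
  qed
  \<comment> \<open>Since \<open>ip \<Omega> (u i) (u k)\<close> vanishes unless
    \<open>l i = l k\<close>, the eigenvalue can be split symmetrically as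
    \<open>- r i * cnj (r k)\<close>. The form then equals minus the squared norm of the combination
    with coefficients \<open>c i * r i\<close>.\<close>
  have form_neg: "(\<Sum>j\<in>UNIV. sqn \<Omega> (\<lambda>x. Gc c x $ j)) + (LINT x|lebesgue_on \<Omega>. V x * (cmod (uc c x))\<^sup>2) \<le> 0" for c
  proof -
    define r where "r i = complex_of_real (sqrt (- l i))" for i
    have "complex_of_real ((\<Sum>j\<in>UNIV. sqn \<Omega> (\<lambda>x. Gc c x $ j)) + (LINT x|lebesgue_on \<Omega>. V x * (cmod (uc c x))\<^sup>2))
      = (\<Sum>i\<in>I. \<Sum>k\<in>I. c i * cnj (c k) * ((\<Sum>j\<in>UNIV. ip \<Omega> (\<lambda>x. G i x $ j) (\<lambda>x. G k x $ j))
          + (LINT x|lebesgue_on \<Omega>. complex_of_real (V x) * u i x * cnj (u k x))))"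
      unfolding of_real_add sqn_G uc_def
      by (subst weighted_norm_sum_expand[OF I potential_mult_integrable[OF H H]])
         (simp_all add: distrib_left sum.distrib)
    also have "\<dots> = (\<Sum>i\<in>I. \<Sum>k\<in>I. - ((c i * r i) * cnj (c k * r k) * ip \<Omega> (u i) (u k)))"
    proof (intro sum.cong refl)
      fix i k assume ik: "i \<in> I" "k \<in> I"
      have "(\<Sum>j\<in>UNIV. ip \<Omega> (\<lambda>x. G i x $ j) (\<lambda>x. G k x $ j)) + (LINT x|lebesgue_on \<Omega>. complex_of_real (V x) * u i x * cnj (u k x))
        = of_real (l i) * ip \<Omega> (u i) (u k)"
        using form_split[OF H[OF ik(1)] H[OF ik(2)]] eigenfunction_form(2)[OF u[OF ik(1)] H[OF ik(2)]]
        by (simp add: G_def)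
      also have "\<dots> = - (r i * cnj (r k) * ip \<Omega> (u i) (u k))"
      proof (cases "l i = l k")
        case True
        have "r k * cnj (r k) = of_real ((sqrt (- l k))\<^sup>2)"
          unfolding r_def complex_cnj_complex_of_real of_real_mult[symmetric] power2_eq_square ..
        also have "\<dots> = - of_real (l k)" using neg[OF ik(2)] by simp
        finally show ?thesis using True by (simp add: r_def)
      next
        case False
        then show ?thesis using eigenfunctions_orthogonal[OF u[OF ik(1)] u[OF ik(2)]] by simp
      qed
      finally show "c i * cnj (c k) * ((\<Sum>j\<in>UNIV. ip \<Omega> (\<lambda>x. G i x $ j) (\<lambda>x. G k x $ j))
          + (LINT x|lebesgue_on \<Omega>. complex_of_real (V x) * u i x * cnj (u k x)))
        = - ((c i * r i) * cnj (c k * r k) * ip \<Omega> (u i) (u k))"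
        by (simp add: mult_ac)
    qed
    also have "\<dots> = complex_of_real (- sqn \<Omega> (uc (\<lambda>i. c i * r i)))"
      unfolding of_real_minus sqn_u by (simp add: sum_negf)
    finally show ?thesis
      unfolding of_real_eq_iff using sqn_nonneg[of \<Omega> "uc (\<lambda>i. c i * r i)"] by simp
  qed
  have Vv: "integrable (lebesgue_on \<Omega>) (\<lambda>x. V x * (cmod (v j x))\<^sup>2)" for j
    unfolding v_def by (rule potential_integrable[OF pair_c])
  define N where "N = neg_part V"
  have N: "N x = max 0 (- V x)" "0 \<le> N x" "- V x \<le> N x" for x by (auto simp: N_def neg_part_def)
  have Nm [measurable]: "N \<in> borel_measurable (lebesgue_on \<Omega>)"
    unfolding N_def neg_part_def[abs_def] by measurable
  have Nv: "integrable (lebesgue_on \<Omega>) (\<lambda>x. N x * (cmod (v j x))\<^sup>2)" for j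
  proof (rule Bochner_Integration.integrable_bound[OF Vv[of j]])
    note [measurable] = L2_measurable[OF vL2[of j]]
    show "(\<lambda>x. N x * (cmod (v j x))\<^sup>2) \<in> borel_measurable (lebesgue_on \<Omega>)" by measurable
    show "AE x in lebesgue_on \<Omega>. norm (N x * (cmod (v j x))\<^sup>2) \<le> norm (V x * (cmod (v j x))\<^sup>2)"
      by (intro AE_I2) (auto simp: N(1) abs_mult intro!: mult_right_mono)
  qed
  \<comment> \<open>The energy of \<open>v j\<close> is one, and \<open>form_neg\<close> trades its
    gradient part for minus the potential term.\<close>
  have one_le: "1 \<le> (LINT x|lebesgue_on \<Omega>. N x * (cmod (v j x))\<^sup>2) + E * sqn \<Omega> (v j)" if "j \<in> I" for j
  proof -
    have "complex_of_real (pair_energy \<Omega> E (v j) (Gc (T j))) = 1"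
      using T[OF that that] unfolding B_energy v_def by simp
    then have "pair_energy \<Omega> E (v j) (Gc (T j)) = 1" by (simp only: of_real_eq_1_iff)
    then have "1 \<le> - (LINT x|lebesgue_on \<Omega>. V x * (cmod (v j x))\<^sup>2) + E * sqn \<Omega> (v j)"
      using form_neg[of "T j"] unfolding pair_energy_def v_def by linarith
    also have "- (LINT x|lebesgue_on \<Omega>. V x * (cmod (v j x))\<^sup>2) = (LINT x|lebesgue_on \<Omega>. - (V x * (cmod (v j x))\<^sup>2))"
      by simp
    also have "\<dots> \<le> (LINT x|lebesgue_on \<Omega>. N x * (cmod (v j x))\<^sup>2)"
    proof (rule integral_mono)
      show "- (V x * (cmod (v j x))\<^sup>2) \<le> N x * (cmod (v j x))\<^sup>2" for x
        using mult_right_mono[OF N(3)[of x] zero_le_power2[of "cmod (v j x)"]] by simp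
    qed (use Vv Nv in auto)
    finally show ?thesis by simp
  qed
  have N\<rho>: "integrable (lebesgue_on \<Omega>) (\<lambda>x. N x * \<rho> x)"
    unfolding \<rho>_def sum_distrib_left by (intro Bochner_Integration.integrable_sum Nv)
  have "(\<Sum>j\<in>I. 1) \<le> (\<Sum>j\<in>I. (LINT x|lebesgue_on \<Omega>. N x * (cmod (v j x))\<^sup>2) + E * sqn \<Omega> (v j))"
    by (intro sum_mono one_le)
  also have "\<dots> = (LINT x|lebesgue_on \<Omega>. N x * \<rho> x) + E * (LINT x|lebesgue_on \<Omega>. \<rho> x)"
    unfolding \<rho>_def sum_distrib_left sum.distrib sqn_def
    by (subst (1 2) Bochner_Integration.integral_sum) (auto intro: Nv L2_integrable vL2 simp: sum_distrib_left)
  finally have n_le: "n \<le> (LINT x|lebesgue_on \<Omega>. N x * \<rho> x) + E * (LINT x|lebesgue_on \<Omega>. \<rho> x)"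
    by (simp add: n_def)
  show ?thesis
  proof (cases "n \<le> 128 * m")
    case True
    then show ?thesis using m by (simp add: n_def)
  next
    case False
    then have n: "n > 0" "n > 128 * m" using m by auto
    \<comment> \<open>With this value \<open>\<theta> * n / (16 * E)\<close> is exactly
      \<open>A\<close>, and dividing \<open>m\<close> by \<open>\<theta> / 64\<close> leaves
      \<open>n / 2\<close>. The condition \<open>\<theta> \<le> 1\<close> is why small
      \<open>n\<close> was set aside.\<close>
    define \<theta> where "\<theta> = 128 * m / n"
    have \<theta>: "0 < \<theta>" "\<theta> \<le> 1" using n m by (auto simp: \<theta>_def)
    define f where "f x = complex_of_real (\<theta> * (\<rho> x / 64))" for x
    have "(\<integral>\<^sup>+x. ennreal (young_A (f x)) \<partial>lebesgue_on \<Omega>) \<le> ennreal (\<theta> * n / (16 * E))"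
      unfolding f_def by (rule young_A_integral_le[OF _ _ E \<rho>_nonneg _ trudinger]) (use \<theta> n in auto)
    also have "\<theta> * n / (16 * E) = A" using n m measure_\<Omega> by (simp add: \<theta>_def E_def)
    finally have f: "(\<integral>\<^sup>+x. ennreal (young_A (f x)) \<partial>lebesgue_on \<Omega>) \<le> emeasure lebesgue \<Omega>"
      using measure_\<Omega> by simp
    have fin: "norm_B \<Omega> (\<lambda>x. complex_of_real (N x)) < \<infinity>"
      using m unfolding N_def by (simp add: le_less_trans[OF m(1)])
    have fm: "f \<in> borel_measurable (lebesgue_on \<Omega>)" unfolding f_def by measurable
    have "ennreal (cmod (LINT x|lebesgue_on \<Omega>. f x * complex_of_real (N x))) \<le> ennreal m"
      using norm_B_admissible(2)[OF fin fm f] m(1) unfolding N_def by (rule order_trans)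
    then have "cmod (LINT x|lebesgue_on \<Omega>. f x * complex_of_real (N x)) \<le> m"
      using m by simp
    also have "(LINT x|lebesgue_on \<Omega>. f x * complex_of_real (N x))
      = complex_of_real (LINT x|lebesgue_on \<Omega>. \<theta> / 64 * (N x * \<rho> x))"
      unfolding f_def integral_complex_of_real[symmetric] by (intro Bochner_Integration.integral_cong) auto
    finally have "\<theta> / 64 * (LINT x|lebesgue_on \<Omega>. N x * \<rho> x) \<le> m"
      unfolding norm_of_real integral_mult_right_zero by linarith
    then have part1: "(LINT x|lebesgue_on \<Omega>. N x * \<rho> x) \<le> n / 2"
      using n m by (simp add: \<theta>_def field_simps)
    define X where "X x = E * \<rho> x * exp (\<rho> x / 64)" for x
    have X_nonneg: "0 \<le> X x" for x using E \<rho>_nonneg[of x] by (simp add: X_def)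
    have Xm [measurable]: "X \<in> borel_measurable (lebesgue_on \<Omega>)" unfolding X_def by measurable
    have X_int: "integrable (lebesgue_on \<Omega>) X"
      by (rule integrableI_nonneg) (use trudinger X_nonneg in \<open>auto simp: X_def intro: le_less_trans\<close>)
    have "ennreal (LINT x|lebesgue_on \<Omega>. X x) = (\<integral>\<^sup>+x. ennreal (X x) \<partial>lebesgue_on \<Omega>)"
      by (rule nn_integral_eq_integral[symmetric, OF X_int]) (simp add: X_nonneg)
    also have "\<dots> \<le> ennreal (4 * n)" using trudinger by (simp add: X_def)
    finally have X_le: "(LINT x|lebesgue_on \<Omega>. X x) \<le> 4 * n" using n by simp
    have fin_meas: "emeasure (lebesgue_on \<Omega>) (space (lebesgue_on \<Omega>)) = ennreal A"
      using open_sets_lebesgue[OF open_\<Omega>] measure_\<Omega> by (simp add: emeasure_restrict_space space_restrict_space)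
    then have const_int: "integrable (lebesgue_on \<Omega>) (\<lambda>x. 256 * E)"
      by (intro finite_measure.integrable_const finite_measureI) simp
    have "E * \<rho> x \<le> 256 * E + X x / 16" for x
    proof (cases "\<rho> x \<le> 256")
      case True
      then show ?thesis using E X_nonneg[of x] by (intro add_increasing2) auto
    next
      case False
      have "2 \<le> exp (1 :: real)" using exp_ge_add_one_self[of 1] by simp
      then have "2 ^ 4 \<le> exp (1 :: real) ^ 4" by (intro power_mono) auto
      also have "\<dots> = exp 4" by (simp add: exp_of_nat_mult[symmetric])
      also have "\<dots> \<le> exp (\<rho> x / 64)" using False by simp
      finally have "(E * \<rho> x) * 16 \<le> (E * \<rho> x) * exp (\<rho> x / 64)"
        using E \<rho>_nonneg[of x] by (intro mult_left_mono) auto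
      then have "(E * \<rho> x) * 16 \<le> X x" by (simp only: X_def)
      then show ?thesis using E by linarith
    qed
    then have "(LINT x|lebesgue_on \<Omega>. E * \<rho> x) \<le> (LINT x|lebesgue_on \<Omega>. 256 * E + X x / 16)"
      using \<rho>_int X_int const_int by (intro integral_mono) auto
    also have "\<dots> = 256 * E * A + (LINT x|lebesgue_on \<Omega>. X x) / 16"
      using X_int const_int fin_meas measure_\<Omega>
      by (subst Bochner_Integration.integral_add) (auto simp: measure_def)
    finally have "E * (LINT x|lebesgue_on \<Omega>. \<rho> x) \<le> 2048 * m + n / 4"
      using X_le measure_\<Omega> by (simp add: E_def)
    \<comment> \<open>Here \<open>2048 * m\<close> is \<open>256 * E * A\<close> and
      \<open>n / 4\<close> is \<open>4 * n / 16\<close>. A quarter of \<open>n\<close> survives the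
      absorption, so the final constant is four times 2048.\<close>
    then have "n \<le> n / 2 + (2048 * m + n / 4)" using n_le part1 by linarith
    then show ?thesis by (simp add: n_def)
  qed
qed

section \<open>From finite systems of eigenfunctions to the eigenvalue count\<close>

text \<open>The suprema are exhausted one at a time, with \<open>Y\<close> collecting the numbers
  already fixed; generalising over \<open>Y\<close> is what carries the induction. Nonempty index
  sets let a summand move inside a supremum.\<close>

lemma sum_SUP_of_nat_le:
  fixes S :: "'b \<Rightarrow> nat set" and Y X :: ennreal
  assumes "finite F" "\<And>l. l \<in> F \<Longrightarrow> S l \<noteq> {}"
    and "\<And>f. (\<And>l. l \<in> F \<Longrightarrow> f l \<in> S l) \<Longrightarrow> Y + (\<Sum>l\<in>F. of_nat (f l)) \<le> X"
  shows "Y + (\<Sum>l\<in>F. SUP n\<in>S l. of_nat n) \<le> X"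
  using assms
proof (induction F arbitrary: Y rule: finite_induct)
  case empty
  then show ?case by simp
next
  case (insert a F)
  have "(Y + of_nat n) + (\<Sum>l\<in>F. SUP n\<in>S l. of_nat n) \<le> X" if "n \<in> S a" for n
  proof (rule insert.IH)
    show "S l \<noteq> {}" if "l \<in> F" for l using insert.prems(1) that by simp
    fix f assume f: "\<And>l. l \<in> F \<Longrightarrow> f l \<in> S l"
    have "Y + (\<Sum>l\<in>insert a F. of_nat ((f(a := n)) l)) \<le> X"
      by (rule insert.prems(2)) (use f that in auto)
    moreover have "(\<Sum>l\<in>F. of_nat ((f(a := n)) l)) = (\<Sum>l\<in>F. of_nat (f l) :: ennreal)"
      using insert.hyps by (intro sum.cong) auto
    ultimately show "(Y + of_nat n) + (\<Sum>l\<in>F. of_nat (f l)) \<le> X"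
      using insert.hyps by (simp add: add.assoc)
  qed
  then have "(SUP n\<in>S a. (Y + (\<Sum>l\<in>F. SUP n\<in>S l. of_nat n)) + of_nat n) \<le> X"
    by (intro SUP_least) (simp add: ac_simps)
  also have "(SUP n\<in>S a. (Y + (\<Sum>l\<in>F. SUP n\<in>S l. of_nat n)) + of_nat n)
      = (Y + (\<Sum>l\<in>F. SUP n\<in>S l. of_nat n)) + (SUP n\<in>S a. of_nat n)"
    by (rule ennreal_SUP_add_right[symmetric]) (simp add: insert.prems(1))
  also have "\<dots> = Y + (\<Sum>l\<in>insert a F. SUP n\<in>S l. of_nat n)"
    using insert.hyps by (simp add: ac_simps)
  finally show ?case .
qed

text \<open>An infinite sum of nonnegative terms is the supremum over finite sets of eigenvalues,
  and each multiplicity is the supremum over finite independent families. A bound on finite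
  independent systems of eigenfunctions therefore bounds the whole count.\<close>

lemma (in schroedinger) num_neg_eigenvalues_le:
  assumes m: "norm_B \<Omega> (\<lambda>x. complex_of_real (neg_part V x)) \<le> ennreal m" "m > 0"
  shows "num_neg_eigenvalues (lebesgue_on \<Omega>) (schroedinger_op \<Omega> V) \<le> ennreal (8192 * m)"
proof -
  define S :: "real \<Rightarrow> nat set" where "S l = {n. \<exists>u. (\<forall>i<n. u i \<in> eigenspace (schroedinger_op \<Omega> V) l) \<and>
      (\<forall>c. (AE x in lebesgue_on \<Omega>. (\<Sum>i<n. c i * u i x) = 0) \<longrightarrow> (\<forall>i<n. c i = 0))}" for l
  have "(\<Sum>l\<in>F. ae_dim (lebesgue_on \<Omega>) (eigenspace (schroedinger_op \<Omega> V) l)) \<le> ennreal (8192 * m)"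
    if F: "finite F" "F \<subseteq> {..<0}" for F
  proof -
    have "0 + (\<Sum>l\<in>F. SUP n\<in>S l. of_nat n) \<le> ennreal (8192 * m)"
    proof (rule sum_SUP_of_nat_le[OF F(1)])
      have "0 \<in> S l" for l by (simp add: S_def)
      then show "S l \<noteq> {}" for l by blast
      fix f assume "\<And>l. l \<in> F \<Longrightarrow> f l \<in> S l"
      then have "\<forall>l\<in>F. \<exists>u. (\<forall>i<f l. u i \<in> eigenspace (schroedinger_op \<Omega> V) l) \<and>
          (\<forall>c. (AE x in lebesgue_on \<Omega>. (\<Sum>i<f l. c i * u i x) = 0) \<longrightarrow> (\<forall>i<f l. c i = 0))"
        by (simp add: S_def)
      then obtain U where U: "\<forall>l\<in>F. (\<forall>i<f l. U l i \<in> eigenspace (schroedinger_op \<Omega> V) l) \<and>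
          (\<forall>c. (AE x in lebesgue_on \<Omega>. (\<Sum>i<f l. c i * U l i x) = 0) \<longrightarrow> (\<forall>i<f l. c i = 0))"
        unfolding bchoice_iff by blast
      define I where "I = Sigma F (\<lambda>l. {..<f l})"
      have "real (card I) \<le> 8192 * m"
      proof (rule eigenfunctions_card_le[OF _ _ _ _ m, of I "\<lambda>p. U (fst p) (snd p)" fst])
        show "finite I" using F by (simp add: I_def)
        show "U (fst p) (snd p) \<in> eigenspace (schroedinger_op \<Omega> V) (fst p)" if "p \<in> I" for p
          using U that by (auto simp: I_def)
        show "fst p < 0" if "p \<in> I" for p using F that by (auto simp: I_def)
        fix c :: "real \<times> nat \<Rightarrow> complex"
        assume "AE x in lebesgue_on \<Omega>. (\<Sum>p\<in>I. c p * U (fst p) (snd p) x) = 0"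
        then have AE0: "AE x in lebesgue_on \<Omega>. (\<Sum>l\<in>F. \<Sum>i<f l. c (l, i) * U l i x) = 0"
          using F(1) by (simp add: I_def sum.Sigma case_prod_unfold)
        have "c (l, i) = 0" if "l \<in> F" "i < f l" for l i
          by (rule eigenfunctions_independent[OF F(1) _ _ AE0 that]) (use U in auto)
        then show "\<forall>p\<in>I. c p = 0" by (auto simp: I_def)
      qed
      moreover have "card I = (\<Sum>l\<in>F. f l)" using F(1) by (simp add: I_def)
      ultimately have "ennreal (real (\<Sum>l\<in>F. f l)) \<le> ennreal (8192 * m)" by (intro ennreal_leI) simp
      also have "ennreal (real (\<Sum>l\<in>F. f l)) = 0 + (\<Sum>l\<in>F. of_nat (f l))"
        unfolding ennreal_of_nat_eq_real_of_nat[symmetric] by simp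
      finally show "0 + (\<Sum>l\<in>F. of_nat (f l)) \<le> ennreal (8192 * m)" .
    qed
    then show ?thesis by (simp add: ae_dim_def S_def)
  qed
  then show ?thesis
    unfolding num_neg_eigenvalues_def
    by (subst nonneg_infsum_complete) (auto intro!: SUP_least)
qed

theorem theorem1p1:
  shows "\<exists>C::real. 0 \<le> C \<and>
    (\<forall>(\<Omega> :: (real^2) set) (V :: real^2 \<Rightarrow> real).
       open \<Omega> \<longrightarrow> emeasure lebesgue \<Omega> < \<infinity> \<longrightarrow> (\<lambda>x. complex_of_real (V x)) \<in> L_B \<Omega> \<longrightarrow>
       num_neg_eigenvalues (lebesgue_on \<Omega>) (schroedinger_op \<Omega> V)
         \<le> ennreal C * norm_B \<Omega> (\<lambda>x. complex_of_real (neg_part V x)))"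
proof (intro exI[of _ 8192] conjI allI impI)
  fix \<Omega> :: "(real^2) set" and V :: "real^2 \<Rightarrow> real"
  assume \<Omega>: "open \<Omega>" and fin: "emeasure lebesgue \<Omega> < \<infinity>" and V: "(\<lambda>x. complex_of_real (V x)) \<in> L_B \<Omega>"
  define M where "M = norm_B \<Omega> (\<lambda>x. complex_of_real (neg_part V x))"
  define A where "A = measure lebesgue \<Omega>"
  have A: "emeasure lebesgue \<Omega> = ennreal A"
    using fin unfolding A_def by (intro emeasure_eq_ennreal_measure) auto
  show "num_neg_eigenvalues (lebesgue_on \<Omega>) (schroedinger_op \<Omega> V)
      \<le> ennreal 8192 * norm_B \<Omega> (\<lambda>x. complex_of_real (neg_part V x))"
  proof (cases "A = 0")
    case True
    have "emeasure (lebesgue_on \<Omega>) (space (lebesgue_on \<Omega>)) = 0"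
      using open_sets_lebesgue[OF \<Omega>] A True by (simp add: emeasure_restrict_space space_restrict_space)
    \<comment> \<open>On a null set every statement holds almost everywhere, so no nonempty family
      is independent and all multiplicities are zero.\<close>
    then have AE0: "AE x in lebesgue_on \<Omega>. P x" for P
      by (intro AE_I[of _ _ "space (lebesgue_on \<Omega>)"]) auto
    have "ae_dim (lebesgue_on \<Omega>) (eigenspace (schroedinger_op \<Omega> V) l) = 0" for l
    proof -
      have "n = 0" if "\<forall>c. (AE x in lebesgue_on \<Omega>. (\<Sum>i<n. c i * u i x) = 0) \<longrightarrow> (\<forall>i<n. c i = (0::complex))"
        for n and u :: "nat \<Rightarrow> real^2 \<Rightarrow> complex"
      proof -
        have "\<forall>i<n. (1 :: complex) = 0" using that[rule_format, OF AE0, where c = "\<lambda>_. 1"] by blast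
        then show ?thesis by auto
      qed
      then have "ae_dim (lebesgue_on \<Omega>) (eigenspace (schroedinger_op \<Omega> V) l) \<le> 0"
        unfolding ae_dim_def by (intro SUP_least) auto
      then show ?thesis by simp
    qed
    then show ?thesis by (simp add: num_neg_eigenvalues_def)
  next
    case False
    then have "A > 0" by (simp add: A_def zero_less_measure_iff)
    then interpret schroedinger \<Omega> V A
      using \<Omega> A V by unfold_locales
    show ?thesis
    proof (cases "M = \<infinity>")
      case True
      then show ?thesis by (simp add: M_def ennreal_mult_top)
    next
      case False
      then obtain r where r: "M = ennreal r" "0 \<le> r" by (cases M) auto
      \<comment> \<open>The previous bound requires \<open>m > 0\<close>, whereas the norm
        \<open>r\<close> may be zero; a small excess is added and then sent to zero.\<close>
      have "num_neg_eigenvalues (lebesgue_on \<Omega>) (schroedinger_op \<Omega> V) \<le> ennreal (8192 * r) + ennreal e" if "e > 0" for e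
      proof -
        have "num_neg_eigenvalues (lebesgue_on \<Omega>) (schroedinger_op \<Omega> V) \<le> ennreal (8192 * (r + e / 8192))"
          using r that by (intro num_neg_eigenvalues_le) (auto simp: M_def intro: ennreal_leI)
        then show ?thesis using r that by (simp add: distrib_left)
      qed
      then have "num_neg_eigenvalues (lebesgue_on \<Omega>) (schroedinger_op \<Omega> V) \<le> ennreal (8192 * r)"
        by (rule ennreal_le_epsilon)
      then show ?thesis using r by (simp add: M_def[symmetric] ennreal_mult)
    qed
  qed
qed simp

end
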